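(* Let $V$ be an $\mathbb{R}$-vector space, let $\tau$ be a locally convex topology on $V$ defined by a directed family $\mathcal{S}$ of seminorms on $V$, and let $\overline{\tau}$ be the finest locally multiplicatively convex topology on the symmetric algebra $S(V)$ extending $\tau$. Let $d\ge 1$ be an integer and let $M$ be a $2d$-power module of $S(V)$. Then a linear functional $L:S(V)\to\mathbb{R}$ is $\overline{\tau}$-continuous and satisfies $L(M)\subseteq[0,\infty)$ if and only if there exist $\rho\in\mathcal{S}$, an integer $i\ge 1$ and a nonnegative Radon measure $\mu$ on the algebraic dual $V^*$ of $V$ such that $L(f)=\int_{V^*}\hat f\,d\mu$ for all $f\in S(V)$ and $\mu$ is supported by $X_M\cap\overline{B}_i(\rho')$.
   Context: $S(V)=\bigoplus_{k\ge0}S(V)_k$ is the symmetric algebra of $V$ (a commutative unital graded $\mathbb{R}$-algebra with $S(V)_0=\mathbb{R}$, $S(V)_1=V$). Seminorms are maps to $[0,\infty)$; a seminorm $\sigma$ on an algebra is submultiplicative if $\sigma(ab)\le\sigma(a)\sigma(b)$ for all $a,b$. A locally convex topology on $V$ is the coarsest topology making all seminorms of some family $\mathcal{S}$ continuous (with the basic neighbourhoods of zero being given by the open seminorm balls and their finite intersections); it is not required to be Hausdorff. The family $\mathcal{S}$ is directed if it is non-empty and for all $\rho_1,\rho_2\in\mathcal{S}$ there are $\rho\in\mathcal{S}$ and $C>0$ with $C\rho\ge\max\{\rho_1,\rho_2\}$ on $V$. A locally multiplicatively convex (lmc) topology on an $\mathbb{R}$-algebra is a topology generated in the same way by a family of submultiplicative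 seminorms. A topology on $S(V)$ extends $\tau$ if it induces $\tau$ on $V=S(V)_1$; a finest lmc topology on $S(V)$ extending $\tau$ exists. A $2d$-power module of a commutative $\mathbb{R}$-algebra $A$ is a subset $M\subseteq A$ with $1\in M$, $M+M\subseteq M$, and $a^{2d}M\subseteq M$ for all $a\in A$. $V^*=\operatorname{Hom}(V,\mathbb{R})$ is the algebraic dual, with the coarsest topology making $v^*\mapsto v^*(f)$ continuous for every $f\in V$. Each $v^*\in V^*$ extends uniquely to a unital $\mathbb{R}$-algebra homomorphism $\overline{v^*}:S(V)\to\mathbb{R}$, and for $f\in S(V)$ one puts $\hat f(v^* ):=\overline{v^*}(f)$. $X_M:=\{v^*\in V^*:\hat g(v^* )\ge0\ \forall g\in M\}$. For a seminorm $\rho$ on $V$, $\rho'(v^* ):=\inf\{C\in[0,\infty):|v^*(w)|\le C\rho(w)\ \forall w\in V\}$ (with $\inf\emptyset=\infty$), and $\overline{B}_i(\rho'):=\{v^*\in V^*:\rho'(v^* )\le i\}$. A measure $\mu$ on $V^*$ is supported by a Borel set $Y\subseteq V^*$ if $\mu(V^*\setminus Y)=0$. *)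

theory Defs
  imports "HOL-Analysis.Analysis" "HOL-Library.Poly_Mapping" "HOL-Library.Multiset"
begin

section \<open>The symmetric algebra\<close>

text \<open>
  The symmetric algebra of a real vector space is the commutative polynomial algebra on the
  set \<open>V\<close> (the monoid algebra over the reals of the free commutative monoid \<open>'v multiset\<close>) modulo
  the ideal that identifies the formal sum and the formal scalar multiple of generators with those
  in \<open>V\<close>.
\<close>

type_synonym 'v free_comm_alg = "'v multiset \<Rightarrow>\<^sub>0 real"

definition free_gen :: "'v \<Rightarrow> 'v free_comm_alg" where
  "free_gen v = Poly_Mapping.single {#v#} 1"

definition free_const :: "real \<Rightarrow> 'v free_comm_alg" where
  "free_const c = Poly_Mapping.single {#} c"

definition sym_relations :: "'v::real_vector free_comm_alg set" where
  "sym_relations =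
     {free_gen (v + w) - free_gen v - free_gen w | v w. True} \<union>
     {free_gen (c *\<^sub>R v) - free_const c * free_gen v | c v. True}"

text \<open>A commutative ring is a module over itself; the span of a set is the ideal it generates.\<close>

lemma module_ring_self: "module ((*) :: 'a::comm_ring_1 \<Rightarrow> 'a \<Rightarrow> 'a)"
  by unfold_locales (simp_all add: algebra_simps)

definition sym_ideal :: "'v::real_vector free_comm_alg set" where
  "sym_ideal = module.span (*) sym_relations"

definition sym_rel :: "'v::real_vector free_comm_alg \<Rightarrow> 'v free_comm_alg \<Rightarrow> bool" where
  "sym_rel p q \<longleftrightarrow> p - q \<in> sym_ideal"

lemma sym_ideal_zero [simp]: "0 \<in> sym_ideal"
  and sym_ideal_add: "p \<in> sym_ideal \<Longrightarrow> q \<in> sym_ideal \<Longrightarrow> p + q \<in> sym_ideal"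
  and sym_ideal_neg: "p \<in> sym_ideal \<Longrightarrow> - p \<in> sym_ideal"
  and sym_ideal_mult: "p \<in> sym_ideal \<Longrightarrow> r * p \<in> sym_ideal"
  unfolding sym_ideal_def
  by (simp_all only: module.span_zero[OF module_ring_self] module.span_add[OF module_ring_self]
      module.span_neg[OF module_ring_self] module.span_scale[OF module_ring_self])

lemma equivp_sym_rel: "equivp (sym_rel :: 'v::real_vector free_comm_alg \<Rightarrow> _)"
proof (rule equivpI)
  show "reflp (sym_rel :: 'v free_comm_alg \<Rightarrow> _)" by (simp add: reflp_def sym_rel_def)
  show "symp (sym_rel :: 'v free_comm_alg \<Rightarrow> _)"
    using sym_ideal_neg by (fastforce simp: symp_def sym_rel_def)
  have "sym_rel p r" if "sym_rel p q" "sym_rel q r" for p q r :: "'v free_comm_alg"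
    using sym_ideal_add[of "p - q" "q - r"] that by (simp add: sym_rel_def)
  then show "transp (sym_rel :: 'v free_comm_alg \<Rightarrow> _)" by (blast intro: transpI)
qed

lemma sym_rel_refl: "p = q \<Longrightarrow> sym_rel p q"
  by (simp add: sym_rel_def)

lemma sym_rel_add: "sym_rel p p' \<Longrightarrow> sym_rel q q' \<Longrightarrow> sym_rel (p + q) (p' + q')"
  unfolding sym_rel_def using sym_ideal_add[of "p - p'" "q - q'"] by (simp add: algebra_simps)

lemma sym_rel_neg: "sym_rel p p' \<Longrightarrow> sym_rel (- p) (- p')"
  unfolding sym_rel_def using sym_ideal_neg[of "p - p'"] by (simp add: algebra_simps)

lemma sym_rel_mult:
  assumes "sym_rel p p'" "sym_rel q q'"
  shows "sym_rel (p * q) (p' * q')"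
proof -
  have "q * (p - p') + p' * (q - q') \<in> sym_ideal"
    using assms by (intro sym_ideal_add sym_ideal_mult) (simp_all add: sym_rel_def)
  then show ?thesis by (simp add: sym_rel_def algebra_simps)
qed

definition free_eval ::
    "('v \<Rightarrow> 'b::{comm_ring_1,real_algebra_1}) \<Rightarrow> 'v free_comm_alg \<Rightarrow> 'b" where
  "free_eval \<phi> p =
     (\<Sum>m\<in>Poly_Mapping.keys p. Poly_Mapping.lookup p m *\<^sub>R (\<Prod>v\<in>#m. \<phi> v))"

lemma free_eval_superset:
  assumes "finite K" "Poly_Mapping.keys p \<subseteq> K"
  shows "free_eval \<phi> p = (\<Sum>m\<in>K. Poly_Mapping.lookup p m *\<^sub>R (\<Prod>v\<in>#m. \<phi> v))"
  unfolding free_eval_def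
  by (rule sum.mono_neutral_left) (use assms in \<open>auto simp: in_keys_iff\<close>)

lemma free_eval_single: "free_eval \<phi> (Poly_Mapping.single m c) = c *\<^sub>R (\<Prod>v\<in>#m. \<phi> v)"
  by (subst free_eval_superset[of "{m}"]) auto

lemma free_eval_0 [simp]: "free_eval \<phi> 0 = 0"
  by (simp add: free_eval_def)

lemma free_eval_add: "free_eval \<phi> (p + q) = free_eval \<phi> p + free_eval \<phi> q"
proof -
  let ?K = "Poly_Mapping.keys p \<union> Poly_Mapping.keys q"
  have "Poly_Mapping.keys (p + q) \<subseteq> ?K" by (rule Poly_Mapping.keys_add)
  then show ?thesis
    by (simp add: free_eval_superset[of ?K] lookup_add scaleR_left_distrib sum.distrib)
qed

lemma free_eval_uminus: "free_eval \<phi> (- p) = - free_eval \<phi> p"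
  using free_eval_add[of \<phi> p "- p"] by (simp add: eq_neg_iff_add_eq_0 add.commute)

lemma free_eval_diff: "free_eval \<phi> (p - q) = free_eval \<phi> p - free_eval \<phi> q"
  using free_eval_add[of \<phi> p "- q"] by (simp add: free_eval_uminus)

lemma free_comm_alg_induct [case_names zero single_add]:
  assumes "P 0" "\<And>m c p. P p \<Longrightarrow> P (Poly_Mapping.single m c + p)"
  shows "P (p :: 'v free_comm_alg)"
proof (induction p rule: update_induct)
  case const
  then show ?case by (rule assms(1))
next
  case (update f a b)
  have "Poly_Mapping.update a b f = Poly_Mapping.single a b + f"
    using update(1)
    by (intro poly_mapping_eqI) (auto simp: lookup_update lookup_add lookup_single in_keys_iff)
  then show ?case using assms(2) update by simp
qed

lemma free_eval_mult: "free_eval \<phi> (p * q) = free_eval \<phi> p * free_eval \<phi> q"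
proof (induction p rule: free_comm_alg_induct)
  case zero
  then show ?case by simp
next
  case (single_add m c p)
  have "free_eval \<phi> (Poly_Mapping.single m c * q)
      = free_eval \<phi> (Poly_Mapping.single m c) * free_eval \<phi> q"
  proof (induction q rule: free_comm_alg_induct)
    case zero
    then show ?case by simp
  next
    case (single_add n d q)
    then show ?case
      by (simp add: distrib_left free_eval_add mult_single free_eval_single mult.commute)
  qed
  then show ?case using single_add by (simp add: distrib_right free_eval_add)
qed

lemma free_eval_sym_relations:
  assumes "linear \<phi>" "p \<in> sym_relations"
  shows "free_eval \<phi> p = 0"
  using assms(2) unfolding sym_relations_def
  by (auto simp: free_gen_def free_const_def free_eval_diff free_eval_mult free_eval_single
      linear_add[OF assms(1)] linear_scale[OF assms(1)])

lemma free_eval_sym_ideal: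
  assumes "linear \<phi>" "p \<in> sym_ideal"
  shows "free_eval \<phi> p = 0"
proof -
  interpret module "(*) :: 'a free_comm_alg \<Rightarrow> _" by (rule module_ring_self)
  show ?thesis
    using assms(2) unfolding sym_ideal_def
    by (induction rule: span_induct_alt)
       (simp_all add: free_eval_add free_eval_mult free_eval_sym_relations[OF assms(1)])
qed

quotient_type (overloaded) 'v sym_alg = "'v::real_vector free_comm_alg" / sym_rel
  by (rule equivp_sym_rel)

instantiation sym_alg :: (real_vector) comm_ring_1
begin

lift_definition zero_sym_alg :: "'a sym_alg" is 0 .
lift_definition one_sym_alg :: "'a sym_alg" is 1 .
lift_definition plus_sym_alg :: "'a sym_alg \<Rightarrow> 'a sym_alg \<Rightarrow> 'a sym_alg" is "(+)"
  by (rule sym_rel_add)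
lift_definition uminus_sym_alg :: "'a sym_alg \<Rightarrow> 'a sym_alg" is uminus
  by (rule sym_rel_neg)
lift_definition minus_sym_alg :: "'a sym_alg \<Rightarrow> 'a sym_alg \<Rightarrow> 'a sym_alg" is "(-)"
  using sym_rel_add sym_rel_neg by (metis add_uminus_conv_diff)
lift_definition times_sym_alg :: "'a sym_alg \<Rightarrow> 'a sym_alg \<Rightarrow> 'a sym_alg" is "(*)"
  by (rule sym_rel_mult)

instance
proof
  show "(0 :: 'a sym_alg) \<noteq> 1"
  proof transfer
    have "free_eval (\<lambda>v::'a. 0::real) (0 - 1) \<noteq> 0"
      unfolding free_eval_diff single_one[symmetric] by (simp only: free_eval_single) simp
    then show "\<not> sym_rel 0 (1 :: 'a free_comm_alg)"
      using free_eval_sym_ideal[OF linear_zero] unfolding sym_rel_def by blast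
  qed
  fix a b c :: "'a sym_alg"
  show "a * b * c = a * (b * c)" by transfer (intro sym_rel_refl mult.assoc)
  show "a * b = b * a" by transfer (intro sym_rel_refl mult.commute)
  show "1 * a = a" by transfer (intro sym_rel_refl mult_1_left)
  show "(a + b) * c = a * c + b * c" by transfer (intro sym_rel_refl distrib_right)
  show "a + b + c = a + (b + c)" by transfer (intro sym_rel_refl add.assoc)
  show "a + b = b + a" by transfer (intro sym_rel_refl add.commute)
  show "0 + a = a" by transfer (intro sym_rel_refl add_0_left)
  show "- a + a = 0" by transfer (intro sym_rel_refl left_minus)
  show "a - b = a + - b" by transfer (intro sym_rel_refl diff_conv_add_uminus)
qed

end

instantiation sym_alg :: (real_vector) real_algebra_1
begin

lift_definition scaleR_sym_alg :: "real \<Rightarrow> 'a sym_alg \<Rightarrow> 'a sym_alg"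
  is "\<lambda>c p. free_const c * p"
  by (rule sym_rel_mult[OF sym_rel_refl[OF refl]])

instance
proof
  fix a b :: real and x y :: "'a sym_alg"
  show "a *\<^sub>R (x + y) = a *\<^sub>R x + a *\<^sub>R y"
    by transfer (intro sym_rel_refl distrib_left)
  show "(a + b) *\<^sub>R x = a *\<^sub>R x + b *\<^sub>R x"
    by transfer (intro sym_rel_refl, simp only: free_const_def single_add distrib_right)
  show "a *\<^sub>R b *\<^sub>R x = (a * b) *\<^sub>R x"
    by transfer (intro sym_rel_refl, simp add: free_const_def mult_single mult.assoc[symmetric]
        del: single_zero)
  show "1 *\<^sub>R x = x"
    by transfer (intro sym_rel_refl, simp add: free_const_def flip: zero_multiset_def)
  show "a *\<^sub>R x * y = a *\<^sub>R (x * y)"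
    by transfer (intro sym_rel_refl mult.assoc)
  show "x * a *\<^sub>R y = a *\<^sub>R (x * y)"
    by transfer (intro sym_rel_refl mult.left_commute)
qed

end

text \<open>The canonical map of \<open>V\<close> onto the degree-one part of its symmetric algebra.\<close>

lift_definition sym_embed :: "'v::real_vector \<Rightarrow> 'v sym_alg" is free_gen .

text \<open>The extension of a linear map to an algebra homomorphism; for nonlinear arguments the value
  is irrelevant.\<close>

definition sym_lift ::
    "('v::real_vector \<Rightarrow> 'b::{comm_ring_1,real_algebra_1}) \<Rightarrow> 'v sym_alg \<Rightarrow> 'b" where
  "sym_lift \<phi> f = free_eval \<phi> (rep_sym_alg f)"

definition alg_hom ::
    "('a::{comm_ring_1,real_algebra_1} \<Rightarrow> 'b::{comm_ring_1,real_algebra_1}) \<Rightarrow> bool" where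
  "alg_hom h \<longleftrightarrow> linear h \<and> h 1 = 1 \<and> (\<forall>a b. h (a * b) = h a * h b)"

lemma linear_sym_embed: "linear sym_embed"
proof (rule linearI)
  fix v w :: 'a and c :: real
  show "sym_embed (v + w) = sym_embed v + sym_embed w"
  proof transfer
    fix v w :: 'a
    have "free_gen (v + w) - free_gen v - free_gen w \<in> sym_relations"
      unfolding sym_relations_def by blast
    then show "sym_rel (free_gen (v + w)) (free_gen v + free_gen w)"
      using module.span_base[OF module_ring_self] by (force simp: sym_rel_def sym_ideal_def diff_diff_eq)
  qed
  show "sym_embed (c *\<^sub>R v) = c *\<^sub>R sym_embed v"
  proof transfer
    fix v :: 'a and c :: real
    have "free_gen (c *\<^sub>R v) - free_const c * free_gen v \<in> sym_relations"
      unfolding sym_relations_def by blast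
    then show "sym_rel (free_gen (c *\<^sub>R v)) (free_const c * free_gen v)"
      using module.span_base[OF module_ring_self] by (force simp: sym_rel_def sym_ideal_def)
  qed
qed

lemma sym_lift_abs:
  assumes "linear \<phi>"
  shows "sym_lift \<phi> (abs_sym_alg p) = free_eval \<phi> p"
proof -
  have "sym_rel (rep_sym_alg (abs_sym_alg p)) p"
    using Quotient3_rep_abs[OF Quotient3_sym_alg] equivp_reflp[OF equivp_sym_rel] by blast
  then have "free_eval \<phi> (rep_sym_alg (abs_sym_alg p) - p) = 0"
    using free_eval_sym_ideal[OF assms] by (simp add: sym_rel_def)
  then show ?thesis by (simp add: sym_lift_def free_eval_diff)
qed

lemma sym_alg_abs_cases: obtains p where "f = abs_sym_alg p"
  by (metis Quotient3_abs_rep[OF Quotient3_sym_alg])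

lemma alg_hom_sym_lift:
  assumes "linear \<phi>"
  shows "alg_hom (sym_lift \<phi>)"
  unfolding alg_hom_def
proof (intro conjI allI)
  note sl = sym_lift_abs[OF assms]
  show "linear (sym_lift \<phi>)"
  proof (rule linearI)
    fix f g :: "'a sym_alg" and c :: real
    obtain p q where [simp]: "f = abs_sym_alg p" "g = abs_sym_alg q"
      by (metis sym_alg_abs_cases)
    show "sym_lift \<phi> (f + g) = sym_lift \<phi> f + sym_lift \<phi> g"
      by (simp add: plus_sym_alg.abs_eq sl free_eval_add)
    show "sym_lift \<phi> (c *\<^sub>R f) = c *\<^sub>R sym_lift \<phi> f"
      by (simp add: scaleR_sym_alg.abs_eq sl free_eval_mult free_const_def free_eval_single)
  qed
  show "sym_lift \<phi> 1 = 1"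
    unfolding one_sym_alg_def sl single_one[symmetric] by (simp only: free_eval_single) simp
  fix f g :: "'a sym_alg"
  obtain p q where [simp]: "f = abs_sym_alg p" "g = abs_sym_alg q"
    by (metis sym_alg_abs_cases)
  show "sym_lift \<phi> (f * g) = sym_lift \<phi> f * sym_lift \<phi> g"
    by (simp add: times_sym_alg.abs_eq sl free_eval_mult)
qed

lemma sym_lift_embed: "linear \<phi> \<Longrightarrow> sym_lift \<phi> (sym_embed v) = \<phi> v"
  by (simp add: sym_embed.abs_eq sym_lift_abs free_gen_def free_eval_single)

lemma sym_lift_unique:
  assumes "alg_hom h" "\<And>v. h (sym_embed v) = \<phi> v" "linear \<phi>"
  shows "h = sym_lift \<phi>"
proof
  have lin: "linear h" and h1: "h 1 = 1" and hm: "\<And>a b. h (a * b) = h a * h b"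
    using assms(1) by (auto simp: alg_hom_def)
  have mono: "h (abs_sym_alg (Poly_Mapping.single m 1)) = (\<Prod>v\<in>#m. \<phi> v)" for m
  proof (induction m)
    case empty
    then show ?case using h1 by (simp add: one_sym_alg_def)
  next
    case (add v m)
    have "abs_sym_alg (Poly_Mapping.single (add_mset v m) 1)
        = sym_embed v * abs_sym_alg (Poly_Mapping.single m 1)"
      by (simp add: sym_embed.abs_eq times_sym_alg.abs_eq free_gen_def mult_single)
    then show ?case using add by (simp add: hm assms(2))
  qed
  have "h (abs_sym_alg p) = free_eval \<phi> p" for p
  proof (induction p rule: free_comm_alg_induct)
    case zero
    then show ?case using linear_0[OF lin] by (simp add: zero_sym_alg_def)
  next
    case (single_add m c p)
    have "abs_sym_alg (Poly_Mapping.single m c + p)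
        = c *\<^sub>R abs_sym_alg (Poly_Mapping.single m 1) + abs_sym_alg p"
      by (simp add: plus_sym_alg.abs_eq scaleR_sym_alg.abs_eq free_const_def mult_single)
    then show ?case
      by (simp add: linear_add[OF lin] linear_scale[OF lin] mono single_add free_eval_add
          free_eval_single)
  qed
  then show "h f = sym_lift \<phi> f" for f
    by (metis sym_alg_abs_cases sym_lift_abs[OF assms(3)])
qed

theorem sym_alg_universal:
  fixes \<phi> :: "'v::real_vector \<Rightarrow> 'b::{comm_ring_1,real_algebra_1}"
  assumes "linear \<phi>"
  shows "\<exists>!h. alg_hom h \<and> (\<forall>v. h (sym_embed v) = \<phi> v)"
  using alg_hom_sym_lift[OF assms] sym_lift_embed[OF assms] sym_lift_unique[OF _ _ assms]
  by metis

lemma inj_sym_embed: "inj (sym_embed :: 'v::real_vector \<Rightarrow> 'v sym_alg)"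
proof (rule linear_injective_0[OF linear_sym_embed, THEN iffD2, rule_format])
  fix v :: 'v assume *: "sym_embed v = 0"
  show "v = 0"
  proof (rule ccontr)
    assume "v \<noteq> 0"
    then have "independent {v}" by simp
    then obtain l :: "'v \<Rightarrow> real" where l: "linear l" "l v = 1"
      using linear_independent_extend[of "{v}" "\<lambda>_. 1"] by auto
    then have "sym_lift l (sym_embed v) = 1" by (simp add: sym_lift_embed)
    then show False
      using * alg_hom_sym_lift[OF l(1)] linear_0 unfolding alg_hom_def by fastforce
  qed
qed


section \<open>The algebraic dual\<close>

typedef (overloaded) 'v alg_dual = "{l :: 'v::real_vector \<Rightarrow> real. linear l}"
  morphisms dual_apply Abs_alg_dual
  using linear_zero by blast

lemma linear_dual_apply: "linear (dual_apply l)"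
  using dual_apply by simp

instantiation alg_dual :: (real_vector) topological_space
begin

definition open_alg_dual :: "'a alg_dual set \<Rightarrow> bool" where
  "open_alg_dual = generate_topology {{l. dual_apply l v \<in> W} | v W. open W}"

instance
proof
  show "open (UNIV :: 'a alg_dual set)"
    unfolding open_alg_dual_def by (rule generate_topology.UNIV)
  show "open (U \<inter> W)" if "open U" "open W" for U W :: "'a alg_dual set"
    using that unfolding open_alg_dual_def by (rule generate_topology.Int)
  show "open (\<Union>K)" if "\<forall>U\<in>K. open U" for K :: "'a alg_dual set set"
    using that unfolding open_alg_dual_def by (blast intro: generate_topology.UN)
qed

end

lemma open_dual_apply_vimage: "open W \<Longrightarrow> open {l. dual_apply l v \<in> W}"
  unfolding open_alg_dual_def by (rule generate_topology.Basis) blast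

instance alg_dual :: (real_vector) t2_space
proof
  fix k l :: "'a alg_dual" assume "k \<noteq> l"
  then obtain v where v: "dual_apply k v \<noteq> dual_apply l v"
    by (metis dual_apply_inject ext)
  obtain U W where UW: "open U" "open W" "dual_apply k v \<in> U" "dual_apply l v \<in> W" "U \<inter> W = {}"
    using hausdorff[OF v] by blast
  show "\<exists>U W. open U \<and> open W \<and> k \<in> U \<and> l \<in> W \<and> U \<inter> W = {}"
    using UW
    by (intro exI[of _ "{l. dual_apply l v \<in> U}"] exI[of _ "{l. dual_apply l v \<in> W}"])
       (auto intro: open_dual_apply_vimage)
qed

definition hat :: "'v::real_vector sym_alg \<Rightarrow> 'v alg_dual \<Rightarrow> real" where
  "hat f l = sym_lift (dual_apply l) f"


section \<open>Seminorms and the topologies they generate\<close>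

definition seminorm :: "('a::real_vector \<Rightarrow> real) \<Rightarrow> bool" where
  "seminorm \<rho> \<longleftrightarrow> (\<forall>x. 0 \<le> \<rho> x) \<and> (\<forall>c x. \<rho> (c *\<^sub>R x) = \<bar>c\<bar> * \<rho> x) \<and>
     (\<forall>x y. \<rho> (x + y) \<le> \<rho> x + \<rho> y)"

definition submultiplicative :: "('a::times \<Rightarrow> real) \<Rightarrow> bool" where
  "submultiplicative \<sigma> \<longleftrightarrow> (\<forall>a b. \<sigma> (a * b) \<le> \<sigma> a * \<sigma> b)"

definition directed_family :: "('a \<Rightarrow> real) set \<Rightarrow> bool" where
  "directed_family S \<longleftrightarrow> S \<noteq> {} \<and>
     (\<forall>\<rho>1\<in>S. \<forall>\<rho>2\<in>S. \<exists>\<rho>\<in>S. \<exists>C>0. \<forall>x. max (\<rho>1 x) (\<rho>2 x) \<le> C * \<rho> x)"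

text \<open>The translation-invariant topology whose basic neighbourhoods of zero are the finite
  intersections of open seminorm balls.  The whole space is added to the subbasis so that the empty
  family yields the indiscrete topology.\<close>

definition seminorm_topology :: "('a::real_vector \<Rightarrow> real) set \<Rightarrow> 'a topology" where
  "seminorm_topology S =
     topology_generated_by (insert UNIV {{y. \<rho> (y - x) < e} | \<rho> x e. \<rho> \<in> S \<and> e > 0})"

definition lmc_topology :: "'a::{comm_ring_1,real_algebra_1} topology \<Rightarrow> bool" where
  "lmc_topology T \<longleftrightarrow>
     (\<exists>F. (\<forall>\<sigma>\<in>F. seminorm \<sigma> \<and> submultiplicative \<sigma>) \<and> T = seminorm_topology F)"

definition extends_topology :: "'v::real_vector topology \<Rightarrow> 'v sym_alg topology \<Rightarrow> bool" where
  "extends_topology \<tau> T \<longleftrightarrow> pullback_topology UNIV sym_embed T = \<tau>"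

definition finest_lmc_extension :: "'v::real_vector topology \<Rightarrow> 'v sym_alg topology \<Rightarrow> bool" where
  "finest_lmc_extension \<tau> T \<longleftrightarrow> lmc_topology T \<and> extends_topology \<tau> T \<and>
     (\<forall>T'. lmc_topology T' \<and> extends_topology \<tau> T' \<longrightarrow> (\<forall>U. openin T' U \<longrightarrow> openin T U))"

definition dual_seminorm :: "('v::real_vector \<Rightarrow> real) \<Rightarrow> 'v alg_dual \<Rightarrow> ennreal" where
  "dual_seminorm \<rho> l = Inf {ennreal C | C. 0 \<le> C \<and> (\<forall>w. \<bar>dual_apply l w\<bar> \<le> C * \<rho> w)}"

definition dual_ball :: "('v::real_vector \<Rightarrow> real) \<Rightarrow> nat \<Rightarrow> 'v alg_dual set" where
  "dual_ball \<rho> i = {l. dual_seminorm \<rho> l \<le> of_nat i}"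


section \<open>Power modules, the nonnegativity set and Radon measures\<close>

definition power_module :: "nat \<Rightarrow> 'a::comm_ring_1 set \<Rightarrow> bool" where
  "power_module n M \<longleftrightarrow> 1 \<in> M \<and> (\<forall>x\<in>M. \<forall>y\<in>M. x + y \<in> M) \<and> (\<forall>a. \<forall>x\<in>M. a ^ n * x \<in> M)"

definition nonneg_set :: "'v::real_vector sym_alg set \<Rightarrow> 'v alg_dual set" where
  "nonneg_set M = {l. \<forall>g\<in>M. 0 \<le> hat g l}"

definition radon_measure :: "'a::t2_space measure \<Rightarrow> bool" where
  "radon_measure \<mu> \<longleftrightarrow> sets \<mu> = sets borel \<and>
     (\<forall>x. \<exists>U. open U \<and> x \<in> U \<and> emeasure \<mu> U < \<infinity>) \<and>
     (\<forall>B\<in>sets borel. emeasure \<mu> B = (SUP K\<in>{K. compact K \<and> K \<subseteq> B}. emeasure \<mu> K))"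

text \<open>Measurability of the support has to be demanded because \<^const>\<open>emeasure\<close> is zero
  on non-measurable sets.\<close>

definition supported_by :: "'a::topological_space measure \<Rightarrow> 'a set \<Rightarrow> bool" where
  "supported_by \<mu> Y \<longleftrightarrow> Y \<in> sets borel \<and> emeasure \<mu> (UNIV - Y) = 0"

end

(* A continuous functional L is bounded by C \<sigma> for a submultiplicative seminorm \<sigma> whose restriction to V
   is at most i \<rho>.  If \<sigma> a < 1, the partial sums of the binomial series show that 1 + a is a \<sigma>-limit of
   2d-th powers, so the elements b with L(g b) \<ge> 0 for all g in M are stable under multiplication by
   r + a whenever \<sigma> a \<le> r.  Bernstein polynomials are positive combinations of products of such factors,
   hence L(g f) \<ge> 0 for every polynomial f that is nonnegative on a box in the product space of all
   functions on V; compactness improves this to f nonnegative on the dual ball.  By the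
   Stone-Weierstrass and Riesz theorems L is integration against a Radon measure \<mu> on the dual ball, and
   testing the positivity of f \<mapsto> L(g f) with approximations of the negative part of g shows that \<mu>
   lives where g \<ge> 0.  Conversely, the supremum over the dual ball is a submultiplicative seminorm
   dominating L, and adding it to a defining family of the finest topology does not change that topology. *)

theory Submission
  imports Defs "HOL-Real_Asymp.Real_Asymp"
begin

section \<open>Seminorms and seminorm topologies\<close>

text \<open>The algebra with the seminorm \<open>\<sigma>\<close> need be neither complete nor
  Hausdorff, so \<open>1 + a\<close> need not have an actual root; roots occur only as limits of
  \<open>m\<close>-th powers, inside sets that are closed under such limits because \<open>L\<close>
  is bounded by \<open>\<sigma>\<close>. The factors \<open>r v \<plusminus> a v\<close>, one pair
  for each vector \<open>v\<close>, know nothing of the linear relations between vectors. This is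
  why positivity is first available on a box of arbitrary functions on \<open>V\<close>, for formal
  polynomials in the free algebra, and why the passage to linear functionals is a separate step:
  squares of the defining relations, which vanish in \<open>S(V)\<close>, are added as a penalty.
  The functionals \<open>f \<mapsto> L (g * f)\<close> for all \<open>g \<in> M\<close> are treated
  together, since positivity of \<open>L\<close> alone would give \<open>\<mu>\<close> but not its
  support. As \<open>M\<close> may be uncountable, the exceptional null sets of the single
  \<open>g\<close> cannot be united by countable additivity; inner regularity of
  \<open>\<mu>\<close> does it.\<close>

lemma le_zero_if_le_mult_epsilon:
  fixes a c :: real
  assumes "\<And>e. e > 0 \<Longrightarrow> a \<le> e * c" "0 \<le> c"
  shows "a \<le> 0"
proof (rule field_le_epsilon)
  fix e :: real assume e: "e > 0"
  have "a \<le> e / (c + 1) * c" using e assms(2) by (intro assms(1)) simp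
  also have "\<dots> \<le> e" using e assms(2) by (simp add: field_simps)
  finally show "a \<le> 0 + e" by simp
qed

lemma seminorm_nonneg: "seminorm \<rho> \<Longrightarrow> 0 \<le> \<rho> x"
  and seminorm_scaleR: "seminorm \<rho> \<Longrightarrow> \<rho> (c *\<^sub>R x) = \<bar>c\<bar> * \<rho> x"
  and seminorm_triangle: "seminorm \<rho> \<Longrightarrow> \<rho> (x + y) \<le> \<rho> x + \<rho> y"
  by (auto simp: seminorm_def)

lemma seminorm_zero: "seminorm \<rho> \<Longrightarrow> \<rho> 0 = 0"
  using seminorm_scaleR[of \<rho> 0 0] by simp

lemma seminorm_uminus: "seminorm \<rho> \<Longrightarrow> \<rho> (- x) = \<rho> x"
  using seminorm_scaleR[of \<rho> "-1" x] by simp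

lemma seminorm_sum_le: "seminorm \<rho> \<Longrightarrow> \<rho> (\<Sum>i\<in>I. f i) \<le> (\<Sum>i\<in>I. \<rho> (f i))"
proof (induction I rule: infinite_finite_induct)
  case (insert i I)
  then show ?case using seminorm_triangle[of \<rho> "f i" "sum f I"] by simp
qed (simp_all add: seminorm_zero)

lemma submultiplicativeD: "submultiplicative \<sigma> \<Longrightarrow> \<sigma> (a * b) \<le> \<sigma> a * \<sigma> b"
  by (simp add: submultiplicative_def)

text \<open>Homogeneity turns an inclusion of balls into a bound: rescaling \<open>x\<close> to
  \<open>q\<close>-length \<open>e / 2\<close> produces the factor \<open>2 / e\<close>. If
  \<open>q x = 0\<close>, every multiple of \<open>x\<close> lies in the \<open>q\<close>-ball,
  which forces \<open>p x = 0\<close>.\<close>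

lemma seminorm_dominated:
  assumes "seminorm p" "seminorm q" "e > 0" and imp: "\<And>x. q x < e \<Longrightarrow> p x < 1"
  shows "p x \<le> (2 / e) * q x"
proof (cases "q x = 0")
  case True
  have "p x = 0"
  proof (rule ccontr)
    assume "p x \<noteq> 0"
    then have "p x > 0" using seminorm_nonneg[OF assms(1), of x] by linarith
    then have "p ((1 / p x) *\<^sub>R x) = 1"
      by (simp add: seminorm_scaleR[OF assms(1)])
    moreover have "q ((1 / p x) *\<^sub>R x) = 0"
      by (simp add: seminorm_scaleR[OF assms(2)] True)
    ultimately show False using imp[of "(1 / p x) *\<^sub>R x"] \<open>e > 0\<close> by simp
  qed
  then show ?thesis using True by simp
next
  case False
  then have q: "q x > 0" using seminorm_nonneg[OF assms(2), of x] by linarith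
  let ?c = "e / (2 * q x)"
  have c: "?c > 0" using q \<open>e > 0\<close> by simp
  have "q (?c *\<^sub>R x) = e / 2"
    using q \<open>e > 0\<close> by (simp add: seminorm_scaleR[OF assms(2)])
  then have "p (?c *\<^sub>R x) < 1" using \<open>e > 0\<close> by (intro imp) simp
  then have "?c * p x < 1" using c by (simp only: seminorm_scaleR[OF assms(1)] abs_of_pos)
  then show ?thesis using q \<open>e > 0\<close> by (simp add: pos_divide_less_eq pos_le_divide_eq mult.commute)
qed

lemma topspace_seminorm_topology [simp]: "topspace (seminorm_topology S) = UNIV"
  by (simp add: seminorm_topology_def)

lemma openin_seminorm_topology_ball:
  "\<rho> \<in> S \<Longrightarrow> e > 0 \<Longrightarrow> openin (seminorm_topology S) {y. \<rho> (y - x) < e}"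
  unfolding seminorm_topology_def by (intro topology_generated_by_Basis) auto

text \<open>The subbasic balls have arbitrary centres; by the triangle inequality each contains a
  smaller ball around any of its points, and finite intersections get a common radius. The empty
  \<open>F\<close> accounts for the subbasic set \<open>UNIV\<close>.\<close>

lemma openin_seminorm_topology_iff:
  assumes sn: "\<forall>\<rho>\<in>S. seminorm \<rho>"
  shows "openin (seminorm_topology S) U \<longleftrightarrow>
    (\<forall>x\<in>U. \<exists>F e. finite F \<and> F \<subseteq> S \<and> e > 0 \<and> {y. \<forall>\<rho>\<in>F. \<rho> (y - x) < e} \<subseteq> U)"
proof
  assume "openin (seminorm_topology S) U"
  then have "generate_topology_on (insert UNIV {{y. \<rho> (y - x) < e} | \<rho> x e. \<rho> \<in> S \<and> e > 0}) U"
    by (simp add: seminorm_topology_def openin_topology_generated_by)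
  then show "\<forall>x\<in>U. \<exists>F e. finite F \<and> F \<subseteq> S \<and> e > 0 \<and> {y. \<forall>\<rho>\<in>F. \<rho> (y - x) < e} \<subseteq> U"
  proof induction
    case Empty
    then show ?case by simp
  next
    case (Int a b)
    show ?case
    proof
      fix x assume "x \<in> a \<inter> b"
      then have "x \<in> a" "x \<in> b" by auto
      from bspec[OF Int.IH(1) this(1)] bspec[OF Int.IH(2) this(2)]
      obtain F e G d where *: "finite F" "F \<subseteq> S" "e > 0" "{y. \<forall>\<rho>\<in>F. \<rho> (y - x) < e} \<subseteq> a"
        "finite G" "G \<subseteq> S" "d > 0" "{y. \<forall>\<rho>\<in>G. \<rho> (y - x) < d} \<subseteq> b"
        by (elim exE conjE)
      show "\<exists>F e. finite F \<and> F \<subseteq> S \<and> e > 0 \<and> {y. \<forall>\<rho>\<in>F. \<rho> (y - x) < e} \<subseteq> a \<inter> b"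
        using * by (intro exI[of _ "F \<union> G"] exI[of _ "min e d"]) auto
    qed
  next
    case (UN K)
    then show ?case by (meson Sup_upper UnionE subset_trans)
  next
    case (Basis s)
    then consider "s = UNIV" | \<rho> x e where "s = {y. \<rho> (y - x) < e}" "\<rho> \<in> S" "e > 0" by auto
    then show ?case
    proof cases
      case 1
      then show ?thesis by (auto intro!: exI[of _ "{}"] exI[of _ 1])
    next
      case (2 \<rho> x e)
      show ?thesis
      proof
        fix z assume z: "z \<in> s"
        have "\<rho> (y - x) < e" if "\<rho> (y - z) < e - \<rho> (z - x)" for y
          using seminorm_triangle[of \<rho> "y - z" "z - x"] sn 2(2) that by simp
        then show "\<exists>F e. finite F \<and> F \<subseteq> S \<and> e > 0 \<and> {y. \<forall>\<rho>\<in>F. \<rho> (y - z) < e} \<subseteq> s"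
          using 2 z by (intro exI[of _ "{\<rho>}"] exI[of _ "e - \<rho> (z - x)"]) auto
      qed
    qed
  qed
next
  assume *: "\<forall>x\<in>U. \<exists>F e. finite F \<and> F \<subseteq> S \<and> e > 0 \<and> {y. \<forall>\<rho>\<in>F. \<rho> (y - x) < e} \<subseteq> U"
  show "openin (seminorm_topology S) U"
  proof (subst openin_subopen, intro ballI)
    fix x assume "x \<in> U"
    then obtain F e where F: "finite F" "F \<subseteq> S" "e > 0" "{y. \<forall>\<rho>\<in>F. \<rho> (y - x) < e} \<subseteq> U"
      using * by meson
    let ?B = "\<Inter>\<rho>\<in>F. {y. \<rho> (y - x) < e}"
    have "openin (seminorm_topology S) ?B"
    proof (cases "F = {}")
      case True
      then show ?thesis using openin_topspace[of "seminorm_topology S"] by simp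
    next
      case False
      then show ?thesis
        using F by (intro openin_INT2 openin_seminorm_topology_ball) auto
    qed
    moreover have "?B \<subseteq> U" using F(4) by auto
    moreover have "x \<in> ?B"
      using F sn by (auto simp: seminorm_zero)
    ultimately show "\<exists>T. openin (seminorm_topology S) T \<and> x \<in> T \<and> T \<subseteq> U"
      by (intro exI[of _ ?B] conjI)
  qed
qed

lemma seminorm_topology_mono:
  assumes "S \<subseteq> T" "\<forall>\<rho>\<in>T. seminorm \<rho>" "openin (seminorm_topology S) U"
  shows "openin (seminorm_topology T) U"
proof -
  have S: "\<forall>\<rho>\<in>S. seminorm \<rho>" using assms by auto
  show ?thesis
    unfolding openin_seminorm_topology_iff[OF assms(2)]
  proof
    fix x assume "x \<in> U"
    with assms(3) obtain F e where "finite F" "F \<subseteq> S" "e > 0" "{y. \<forall>\<rho>\<in>F. \<rho> (y - x) < e} \<subseteq> U"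
      unfolding openin_seminorm_topology_iff[OF S] by meson
    with assms(1) show "\<exists>F e. finite F \<and> F \<subseteq> T \<and> e > 0 \<and> {y. \<forall>\<rho>\<in>F. \<rho> (y - x) < e} \<subseteq> U"
      by (intro exI[of _ F] exI[of _ e] conjI) (assumption | blast)+
  qed
qed

section \<open>Bounds by a single seminorm\<close>

lemma directed_family_finite_bound:
  assumes "directed_family S" "\<forall>\<rho>\<in>S. seminorm \<rho>" "finite F" "F \<subseteq> S"
  shows "\<exists>\<rho>\<in>S. \<exists>C>0. \<forall>\<rho>'\<in>F. \<forall>x. \<rho>' x \<le> C * \<rho> x"
  using assms(3,4)
proof induction
  case empty
  then show ?case using assms(1) by (auto simp: directed_family_def intro: zero_less_one)
next
  case (insert \<rho>1 F)
  then obtain \<rho>2 C where 2: "\<rho>2 \<in> S" "C > 0" "\<forall>\<rho>'\<in>F. \<forall>x. \<rho>' x \<le> C * \<rho>2 x" by auto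
  obtain \<rho> D where \<rho>: "\<rho> \<in> S" "D > 0" "\<forall>x. max (\<rho>1 x) (\<rho>2 x) \<le> D * \<rho> x"
    using assms(1) 2(1) insert.prems unfolding directed_family_def by (meson insert_subset)
  \<comment> \<open>The factor \<open>C + 1\<close> serves both cases: it is at least
    \<open>1\<close> for \<open>\<rho>1\<close> and at least \<open>C\<close> for the members of
    \<open>F\<close>.\<close>
  have "\<rho>' x \<le> ((C + 1) * D) * \<rho> x" if "\<rho>' \<in> insert \<rho>1 F" for \<rho>' x
  proof -
    have nn: "0 \<le> D * \<rho> x" using \<rho> assms(2) by (simp add: seminorm_nonneg)
    have m: "\<rho>1 x \<le> D * \<rho> x" "\<rho>2 x \<le> D * \<rho> x" using \<rho>(3) by (auto simp: max_def split: if_splits elim!: allE[of _ x])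
    show ?thesis
    proof (cases "\<rho>' = \<rho>1")
      case True
      have "0 \<le> C * (D * \<rho> x)" using nn 2 by simp
      then show ?thesis using m True by (simp add: algebra_simps)
    next
      case False
      then have "\<rho>' x \<le> C * \<rho>2 x" using 2 that by auto
      also have "\<dots> \<le> C * (D * \<rho> x)" using m 2 by simp
      finally show ?thesis using nn by (simp add: algebra_simps)
    qed
  qed
  moreover have "(C + 1) * D > 0" using \<rho> 2 by simp
  ultimately show ?case using \<rho>(1) by blast
qed

text \<open>The maximum of finitely many submultiplicative seminorms is again one, so the finitely
  many seminorms that control \<open>L\<close> near zero merge into a single
  \<open>\<sigma>\<close>. Openness of its unit ball is recorded in order to be pulled back to
  \<open>V\<close> later.\<close>

lemma continuous_functional_bound:
  fixes L :: "'a::{comm_ring_1,real_algebra_1} \<Rightarrow> real"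
  assumes lmc: "lmc_topology T" and lin: "linear L" and cont: "continuous_map T euclideanreal L"
  obtains \<sigma> C where "seminorm \<sigma>" "submultiplicative \<sigma>" "C > 0" "\<And>f. \<bar>L f\<bar> \<le> C * \<sigma> f"
    "openin T {f. \<sigma> f < 1}"
proof -
  obtain F where F: "\<forall>\<sigma>\<in>F. seminorm \<sigma> \<and> submultiplicative \<sigma>" and T: "T = seminorm_topology F"
    using lmc unfolding lmc_topology_def by blast
  have Fs: "\<forall>\<sigma>\<in>F. seminorm \<sigma>" using F by blast
  have "openin T {f \<in> topspace T. L f \<in> {-1<..<1}}"
    using openin_continuous_map_preimage[OF cont, of "{-1<..<1}"] by simp
  then have "openin T {f. L f \<in> {-1<..<1}}" by (simp add: T)
  moreover have "0 \<in> {f. L f \<in> {-1<..<1}}" using linear_0[OF lin] by simp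
  ultimately obtain G e where G: "finite G" "G \<subseteq> F" "e > 0"
      "{y. \<forall>\<rho>\<in>G. \<rho> (y - 0) < e} \<subseteq> {f. L f \<in> {-1<..<1}}"
    unfolding T openin_seminorm_topology_iff[OF Fs] by meson
  \<comment> \<open>Inserting \<open>0\<close> gives the maximum a value when \<open>G\<close> is
    empty; otherwise it changes nothing, as seminorms are nonnegative.\<close>
  define \<sigma> where "\<sigma> f = Max (insert 0 ((\<lambda>\<rho>. \<rho> f) ` G))" for f
  have Gs: "seminorm \<rho>" "submultiplicative \<rho>" if "\<rho> \<in> G" for \<rho> using F G that by auto
  have le: "\<rho> f \<le> \<sigma> f" if "\<rho> \<in> G" for \<rho> f
    using that G(1) unfolding \<sigma>_def by (intro Max_ge) auto
  have nn: "0 \<le> \<sigma> f" for f using G(1) unfolding \<sigma>_def by (intro Max_ge) auto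
  have leI: "\<sigma> f \<le> c" if "0 \<le> c" "\<And>\<rho>. \<rho> \<in> G \<Longrightarrow> \<rho> f \<le> c" for f c
    unfolding \<sigma>_def using G(1) that by (subst Max_le_iff) auto
  have less_iff: "\<sigma> f < c \<longleftrightarrow> (\<forall>\<rho>\<in>G. \<rho> f < c)" if "0 < c" for f c
    unfolding \<sigma>_def using G(1) that by (subst Max_less_iff) auto
  have \<sigma>le: "\<sigma> (c *\<^sub>R f) \<le> \<bar>c\<bar> * \<sigma> f" for c f
    using Gs nn by (intro leI) (auto simp: seminorm_scaleR le mult_left_mono)
  have "\<sigma> (c *\<^sub>R f) = \<bar>c\<bar> * \<sigma> f" for c f
  proof (cases "c = 0")
    case True
    then show ?thesis using \<sigma>le[of 0 f] nn[of 0] by simp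
  next
    case False
    have "\<sigma> f \<le> \<bar>1 / c\<bar> * \<sigma> (c *\<^sub>R f)" using \<sigma>le[of "1 / c" "c *\<^sub>R f"] False by simp
    then show ?thesis using \<sigma>le[of c f] False by (simp add: field_simps)
  qed
  moreover have "\<sigma> (f + g) \<le> \<sigma> f + \<sigma> g" for f g
  proof (rule leI)
    fix \<rho> assume \<rho>: "\<rho> \<in> G"
    show "\<rho> (f + g) \<le> \<sigma> f + \<sigma> g"
      using seminorm_triangle[OF Gs(1)[OF \<rho>], of f g] le[OF \<rho>, of f] le[OF \<rho>, of g] by linarith
  qed (use nn[of f] nn[of g] in linarith)
  ultimately have sn: "seminorm \<sigma>" using nn unfolding seminorm_def by blast
  have sm: "submultiplicative \<sigma>"
    unfolding submultiplicative_def
  proof (intro allI leI)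
    fix f g \<rho> assume \<rho>: "\<rho> \<in> G"
    have "\<rho> (f * g) \<le> \<rho> f * \<rho> g" using Gs \<rho> by (simp add: submultiplicativeD)
    also have "\<dots> \<le> \<sigma> f * \<sigma> g" using le[OF \<rho>] Gs \<rho> nn by (intro mult_mono) (auto simp: seminorm_nonneg)
    finally show "\<rho> (f * g) \<le> \<sigma> f * \<sigma> g" .
  qed (use nn in auto)
  have "seminorm (\<lambda>f. \<bar>L f\<bar>)"
    unfolding seminorm_def using lin by (auto simp: linear_add linear_scale abs_mult)
  moreover have "\<bar>L f\<bar> < 1" if "\<sigma> f < e" for f
    using that G(3,4) by (auto simp: less_iff)
  ultimately have bd: "\<bar>L f\<bar> \<le> (2 / e) * \<sigma> f" for f
    using seminorm_dominated[of "\<lambda>f. \<bar>L f\<bar>" \<sigma> e] sn G(3) by simp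
  have "openin T {f. \<sigma> f < 1}"
    unfolding T openin_seminorm_topology_iff[OF Fs]
  proof
    fix f assume f: "f \<in> {f. \<sigma> f < 1}"
    have "\<sigma> g < 1" if "\<forall>\<rho>\<in>G. \<rho> (g - f) < 1 - \<sigma> f" for g
    proof -
      have "\<sigma> (g - f) < 1 - \<sigma> f" using f that by (subst less_iff) auto
      then show ?thesis using seminorm_triangle[OF sn, of "g - f" f] by simp
    qed
    then show "\<exists>H e. finite H \<and> H \<subseteq> F \<and> 0 < e \<and> {y. \<forall>\<rho>\<in>H. \<rho> (y - f) < e} \<subseteq> {f. \<sigma> f < 1}"
      using G f by (intro exI[of _ G] exI[of _ "1 - \<sigma> f"]) auto
  qed
  then show ?thesis using that sn sm bd G(3) by (meson divide_pos_pos zero_less_numeral)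
qed

text \<open>Directedness replaces the finitely many seminorms of a neighbourhood by one
  \<open>\<rho>\<close>. The constant is rounded up to a positive integer because it becomes the
  radius of a dual ball.\<close>

lemma seminorm_bound_of_open_unit_ball:
  assumes "directed_family S" "\<forall>\<rho>\<in>S. seminorm \<rho>" "seminorm p"
    and "openin (seminorm_topology S) {v. p v < 1}"
  obtains \<rho> i where "\<rho> \<in> S" "(i::nat) \<ge> 1" "\<And>v. p v \<le> real i * \<rho> v"
proof -
  have "0 \<in> {v. p v < 1}" using assms(3) by (simp add: seminorm_zero)
  then obtain F e where F: "finite F" "F \<subseteq> S" "e > 0" "{v. \<forall>\<rho>\<in>F. \<rho> (v - 0) < e} \<subseteq> {v. p v < 1}"
    using assms(4) unfolding openin_seminorm_topology_iff[OF assms(2)] by meson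
  obtain \<rho> C where \<rho>: "\<rho> \<in> S" "C > 0" "\<forall>\<rho>'\<in>F. \<forall>x. \<rho>' x \<le> C * \<rho> x"
    using directed_family_finite_bound[OF assms(1,2) F(1,2)] by meson
  have "p v < 1" if "\<rho> v < e / C" for v
  proof -
    have "C * \<rho> v < e" using that \<rho>(2) by (simp add: field_simps)
    then have "\<forall>\<rho>'\<in>F. \<rho>' v < e" using \<rho>(3) by (meson le_less_trans)
    then show ?thesis using F(4) by auto
  qed
  then have p: "p v \<le> 2 / (e / C) * \<rho> v" for v
    using assms \<rho> F(3) by (intro seminorm_dominated) auto
  define i where "i = Suc (nat \<lceil>2 / (e / C)\<rceil>)"
  have "2 / (e / C) \<le> real i" unfolding i_def by linarith
  then have "p v \<le> real i * \<rho> v" for v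
    using p[of v] mult_right_mono[of "2 / (e / C)" "real i" "\<rho> v"] seminorm_nonneg[of \<rho> v] \<rho> assms(2)
    by auto
  then show ?thesis using that[of \<rho> i] \<rho> by (simp add: i_def)
qed

text \<open>Maximality compares \<open>\<tau>bar\<close> only with lmc topologies inducing exactly
  the given topology on \<open>V\<close>, so \<open>\<sigma>\<close> cannot be compared on its own.
  The topology of \<open>insert \<sigma> F\<close> is finer than \<open>\<tau>bar\<close>, hence
  induces at least the topology of \<open>S\<close>; the bound by \<open>\<rho>\<close> makes
  \<open>sym_embed\<close> continuous, so it induces no more.\<close>

lemma finest_lmc_extension_ball_open:
  fixes \<tau>bar :: "'v::real_vector sym_alg topology"
  assumes fin: "finest_lmc_extension (seminorm_topology S) \<tau>bar"
    and S: "\<forall>\<rho>\<in>S. seminorm \<rho>" and \<rho>: "\<rho> \<in> S"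
    and \<sigma>: "seminorm \<sigma>" "submultiplicative \<sigma>" and bd: "\<And>v. \<sigma> (sym_embed v) \<le> C * \<rho> v" "C > 0"
    and e: "e > 0"
  shows "openin \<tau>bar {y. \<sigma> (y - x) < e}"
proof -
  obtain F where F: "\<forall>\<sigma>\<in>F. seminorm \<sigma> \<and> submultiplicative \<sigma>" and T: "\<tau>bar = seminorm_topology F"
    using fin unfolding finest_lmc_extension_def lmc_topology_def by blast
  have ext: "pullback_topology UNIV sym_embed \<tau>bar = seminorm_topology S"
    using fin unfolding finest_lmc_extension_def extends_topology_def by blast
  let ?T = "seminorm_topology (insert \<sigma> F)"
  have lmc: "lmc_topology ?T" unfolding lmc_topology_def using F \<sigma> by blast
  have "continuous_map (seminorm_topology S) ?T sym_embed"
    unfolding seminorm_topology_def[of "insert \<sigma> F"]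
  proof (rule continuous_on_generated_topo)
    fix U assume "U \<in> insert UNIV {{y. \<rho> (y - x) < e} |\<rho> x e. \<rho> \<in> insert \<sigma> F \<and> 0 < e}"
    then consider "U = UNIV" | x e where "U = {y. \<sigma> (y - x) < e}" "e > 0"
      | \<rho> x e where "U = {y. \<rho> (y - x) < e}" "e > 0" "\<rho> \<in> F" by auto
    then have "openin (seminorm_topology S) (sym_embed -` U)"
    proof cases
      case 1
      then show ?thesis using openin_topspace[of "seminorm_topology S"] by simp
    next
      case (2 x e)
      show ?thesis unfolding openin_seminorm_topology_iff[OF S]
      proof
        fix v assume v: "v \<in> sym_embed -` U"
        let ?d = "e - \<sigma> (sym_embed v - x)"
        have "sym_embed w \<in> U" if "\<rho> (w - v) < ?d / C" for w
        proof -
          have "\<sigma> (sym_embed w - sym_embed v) \<le> C * \<rho> (w - v)"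
            using bd(1)[of "w - v"] by (simp add: linear_diff[OF linear_sym_embed])
          also have "\<dots> < ?d" using that bd(2) by (simp add: field_simps)
          finally show ?thesis
            using seminorm_triangle[OF \<sigma>(1), of "sym_embed w - sym_embed v" "sym_embed v - x"] 2
            by simp
        qed
        then show "\<exists>F e. finite F \<and> F \<subseteq> S \<and> 0 < e \<and> {y. \<forall>\<rho>\<in>F. \<rho> (y - v) < e} \<subseteq> sym_embed -` U"
          using \<rho> bd(2) v 2 by (intro exI[of _ "{\<rho>}"] exI[of _ "?d / C"]) auto
      qed
    next
      case (3 \<rho> x e)
      then have "openin \<tau>bar U" unfolding T by (simp add: openin_seminorm_topology_ball)
      then show ?thesis unfolding ext[symmetric] openin_pullback_topology by auto
    qed
    then show "openin (seminorm_topology S) (sym_embed -` U \<inter> topspace (seminorm_topology S))" by simp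
  qed auto
  then have *: "openin (seminorm_topology S) (sym_embed -` U)" if "openin ?T U" for U
    using openin_continuous_map_preimage[of "seminorm_topology S" ?T sym_embed U] that
    by (simp add: vimage_def)
  have "extends_topology (seminorm_topology S) ?T"
    unfolding extends_topology_def topology_eq
  proof (intro allI iffI)
    fix U assume "openin (pullback_topology UNIV sym_embed ?T) U"
    then show "openin (seminorm_topology S) U"
      unfolding openin_pullback_topology using * by auto
  next
    fix U assume "openin (seminorm_topology S) U"
    then obtain W where W: "openin \<tau>bar W" "U = sym_embed -` W \<inter> UNIV"
      unfolding ext[symmetric] openin_pullback_topology by blast
    have "openin ?T W"
      using W(1) F \<sigma>(1) unfolding T by (intro seminorm_topology_mono[of F "insert \<sigma> F"]) auto
    then show "openin (pullback_topology UNIV sym_embed ?T) U"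
      unfolding openin_pullback_topology using W(2) by blast
  qed
  then have "openin ?T U \<Longrightarrow> openin \<tau>bar U" for U
    using fin lmc unfolding finest_lmc_extension_def by blast
  then show ?thesis using e by (simp add: openin_seminorm_topology_ball)
qed

lemma linear_continuous_of_bound:
  assumes lin: "linear L" and bd: "\<And>f. \<bar>L f\<bar> \<le> C * \<sigma> f"
    and top: "topspace T = UNIV" and op: "\<And>x e. e > 0 \<Longrightarrow> openin T {y. \<sigma> (y - x) < e}"
    and \<sigma>: "seminorm \<sigma>"
  shows "continuous_map T euclideanreal L"
  unfolding continuous_map_def
proof (intro conjI allI impI)
  fix U :: "real set" assume U: "openin euclideanreal U"
  show "openin T {x \<in> topspace T. L x \<in> U}"
  proof (subst openin_subopen, intro ballI)
    fix x assume "x \<in> {x \<in> topspace T. L x \<in> U}"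
    then obtain e where e: "e > 0" "\<And>y. \<bar>y - L x\<bar> < e \<Longrightarrow> y \<in> U"
      using U open_dist[of U] by (auto simp: dist_real_def)
    let ?d = "e / (\<bar>C\<bar> + 1)"
    have d: "?d > 0" using e(1) by (intro divide_pos_pos) auto
    have "L y \<in> U" if "\<sigma> (y - x) < ?d" for y
    proof (rule e(2))
      have "\<bar>L y - L x\<bar> \<le> C * \<sigma> (y - x)" using bd[of "y - x"] by (simp add: linear_diff[OF lin])
      also have "\<dots> \<le> (\<bar>C\<bar> + 1) * \<sigma> (y - x)"
        using seminorm_nonneg[OF \<sigma>] by (intro mult_right_mono) auto
      also have "\<dots> < e" using that by (simp add: field_simps)
      finally show "\<bar>L y - L x\<bar> < e" .
    qed
    then show "\<exists>S. openin T S \<and> x \<in> S \<and> S \<subseteq> {x \<in> topspace T. L x \<in> U}"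
      using op[OF d, of x] d top seminorm_zero[OF \<sigma>] by (intro exI[of _ "{y. \<sigma> (y - x) < ?d}"]) auto
  qed
qed auto

section \<open>Convergence with respect to one seminorm\<close>

text \<open>Limits in this sense need not be unique, since \<open>\<sigma>\<close> may vanish at
  nonzero elements; they are only fed into functionals bounded by \<open>\<sigma>\<close>, which do
  not distinguish them.\<close>

definition seminorm_tendsto :: "('a::real_vector \<Rightarrow> real) \<Rightarrow> (nat \<Rightarrow> 'a) \<Rightarrow> 'a \<Rightarrow> bool" where
  "seminorm_tendsto \<sigma> f x \<longleftrightarrow> (\<lambda>n. \<sigma> (f n - x)) \<longlonglongrightarrow> 0"

lemma seminorm_tendsto_le:
  assumes "seminorm \<sigma>" "g \<longlonglongrightarrow> 0" "eventually (\<lambda>n. \<sigma> (f n - x) \<le> g n) sequentially"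
  shows "seminorm_tendsto \<sigma> f x"
  unfolding seminorm_tendsto_def
  by (rule tendsto_sandwich[OF _ assms(3) tendsto_const assms(2)])
     (simp add: seminorm_nonneg[OF assms(1)])

lemma seminorm_tendsto_const: "seminorm \<sigma> \<Longrightarrow> seminorm_tendsto \<sigma> (\<lambda>n. x) x"
  by (simp add: seminorm_tendsto_def seminorm_zero)

lemma seminorm_tendsto_add:
  assumes \<sigma>: "seminorm \<sigma>" and "seminorm_tendsto \<sigma> f x" "seminorm_tendsto \<sigma> g y"
  shows "seminorm_tendsto \<sigma> (\<lambda>n. f n + g n) (x + y)"
proof (rule seminorm_tendsto_le[OF \<sigma>])
  show "(\<lambda>n. \<sigma> (f n - x) + \<sigma> (g n - y)) \<longlonglongrightarrow> 0"
    using tendsto_add[of _ 0 _ _ 0] assms(2,3) by (fastforce simp: seminorm_tendsto_def)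
  show "\<forall>\<^sub>F n in sequentially. \<sigma> (f n + g n - (x + y)) \<le> \<sigma> (f n - x) + \<sigma> (g n - y)"
    using seminorm_triangle[OF \<sigma>, of "f _ - x" "g _ - y"] by (simp add: algebra_simps)
qed

lemma seminorm_tendsto_sum:
  assumes \<sigma>: "seminorm \<sigma>" and "\<And>i. i \<in> I \<Longrightarrow> seminorm_tendsto \<sigma> (f i) (x i)"
  shows "seminorm_tendsto \<sigma> (\<lambda>n. \<Sum>i\<in>I. f i n) (\<Sum>i\<in>I. x i)"
  using assms(2)
  by (induction I rule: infinite_finite_induct)
     (auto intro: seminorm_tendsto_add[OF \<sigma>] seminorm_tendsto_const[OF \<sigma>])

lemma seminorm_tendsto_scaleR:
  assumes \<sigma>: "seminorm \<sigma>" and c: "c \<longlonglongrightarrow> k" and f: "seminorm_tendsto \<sigma> f x"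
  shows "seminorm_tendsto \<sigma> (\<lambda>n. c n *\<^sub>R f n) (k *\<^sub>R x)"
proof (rule seminorm_tendsto_le[OF \<sigma>])
  have "(\<lambda>n. c n - k) \<longlonglongrightarrow> 0" using c LIM_zero_iff by blast
  then show "(\<lambda>n. \<bar>c n\<bar> * \<sigma> (f n - x) + \<bar>c n - k\<bar> * \<sigma> x) \<longlonglongrightarrow> 0"
    using f c unfolding seminorm_tendsto_def
    by (auto intro!: tendsto_eq_intros)
  show "\<forall>\<^sub>F n in sequentially. \<sigma> (c n *\<^sub>R f n - k *\<^sub>R x) \<le> \<bar>c n\<bar> * \<sigma> (f n - x) + \<bar>c n - k\<bar> * \<sigma> x"
  proof (intro always_eventually allI)
    fix n
    have "c n *\<^sub>R f n - k *\<^sub>R x = c n *\<^sub>R (f n - x) + (c n - k) *\<^sub>R x" by (simp add: algebra_simps)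
    then show "\<sigma> (c n *\<^sub>R f n - k *\<^sub>R x) \<le> \<bar>c n\<bar> * \<sigma> (f n - x) + \<bar>c n - k\<bar> * \<sigma> x"
      using seminorm_triangle[OF \<sigma>] by (metis seminorm_scaleR[OF \<sigma>])
  qed
qed

lemma seminorm_tendsto_mult:
  fixes \<sigma> :: "'a::{comm_ring_1,real_algebra_1} \<Rightarrow> real"
  assumes \<sigma>: "seminorm \<sigma>" "submultiplicative \<sigma>"
    and f: "seminorm_tendsto \<sigma> f x" and g: "seminorm_tendsto \<sigma> g y"
  shows "seminorm_tendsto \<sigma> (\<lambda>n. f n * g n) (x * y)"
proof (rule seminorm_tendsto_le[OF \<sigma>(1)])
  have "(\<lambda>n. \<sigma> (f n - x) * \<sigma> (g n - y) + (\<sigma> (f n - x) * \<sigma> y + \<sigma> x * \<sigma> (g n - y)))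
      \<longlonglongrightarrow> 0 * 0 + (0 * \<sigma> y + \<sigma> x * 0)"
    using f g unfolding seminorm_tendsto_def by (intro tendsto_intros)
  then show "(\<lambda>n. \<sigma> (f n - x) * \<sigma> (g n - y) + (\<sigma> (f n - x) * \<sigma> y + \<sigma> x * \<sigma> (g n - y))) \<longlonglongrightarrow> 0"
    by simp
  have "\<sigma> (f n * g n - x * y)
      \<le> \<sigma> (f n - x) * \<sigma> (g n - y) + (\<sigma> (f n - x) * \<sigma> y + \<sigma> x * \<sigma> (g n - y))" for n
  proof -
    have "f n * g n - x * y = (f n - x) * (g n - y) + ((f n - x) * y + x * (g n - y))"
      by (simp add: algebra_simps)
    also have "\<sigma> \<dots> \<le> \<sigma> ((f n - x) * (g n - y)) + (\<sigma> ((f n - x) * y) + \<sigma> (x * (g n - y)))"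
      using seminorm_triangle[OF \<sigma>(1)] by (meson add_left_mono order_trans)
    also have "\<dots> \<le> \<sigma> (f n - x) * \<sigma> (g n - y) + (\<sigma> (f n - x) * \<sigma> y + \<sigma> x * \<sigma> (g n - y))"
      by (intro add_mono submultiplicativeD[OF \<sigma>(2)])
    finally show ?thesis .
  qed
  then show "\<forall>\<^sub>F n in sequentially. \<sigma> (f n * g n - x * y)
      \<le> \<sigma> (f n - x) * \<sigma> (g n - y) + (\<sigma> (f n - x) * \<sigma> y + \<sigma> x * \<sigma> (g n - y))" by simp
qed

lemma seminorm_tendsto_prod:
  fixes \<sigma> :: "'a::{comm_ring_1,real_algebra_1} \<Rightarrow> real"
  assumes \<sigma>: "seminorm \<sigma>" "submultiplicative \<sigma>"
    and "\<And>i. i \<in> I \<Longrightarrow> seminorm_tendsto \<sigma> (f i) (x i)"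
  shows "seminorm_tendsto \<sigma> (\<lambda>n. \<Prod>i\<in>I. f i n) (\<Prod>i\<in>I. x i)"
  using assms(3)
  by (induction I rule: infinite_finite_induct)
     (auto intro: seminorm_tendsto_mult[OF \<sigma>] seminorm_tendsto_const[OF \<sigma>(1)])

lemma bounded_functional_tendsto_nonneg:
  assumes "linear L" "\<And>f. \<bar>L f\<bar> \<le> C * \<sigma> f" "seminorm_tendsto \<sigma> f x"
    and "eventually (\<lambda>n. 0 \<le> L (f n)) sequentially"
  shows "0 \<le> L x"
proof -
  have "(\<lambda>n. C * \<sigma> (f n - x)) \<longlonglongrightarrow> 0"
    using tendsto_mult_left[OF assms(3)[unfolded seminorm_tendsto_def], of C] by simp
  then have "(\<lambda>n. L (f n - x)) \<longlonglongrightarrow> 0"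
    by (rule Lim_null_comparison[rotated]) (use assms(2) in simp)
  then have "(\<lambda>n. L (f n)) \<longlonglongrightarrow> L x"
    by (simp add: linear_diff[OF assms(1)] LIM_zero_iff)
  then show ?thesis by (rule tendsto_lowerbound) (use assms(4) in auto)
qed

section \<open>Power series in a seminormed algebra\<close>

text \<open>Truncations stand in for the sum of the series, which need not exist in an incomplete
  algebra.\<close>

definition fps_partial :: "real fps \<Rightarrow> 'a::real_algebra_1 \<Rightarrow> nat \<Rightarrow> 'a" where
  "fps_partial F a n = (\<Sum>k\<le>n. fps_nth F k *\<^sub>R a ^ k)"

text \<open>The factor \<open>\<sigma> 1 + 1\<close> takes care of the power zero, as
  submultiplicativity does not give \<open>\<sigma> 1 \<le> 1\<close>.\<close>

lemma seminorm_power_le: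
  fixes \<sigma> :: "'a::{comm_ring_1,real_algebra_1} \<Rightarrow> real"
  assumes "seminorm \<sigma>" "submultiplicative \<sigma>"
  shows "\<sigma> (a ^ k) \<le> (\<sigma> 1 + 1) * \<sigma> a ^ k"
proof (induction k)
  case 0
  then show ?case by simp
next
  case (Suc k)
  have "\<sigma> (a ^ Suc k) \<le> \<sigma> a * \<sigma> (a ^ k)" using submultiplicativeD[OF assms(2)] by simp
  also have "\<dots> \<le> \<sigma> a * ((\<sigma> 1 + 1) * \<sigma> a ^ k)"
    using Suc seminorm_nonneg[OF assms(1)] by (intro mult_left_mono)
  finally show ?case by (simp add: algebra_simps)
qed

text \<open>Isolates the truncation error of a Cauchy product. It is used with the same index set in
  the algebra and for the real majorants.\<close>

lemma sum_product_minus_triangle: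
  fixes x y :: "nat \<Rightarrow> 'b::comm_ring_1"
  shows "(\<Sum>i\<le>n. x i) * (\<Sum>i\<le>n. y i) - (\<Sum>k\<le>n. \<Sum>i\<le>k. x i * y (k - i))
     = (\<Sum>(i,j)\<in>{..n} \<times> {..n} - {(i,j). i + j \<le> n}. x i * y j)"
proof -
  have "(\<Sum>k\<le>n. \<Sum>i\<le>k. x i * y (k - i)) = (\<Sum>(i,j)\<in>{(i,j). i + j \<le> n}. x i * y j)"
    by (rule sum.triangle_reindex_eq[symmetric])
  moreover have "(\<Sum>i\<le>n. x i) * (\<Sum>i\<le>n. y i) = (\<Sum>(i,j)\<in>{..n} \<times> {..n}. x i * y j)"
    by (simp add: sum_product sum.cartesian_product)
  moreover have "{(i,j). i + j \<le> n} \<subseteq> {..n} \<times> {..n}" by auto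
  ultimately show ?thesis by (simp add: sum_diff)
qed

text \<open>The error is a sum over pairs with \<open>i + j > n\<close>, dominated term by term by
  the same sum of the real numbers \<open>f i * g j\<close>. That sum tends to zero because the
  Cauchy product of two absolutely convergent real series converges to the product of their
  sums.\<close>

lemma fps_partial_mult_tendsto:
  fixes a :: "'a::{comm_ring_1,real_algebra_1}"
  assumes \<sigma>: "seminorm \<sigma>" "submultiplicative \<sigma>"
    and F: "summable (\<lambda>k. \<bar>fps_nth F k\<bar> * \<sigma> a ^ k)" and G: "summable (\<lambda>k. \<bar>fps_nth G k\<bar> * \<sigma> a ^ k)"
  shows "summable (\<lambda>k. \<bar>fps_nth (F * G) k\<bar> * \<sigma> a ^ k)"
    and "seminorm_tendsto \<sigma> (\<lambda>n. fps_partial F a n * fps_partial G a n - fps_partial (F * G) a n) 0"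
proof -
  let ?s = "\<sigma> a"
  have s: "0 \<le> ?s" by (rule seminorm_nonneg[OF \<sigma>(1)])
  define f where "f k = \<bar>fps_nth F k\<bar> * ?s ^ k" for k
  define g where "g k = \<bar>fps_nth G k\<bar> * ?s ^ k" for k
  define h where "h k = (\<Sum>i\<le>k. f i * g (k - i))" for k
  have fg0: "0 \<le> f k" "0 \<le> g k" for k using s by (simp_all add: f_def g_def)
  have sf: "summable (\<lambda>k. norm (f k))" "summable (\<lambda>k. norm (g k))"
    using F G fg0 by (simp_all add: f_def[symmetric] g_def[symmetric])
  have hs: "h sums (suminf f * suminf g)"
    using Cauchy_product_sums[OF sf] by (simp add: h_def[abs_def])
  have le: "\<bar>fps_nth (F * G) k\<bar> * ?s ^ k \<le> h k" for k
  proof -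
    have "\<bar>fps_nth (F * G) k\<bar> * ?s ^ k \<le> (\<Sum>i\<le>k. \<bar>fps_nth F i * fps_nth G (k - i)\<bar>) * ?s ^ k"
      using s by (simp add: fps_mult_nth atLeast0AtMost mult_right_mono)
    also have "\<dots> = h k"
      unfolding h_def f_def g_def sum_distrib_right
      by (intro sum.cong refl) (simp add: abs_mult flip: power_add)
    finally show ?thesis .
  qed
  show "summable (\<lambda>k. \<bar>fps_nth (F * G) k\<bar> * \<sigma> a ^ k)"
    by (rule summable_comparison_test'[OF sums_summable[OF hs], of 0]) (use le s in simp)
  let ?D = "\<lambda>n. {..n} \<times> {..n} - {(i,j). i + j \<le> (n::nat)}"
  have "fps_partial (F * G) a n
      = (\<Sum>k\<le>n. \<Sum>i\<le>k. (fps_nth F i *\<^sub>R a ^ i) * (fps_nth G (k - i) *\<^sub>R a ^ (k - i)))" for n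
    unfolding fps_partial_def
    by (intro sum.cong refl)
       (simp add: fps_mult_nth atLeast0AtMost scaleR_sum_left mult.commute flip: power_add)
  then have eq: "fps_partial F a n * fps_partial G a n - fps_partial (F * G) a n
      = (\<Sum>(i,j)\<in>?D n. (fps_nth F i *\<^sub>R a ^ i) * (fps_nth G j *\<^sub>R a ^ j))" for n
    unfolding fps_partial_def 
    using sum_product_minus_triangle[of "\<lambda>k. fps_nth F k *\<^sub>R a ^ k" n "\<lambda>k. fps_nth G k *\<^sub>R a ^ k"]
    by simp
  show "seminorm_tendsto \<sigma> (\<lambda>n. fps_partial F a n * fps_partial G a n - fps_partial (F * G) a n) 0"
  proof (rule seminorm_tendsto_le[OF \<sigma>(1)])
    have "(\<lambda>n. (\<Sum>i\<le>n. f i)) \<longlonglongrightarrow> suminf f" "(\<lambda>n. (\<Sum>i\<le>n. g i)) \<longlonglongrightarrow> suminf g"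
      using summable_LIMSEQ'[of f] summable_LIMSEQ'[of g] sf fg0 by auto
    moreover have "(\<lambda>n. \<Sum>k\<le>n. h k) \<longlonglongrightarrow> suminf f * suminf g" using hs by (simp add: sums_def_le)
    ultimately have "(\<lambda>n. (\<Sum>i\<le>n. f i) * (\<Sum>i\<le>n. g i) - (\<Sum>k\<le>n. h k))
        \<longlonglongrightarrow> suminf f * suminf g - suminf f * suminf g"
      by (intro tendsto_intros)
    from tendsto_mult_left[OF this, of "\<sigma> 1 + 1"]
    show "(\<lambda>n. (\<sigma> 1 + 1) * ((\<Sum>i\<le>n. f i) * (\<Sum>i\<le>n. g i) - (\<Sum>k\<le>n. h k))) \<longlonglongrightarrow> 0"
      by simp
    have *: "\<sigma> ((fps_nth F i *\<^sub>R a ^ i) * (fps_nth G j *\<^sub>R a ^ j)) \<le> (\<sigma> 1 + 1) * (f i * g j)" for i j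
    proof -
      have "\<sigma> ((fps_nth F i *\<^sub>R a ^ i) * (fps_nth G j *\<^sub>R a ^ j))
          = \<bar>fps_nth F i * fps_nth G j\<bar> * \<sigma> (a ^ (i + j))"
        by (simp add: seminorm_scaleR[OF \<sigma>(1)] abs_mult flip: power_add)
      also have "\<dots> \<le> \<bar>fps_nth F i * fps_nth G j\<bar> * ((\<sigma> 1 + 1) * ?s ^ (i + j))"
        by (intro mult_left_mono seminorm_power_le \<sigma>) simp
      finally show ?thesis
        by (simp add: f_def g_def abs_mult power_add mult_ac)
    qed
    have "\<sigma> (\<Sum>(i,j)\<in>?D n. (fps_nth F i *\<^sub>R a ^ i) * (fps_nth G j *\<^sub>R a ^ j))
        \<le> (\<sigma> 1 + 1) * (\<Sum>(i,j)\<in>?D n. f i * g j)" for n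
    proof -
      have "\<sigma> (\<Sum>(i,j)\<in>?D n. (fps_nth F i *\<^sub>R a ^ i) * (fps_nth G j *\<^sub>R a ^ j))
        \<le> (\<Sum>(i,j)\<in>?D n. \<sigma> ((fps_nth F i *\<^sub>R a ^ i) * (fps_nth G j *\<^sub>R a ^ j)))"
        using seminorm_sum_le[OF \<sigma>(1)] by (simp add: case_prod_unfold)
      also have "\<dots> \<le> (\<Sum>(i,j)\<in>?D n. (\<sigma> 1 + 1) * (f i * g j))"
        using * by (intro sum_mono) auto
      finally show ?thesis by (simp add: sum_distrib_left case_prod_unfold)
    qed
    then show "\<forall>\<^sub>F n in sequentially.
      \<sigma> (fps_partial F a n * fps_partial G a n - fps_partial (F * G) a n - 0)
        \<le> (\<sigma> 1 + 1) * ((\<Sum>i\<le>n. f i) * (\<Sum>i\<le>n. g i) - (\<Sum>k\<le>n. h k))"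
      unfolding eq h_def using sum_product_minus_triangle[of f _ g] by simp
  qed
qed

text \<open>In the induction the error for \<open>Suc m\<close> is
  \<open>?P n * (?P n ^ m - ?Q n)\<close> plus the error of one Cauchy product. The first summand is
  small because \<open>\<sigma> (?P n)\<close> stays below a constant \<open>B\<close> independent
  of \<open>n\<close>.\<close>

lemma fps_partial_power_tendsto:
  fixes a :: "'a::{comm_ring_1,real_algebra_1}"
  assumes \<sigma>: "seminorm \<sigma>" "submultiplicative \<sigma>" and F: "summable (\<lambda>k. \<bar>fps_nth F k\<bar> * \<sigma> a ^ k)"
  shows "summable (\<lambda>k. \<bar>fps_nth (F ^ m) k\<bar> * \<sigma> a ^ k) \<and>
    seminorm_tendsto \<sigma> (\<lambda>n. fps_partial F a n ^ m - fps_partial (F ^ m) a n) 0"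
proof (induction m)
  case 0
  have "fps_partial 1 a n = 1" for n
    by (simp add: fps_partial_def if_distrib[of "\<lambda>x. x *\<^sub>R _"] cong: if_cong)
  moreover have "summable (\<lambda>k. \<bar>fps_nth 1 k\<bar> * \<sigma> a ^ k)"
    by (rule summable_finite[of "{0}"]) auto
  ultimately show ?case by (simp add: seminorm_tendsto_const \<sigma>)
next
  case (Suc m)
  let ?P = "fps_partial F a" and ?Q = "fps_partial (F ^ m) a"
  obtain B where B: "\<sigma> (?P n) \<le> B" for n
  proof
    fix n
    have "\<sigma> (?P n) \<le> (\<Sum>k\<le>n. \<sigma> (fps_nth F k *\<^sub>R a ^ k))"
      unfolding fps_partial_def by (rule seminorm_sum_le[OF \<sigma>(1)])
    also have "\<dots> \<le> (\<Sum>k\<le>n. (\<sigma> 1 + 1) * (\<bar>fps_nth F k\<bar> * \<sigma> a ^ k))"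
    proof (rule sum_mono)
      fix k
      have "\<bar>fps_nth F k\<bar> * \<sigma> (a ^ k) \<le> \<bar>fps_nth F k\<bar> * ((\<sigma> 1 + 1) * \<sigma> a ^ k)"
        by (intro mult_left_mono seminorm_power_le \<sigma>) simp
      then show "\<sigma> (fps_nth F k *\<^sub>R a ^ k) \<le> (\<sigma> 1 + 1) * (\<bar>fps_nth F k\<bar> * \<sigma> a ^ k)"
        by (simp add: seminorm_scaleR[OF \<sigma>(1)] mult_ac)
    qed
    also have "\<dots> \<le> (\<sigma> 1 + 1) * suminf (\<lambda>k. \<bar>fps_nth F k\<bar> * \<sigma> a ^ k)"
      unfolding sum_distrib_left[symmetric]
      by (intro mult_left_mono sum_le_suminf F) (simp_all add: seminorm_nonneg \<sigma>)
    finally show "\<sigma> (?P n) \<le> (\<sigma> 1 + 1) * suminf (\<lambda>k. \<bar>fps_nth F k\<bar> * \<sigma> a ^ k)" .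
  qed
  note IH = conjunct1[OF Suc] conjunct2[OF Suc]
  have "seminorm_tendsto \<sigma> (\<lambda>n. ?P n * (?P n ^ m - ?Q n)) 0"
  proof (rule seminorm_tendsto_le[OF \<sigma>(1)])
    show "(\<lambda>n. B * \<sigma> (?P n ^ m - ?Q n)) \<longlonglongrightarrow> 0"
      using tendsto_mult_left[OF IH(2)[unfolded seminorm_tendsto_def], of B] by simp
    have "\<sigma> (?P n * (?P n ^ m - ?Q n)) \<le> B * \<sigma> (?P n ^ m - ?Q n)" for n
      using submultiplicativeD[OF \<sigma>(2), of "?P n" "?P n ^ m - ?Q n"] B[of n]
        seminorm_nonneg[OF \<sigma>(1)] by (meson mult_right_mono order_trans)
    then show "\<forall>\<^sub>F n in sequentially. \<sigma> (?P n * (?P n ^ m - ?Q n) - 0) \<le> B * \<sigma> (?P n ^ m - ?Q n)"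
      by simp
  qed
  from seminorm_tendsto_add[OF \<sigma>(1) this fps_partial_mult_tendsto(2)[OF \<sigma> F IH(1)]]
  have "seminorm_tendsto \<sigma> (\<lambda>n. ?P n ^ Suc m - fps_partial (F ^ Suc m) a n) 0"
    by (simp add: algebra_simps)
  then show ?case using fps_partial_mult_tendsto(1)[OF \<sigma> F IH(1)] by simp
qed

text \<open>The partial sums of the binomial series of \<open>(1 + x) powr (1 / m)\<close>.\<close>

lemma approximate_root_one_plus:
  fixes a :: "'a::{comm_ring_1,real_algebra_1}"
  assumes \<sigma>: "seminorm \<sigma>" "submultiplicative \<sigma>" and a: "\<sigma> a < 1" and m: "m \<ge> 1"
  shows "\<exists>p. seminorm_tendsto \<sigma> (\<lambda>n. p n ^ m) (1 + a)"
proof -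
  define F :: "real fps" where "F = fps_binomial (1 / real m)"
  have s: "0 \<le> \<sigma> a" by (rule seminorm_nonneg[OF \<sigma>(1)])
  obtain t where t: "\<sigma> a < t" "t < 1" using a dense by blast
  have "summable (\<lambda>k. (1 / real m gchoose k) * t ^ k)"
    using gen_binomial_real[of t "1 / real m"] s t by (auto simp: sums_iff)
  from powser_insidea[OF this, of "\<sigma> a"] s t
  have "summable (\<lambda>k. \<bar>fps_nth F k\<bar> * \<sigma> a ^ k)"
    by (simp add: F_def abs_mult power_abs)
  from conjunct2[OF fps_partial_power_tendsto[OF \<sigma> this, of m]]
  have *: "seminorm_tendsto \<sigma> (\<lambda>n. fps_partial F a n ^ m - fps_partial (F ^ m) a n) 0" .
  \<comment> \<open>The power of the series is a polynomial of degree one, so its truncations are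
    exact from \<open>n = 1\<close> on and the error estimate becomes a statement about
    \<open>1 + a\<close>.\<close>
  have Fm: "F ^ m = 1 + fps_X" using m by (simp add: F_def fps_binomial_power fps_binomial_1)
  have "fps_partial (F ^ m) a n = 1 + a" if "n \<ge> 1" for n
  proof -
    have "fps_partial (F ^ m) a n = (\<Sum>k\<in>{0,1}. fps_nth (1 + fps_X) k *\<^sub>R a ^ k)"
      unfolding fps_partial_def Fm
      by (rule sum.mono_neutral_right) (use that in \<open>auto simp: fps_X_def\<close>)
    then show ?thesis by simp
  qed
  then have "\<forall>\<^sub>F n in sequentially. \<sigma> (fps_partial F a n ^ m - fps_partial (F ^ m) a n - 0)
      = \<sigma> (fps_partial F a n ^ m - (1 + a))"
    unfolding eventually_sequentially by (intro exI[of _ 1]) simp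
  from Lim_transform_eventually[OF *[unfolded seminorm_tendsto_def] this]
  show ?thesis unfolding seminorm_tendsto_def by blast
qed

section \<open>Bernstein operators\<close>

definition bernstein_basis :: "nat \<Rightarrow> 'a::{comm_ring_1,real_algebra_1} \<Rightarrow> nat \<Rightarrow> 'a" where
  "bernstein_basis N y j = of_nat (N choose j) * y ^ j * (1 - y) ^ (N - j)"

text \<open>The sample values are indexed by \<open>j\<close> rather than by the node
  \<open>j / N\<close>, so that falling factorials of \<open>j\<close> can be inserted
  directly.\<close>

definition bernstein :: "nat \<Rightarrow> 'a::{comm_ring_1,real_algebra_1} \<Rightarrow> (nat \<Rightarrow> real) \<Rightarrow> 'a" where
  "bernstein N y \<phi> = (\<Sum>j\<le>N. \<phi> j *\<^sub>R bernstein_basis N y j)"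

lemma bernstein_basis_eq:
  "bernstein_basis N y j = real (N choose j) *\<^sub>R (y ^ j * (1 - y) ^ (N - j))"
  unfolding bernstein_basis_def
  by (metis mult_scaleR_left mult_1 of_real_def of_real_of_nat_eq)

lemma bernstein_add: "bernstein N y (\<lambda>j. \<phi> j + \<psi> j) = bernstein N y \<phi> + bernstein N y \<psi>"
  by (simp add: bernstein_def scaleR_left_distrib sum.distrib)

lemma bernstein_scale: "bernstein N y (\<lambda>j. c * \<phi> j) = c *\<^sub>R bernstein N y \<phi>"
  by (simp add: bernstein_def scaleR_sum_right)

text \<open>These are the factorial moments of the binomial distribution: absorbing a factor by
  \<open>Suc k * (Suc n choose Suc k) = Suc n * (n choose k)\<close> lowers \<open>N\<close> and
  \<open>i\<close> by one, and \<open>i = 0\<close> is the expansion of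
  \<open>(y + (1 - y)) ^ N\<close>. Being exact, the formula holds for algebra elements, where an
  estimate on an interval would have no meaning.\<close>

lemma bernstein_ffact:
  "bernstein N y (\<lambda>j. \<Prod>l<i. (real j - real l)) = (\<Prod>l<i. (real N - real l)) *\<^sub>R y ^ i"
proof (induction i arbitrary: N)
  case 0
  have "(\<Sum>j\<le>N. of_nat (N choose j) * y ^ j * (1 - y) ^ (N - j)) = (y + (1 - y)) ^ N"
    by (rule binomial_ring[symmetric])
  then show ?case by (simp add: bernstein_def bernstein_basis_def)
next
  case (Suc i)
  show ?case
  proof (cases N)
    case 0
    then show ?thesis by (auto simp: bernstein_def prod.lessThan_Suc_shift)
  next
    case (Suc n)
    have shift: "(\<Prod>l<Suc i. (real (Suc k) - real l)) = real (Suc k) * (\<Prod>l<i. (real k - real l))" for k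
      by (subst prod.lessThan_Suc_shift) simp
    have step: "(\<Prod>l<Suc i. (real (Suc k) - real l)) *\<^sub>R bernstein_basis (Suc n) y (Suc k)
        = (real (Suc n) *\<^sub>R y) * ((\<Prod>l<i. (real k - real l)) *\<^sub>R bernstein_basis n y k)" for k
    proof -
      have eq: "real (Suc k) * real (Suc n choose Suc k) = real (Suc n) * real (n choose k)"
        using Suc_times_binomial_eq[of n k] by (metis of_nat_mult mult.commute)
      have "real (Suc k) * (\<Prod>l<i. (real k - real l)) * real (Suc n choose Suc k)
          = real (Suc n) * (\<Prod>l<i. (real k - real l)) * real (n choose k)"
        using arg_cong[OF eq, of "\<lambda>x. (\<Prod>l<i. (real k - real l)) * x"] by (simp only: mult_ac)
      from arg_cong[OF this, of "\<lambda>c. c *\<^sub>R (y ^ Suc k * (1 - y) ^ (n - k))"]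
      have "(real (Suc k) * (\<Prod>l<i. (real k - real l)) * real (Suc n choose Suc k)) *\<^sub>R
            (y ^ Suc k * (1 - y) ^ (n - k))
          = (real (Suc n) * (\<Prod>l<i. (real k - real l)) * real (n choose k)) *\<^sub>R
            (y ^ Suc k * (1 - y) ^ (n - k))" .
      then show ?thesis
        unfolding bernstein_basis_eq shift by (simp add: mult_ac del: of_nat_Suc binomial_Suc_Suc prod.lessThan_Suc)
    qed
    have "bernstein N y (\<lambda>j. \<Prod>l<Suc i. (real j - real l))
        = (\<Sum>k\<le>n. (\<Prod>l<Suc i. (real (Suc k) - real l)) *\<^sub>R bernstein_basis (Suc n) y (Suc k))"
      unfolding bernstein_def Suc by (subst sum.atMost_Suc_shift) (auto simp: prod.lessThan_Suc_shift)
    also have "\<dots> = (real (Suc n) *\<^sub>R y) * bernstein n y (\<lambda>j. \<Prod>l<i. (real j - real l))"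
      unfolding step bernstein_def sum_distrib_left ..
    also have "\<dots> = (\<Prod>l<Suc i. (real N - real l)) *\<^sub>R y ^ Suc i"
      unfolding Suc.IH Suc shift by (simp add: mult_ac del: of_nat_Suc)
    finally show ?thesis .
  qed
qed

lemma bernstein_tendsto_ffact:
  assumes \<sigma>: "seminorm \<sigma>"
  shows "seminorm_tendsto \<sigma> (\<lambda>N. bernstein N y (\<lambda>j. \<Prod>l<i. ((real j - real l) / real N))) (y ^ i)"
proof -
  have eq: "bernstein N y (\<lambda>j. \<Prod>l<i. ((real j - real l) / real N))
      = (\<Prod>l<i. ((real N - real l) / real N)) *\<^sub>R y ^ i" for N
    using bernstein_ffact[of N y i] bernstein_scale[of N y "1 / real N ^ i"]
    by (simp add: prod_dividef)
  have "(\<lambda>N. (real N - real l) / real N) \<longlonglongrightarrow> 1" for l by real_asymp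
  then have "(\<lambda>N. \<Prod>l<i. ((real N - real l) / real N)) \<longlonglongrightarrow> (\<Prod>l<i. 1)"
    by (intro tendsto_prod)
  from seminorm_tendsto_scaleR[OF \<sigma> this seminorm_tendsto_const[OF \<sigma>]]
  show ?thesis unfolding eq by simp
qed

text \<open>Interpolates between falling factorials and powers: writing \<open>j / N\<close> as
  \<open>(j - i) / N + i / N\<close> trades one power for the next falling factor, and the remainder
  carries \<open>i / N\<close>, which tends to zero.\<close>

lemma bernstein_tendsto_power_ffact:
  assumes \<sigma>: "seminorm \<sigma>"
  shows "seminorm_tendsto \<sigma>
    (\<lambda>N. bernstein N y (\<lambda>j. (real j / real N) ^ k * (\<Prod>l<i. ((real j - real l) / real N)))) (y ^ (k + i))"
proof (induction k arbitrary: i)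
  case 0
  then show ?case using bernstein_tendsto_ffact[OF \<sigma>] by simp
next
  case (Suc k)
  let ?\<phi> = "\<lambda>N i j. (real j / real N) ^ k * (\<Prod>l<i. ((real j - real l) / real N))"
  have eq: "(real j / real N) ^ Suc k * (\<Prod>l<i. ((real j - real l) / real N))
      = ?\<phi> N (Suc i) j + (real i / real N) * ?\<phi> N i j" for j N
    by (simp add: algebra_simps diff_divide_distrib)
  have "(\<lambda>N. real i / real N) \<longlonglongrightarrow> 0" by real_asymp
  from seminorm_tendsto_add[OF \<sigma> Suc[of "Suc i"] seminorm_tendsto_scaleR[OF \<sigma> this Suc[of i]]]
  show ?case unfolding eq bernstein_add bernstein_scale by simp
qed

text \<open>The affine substitution moves the nodes from \<open>[0, 1]\<close> to
  \<open>[-r, r]\<close>. The induction carries an additional power of \<open>j / N\<close>, since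
  expanding one more factor either raises that power or keeps it.\<close>

lemma bernstein_tendsto_power:
  fixes \<sigma> :: "'a::{comm_ring_1,real_algebra_1} \<Rightarrow> real"
  assumes \<sigma>: "seminorm \<sigma>"
  shows "seminorm_tendsto \<sigma> (\<lambda>N. bernstein N y (\<lambda>j. (r * (2 * (real j / real N) - 1)) ^ m))
    ((r *\<^sub>R (2 *\<^sub>R y - 1)) ^ m)"
proof -
  have "seminorm_tendsto \<sigma>
      (\<lambda>N. bernstein N y (\<lambda>j. (r * (2 * (real j / real N) - 1)) ^ m * (real j / real N) ^ k))
      ((r *\<^sub>R (2 *\<^sub>R y - 1)) ^ m * y ^ k)" for k
  proof (induction m arbitrary: k)
    case 0
    then show ?case using bernstein_tendsto_power_ffact[OF \<sigma>, of y k 0] by simp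
  next
    case (Suc m)
    let ?\<phi> = "\<lambda>N k j. (r * (2 * (real j / real N) - 1)) ^ m * (real j / real N) ^ k"
    have eq: "(r * (2 * (real j / real N) - 1)) ^ Suc m * (real j / real N) ^ k
        = (2 * r) * ?\<phi> N (Suc k) j + (- r) * ?\<phi> N k j" for j N
      by (simp add: algebra_simps)
    have "(2 * r) *\<^sub>R ((r *\<^sub>R (2 *\<^sub>R y - 1)) ^ m * y ^ Suc k) + (- r) *\<^sub>R ((r *\<^sub>R (2 *\<^sub>R y - 1)) ^ m * y ^ k)
        = (r *\<^sub>R (2 *\<^sub>R y - 1)) ^ Suc m * y ^ k"
      by (simp add: algebra_simps)
    with seminorm_tendsto_add[OF \<sigma>
        seminorm_tendsto_scaleR[OF \<sigma> tendsto_const[of "2 * r"] Suc[of "Suc k"]]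
        seminorm_tendsto_scaleR[OF \<sigma> tendsto_const[of "- r"] Suc[of k]]]
    show ?case unfolding eq bernstein_add bernstein_scale by simp
  qed
  from this[of 0] show ?thesis by simp
qed

lemma prod_scaleR:
  "(\<Prod>i\<in>I. c i *\<^sub>R x i) = (\<Prod>i\<in>I. c i) *\<^sub>R (\<Prod>i\<in>I. x i :: 'a::{comm_ring_1,real_algebra_1})"
  by (induction I rule: infinite_finite_induct) auto

section \<open>Functionals that are nonnegative on a power module\<close>

locale power_module_functional =
  fixes \<sigma> :: "'a::{comm_ring_1,real_algebra_1} \<Rightarrow> real" and C :: real and L :: "'a \<Rightarrow> real"
    and M :: "'a set" and m :: nat
  assumes seminorm: "seminorm \<sigma>" and submult: "submultiplicative \<sigma>"
    and linear: "linear L" and C: "C \<ge> 0" and bound: "\<bar>L f\<bar> \<le> C * \<sigma> f"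
    and M: "power_module m M" and m: "m \<ge> 1" and nonneg: "g \<in> M \<Longrightarrow> 0 \<le> L g"
begin

section \<open>The cone of positive elements and its multipliers\<close>

text \<open>Quantifying over all of \<open>M\<close> makes the set stable under multiplication by
  \<open>m\<close>-th powers, because such a power can be absorbed into \<open>g\<close>.\<close>

definition cone :: "'a set" where
  "cone = {b. \<forall>g\<in>M. 0 \<le> L (g * b)}"

lemma linear_times: "Real_Vector_Spaces.linear (\<lambda>b. L (g * b))"
  by (intro linearI) (simp_all add: linear_add[OF linear] linear_scale[OF linear] distrib_left)

lemma bound_times: "\<bar>L (g * b)\<bar> \<le> (C * \<sigma> g) * \<sigma> b"
  using bound[of "g * b"] mult_left_mono[OF submultiplicativeD[OF submult, of g b] C] by simp

lemma cone_tendsto: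
  assumes "seminorm_tendsto \<sigma> f b" "\<And>n. f n \<in> cone"
  shows "b \<in> cone"
  unfolding cone_def
proof (intro CollectI ballI)
  fix g assume "g \<in> M"
  then show "0 \<le> L (g * b)"
    using assms(2) unfolding cone_def
    by (intro bounded_functional_tendsto_nonneg[OF linear_times bound_times assms(1)] always_eventually)
       auto
qed

lemma one_in_cone: "1 \<in> cone"
  using nonneg by (simp add: cone_def)

lemma cone_add: "a \<in> cone \<Longrightarrow> b \<in> cone \<Longrightarrow> a + b \<in> cone"
  by (simp add: cone_def distrib_left linear_add[OF linear])

lemma cone_scaleR: "0 \<le> c \<Longrightarrow> b \<in> cone \<Longrightarrow> c *\<^sub>R b \<in> cone"
  by (simp add: cone_def linear_scale[OF linear])

lemma cone_sum: "(\<And>i. i \<in> I \<Longrightarrow> f i \<in> cone) \<Longrightarrow> (\<Sum>i\<in>I. f i) \<in> cone"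
proof (induction I rule: infinite_finite_induct)
qed (use cone_add cone_scaleR[OF _ one_in_cone, of 0] in auto)

text \<open>Products of elements of \<open>cone\<close> are not under control; products of
  multipliers are, and multipliers lie in \<open>cone\<close> because \<open>1\<close> does.\<close>

definition cone_multiplier :: "'a set" where
  "cone_multiplier = {c. \<forall>b\<in>cone. c * b \<in> cone}"

lemma cone_multiplier_subset: "cone_multiplier \<subseteq> cone"
  using one_in_cone by (auto simp: cone_multiplier_def dest: bspec[of _ _ 1])

lemma cone_multiplier_mult: "a \<in> cone_multiplier \<Longrightarrow> b \<in> cone_multiplier \<Longrightarrow> a * b \<in> cone_multiplier"
  by (auto simp: cone_multiplier_def mult.assoc)

lemma one_in_cone_multiplier: "1 \<in> cone_multiplier"
  by (simp add: cone_multiplier_def)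

lemma cone_multiplier_scaleR: "0 \<le> c \<Longrightarrow> b \<in> cone_multiplier \<Longrightarrow> c *\<^sub>R b \<in> cone_multiplier"
  by (simp add: cone_multiplier_def cone_scaleR)

lemma cone_multiplier_power: "a \<in> cone_multiplier \<Longrightarrow> a ^ k \<in> cone_multiplier"
  by (induction k) (auto intro: cone_multiplier_mult one_in_cone_multiplier)

lemma cone_multiplier_prod: "(\<And>i. i \<in> I \<Longrightarrow> f i \<in> cone_multiplier) \<Longrightarrow> (\<Prod>i\<in>I. f i) \<in> cone_multiplier"
  by (induction I rule: infinite_finite_induct)
     (auto intro: cone_multiplier_mult one_in_cone_multiplier)

text \<open>For each approximate root, \<open>p n ^ m\<close> moves from \<open>b\<close> to
  \<open>g\<close> and \<open>p n ^ m * g\<close> stays in \<open>M\<close>; the limit is harmless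
  since \<open>cone\<close> is closed.\<close>

lemma one_plus_in_cone_multiplier:
  assumes "\<sigma> a < 1"
  shows "1 + a \<in> cone_multiplier"
  unfolding cone_multiplier_def
proof (intro CollectI ballI)
  fix b assume b: "b \<in> cone"
  obtain p where p: "seminorm_tendsto \<sigma> (\<lambda>n. p n ^ m) (1 + a)"
    using approximate_root_one_plus[OF seminorm submult assms m] by blast
  have "p n ^ m * b \<in> cone" for n
    unfolding cone_def
  proof (intro CollectI ballI)
    fix g assume "g \<in> M"
    then have "p n ^ m * g \<in> M" using M by (simp add: power_module_def)
    then have "0 \<le> L ((p n ^ m * g) * b)" using b by (simp add: cone_def)
    then show "0 \<le> L (g * (p n ^ m * b))" by (simp add: mult_ac)
  qed
  then show "(1 + a) * b \<in> cone"
    using cone_tendsto[OF seminorm_tendsto_mult[OF seminorm submult p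
          seminorm_tendsto_const[OF seminorm, of b]]] by blast
qed

text \<open>Rescaling the preceding lemma needs a scalar strictly above \<open>\<sigma> a\<close>,
  so \<open>r\<close> is approached from above by \<open>s n\<close>. This includes
  \<open>r = 0\<close>.\<close>

lemma shift_in_cone_multiplier:
  assumes "\<sigma> a \<le> r"
  shows "r *\<^sub>R 1 + a \<in> cone_multiplier"
  unfolding cone_multiplier_def
proof (intro CollectI ballI)
  fix b assume b: "b \<in> cone"
  define s where "s n = r + 1 / real (Suc n)" for n
  have s: "\<sigma> a < s n" "0 < s n" for n
  proof -
    have "0 < 1 / real (Suc n)" by simp
    then show "\<sigma> a < s n" "0 < s n"
      using assms seminorm_nonneg[OF seminorm, of a] unfolding s_def by linarith+
  qed
  have "(s n *\<^sub>R 1 + a) * b \<in> cone" for n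
  proof -
    have "1 + (1 / s n) *\<^sub>R a \<in> cone_multiplier"
      using s[of n] by (intro one_plus_in_cone_multiplier) (simp add: seminorm_scaleR[OF seminorm])
    from cone_multiplier_scaleR[OF _ this, of "s n"] s[of n]
    have "s n *\<^sub>R 1 + a \<in> cone_multiplier" by (simp add: scaleR_right_distrib)
    then show ?thesis using b by (simp add: cone_multiplier_def)
  qed
  moreover have "s \<longlonglongrightarrow> r" unfolding s_def by real_asymp
  then have "seminorm_tendsto \<sigma> (\<lambda>n. (s n *\<^sub>R 1 + a) * b) ((r *\<^sub>R 1 + a) * b)"
    by (intro seminorm_tendsto_mult seminorm_tendsto_add seminorm_tendsto_scaleR
        seminorm_tendsto_const seminorm submult)
  ultimately show "(r *\<^sub>R 1 + a) * b \<in> cone" by (rule cone_tendsto[rotated])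
qed

text \<open>The multivariate Bernstein approximations of \<open>p\<close> are combinations of products of
  the multipliers \<open>r v \<plusminus> a v\<close>, with values of \<open>p\<close> on the box as coefficients.\<close>

lemma free_eval_in_cone:
  fixes a :: "'v \<Rightarrow> 'a"
  assumes r: "\<And>v. 0 < r v" and a: "\<And>v. \<sigma> (a v) \<le> r v"
    and p: "\<And>x. (\<And>v. \<bar>x v\<bar> \<le> r v) \<Longrightarrow> 0 \<le> free_eval x p"
  shows "free_eval a p \<in> cone"
proof -
  define J where "J = (\<Union>k\<in>Poly_Mapping.keys p. set_mset k)"
  have J: "finite J" unfolding J_def by auto
  have eval: "free_eval x p
      = (\<Sum>k\<in>Poly_Mapping.keys p. Poly_Mapping.lookup p k *\<^sub>R (\<Prod>v\<in>J. x v ^ count k v))"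
    for x :: "'v \<Rightarrow> 'c::{comm_ring_1,real_algebra_1}"
    unfolding free_eval_def
  proof (intro sum.cong refl arg_cong[of _ _ "scaleR _"])
    fix k assume "k \<in> Poly_Mapping.keys p"
    then have "set_mset k \<subseteq> J" unfolding J_def by blast
    then show "(\<Prod>v\<in>#k. x v) = (\<Prod>v\<in>J. x v ^ count k v)"
      unfolding image_prod_mset_multiplicity
      by (intro prod.mono_neutral_left J) (auto simp: not_in_iff)
  qed
  \<comment> \<open>The affine map taking \<open>[- r v, r v]\<close> to \<open>[0, 1]\<close>: it
    makes both \<open>y v\<close> and \<open>1 - y v\<close> multipliers, hence also all Bernstein
    basis elements in \<open>y v\<close>.\<close>
  define y where "y v = (1 / (2 * r v)) *\<^sub>R (r v *\<^sub>R 1 + a v)" for v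
  have y: "y v \<in> cone_multiplier" for v
    unfolding y_def using r[of v] by (intro cone_multiplier_scaleR shift_in_cone_multiplier a) simp
  have "1 - y v = (1 / (2 * r v)) *\<^sub>R (r v *\<^sub>R 1 + (- a v))" for v
  proof -
    have half: "1 = (1 / 2) *\<^sub>R (1::'a) + (1 / 2) *\<^sub>R 1" by (simp flip: scaleR_left_distrib)
    have "y v = (1 / 2) *\<^sub>R 1 + (1 / (2 * r v)) *\<^sub>R a v"
      using r[of v] by (simp add: y_def scaleR_right_distrib)
    then have "1 - y v = (1 / 2) *\<^sub>R 1 - (1 / (2 * r v)) *\<^sub>R a v"
      by (subst half) simp
    then show ?thesis using r[of v] by (simp add: scaleR_right_diff_distrib)
  qed
  then have y': "1 - y v \<in> cone_multiplier" for v
    using r[of v] a[of v] shift_in_cone_multiplier[of "- a v" "r v"] cone_multiplier_scaleR[of "1 / (2 * r v)"]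
    by (simp add: seminorm_uminus[OF seminorm])
  have basis: "bernstein_basis N (y v) j \<in> cone_multiplier" for N v j
    using y y' unfolding bernstein_basis_eq
    by (auto intro!: cone_multiplier_scaleR cone_multiplier_mult cone_multiplier_power)
  have ya: "r v *\<^sub>R (2 *\<^sub>R y v - 1) = a v" for v
    using r[of v] unfolding y_def by (simp add: algebra_simps)
  define node where "node N v j = r v * (2 * (real j / real N) - 1)" for N v j
  have node: "\<bar>node N v j\<bar> \<le> r v" if "j \<le> N" for N v j
  proof -
    have "0 \<le> real j / real N" "real j / real N \<le> 1" using that by (auto simp: divide_le_eq_1)
    then have "\<bar>2 * (real j / real N) - 1\<bar> \<le> 1" by linarith
    then show ?thesis using r[of v] unfolding node_def by (simp add: abs_mult)
  qed
  define B where "B N = (\<Sum>k\<in>Poly_Mapping.keys p. Poly_Mapping.lookup p k *\<^sub>R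
      (\<Prod>v\<in>J. bernstein N (y v) (\<lambda>j. node N v j ^ count k v)))" for N
  have "seminorm_tendsto \<sigma> B (free_eval a p)"
    unfolding B_def eval node_def
    by (intro seminorm_tendsto_sum seminorm_tendsto_scaleR seminorm_tendsto_prod seminorm submult
        tendsto_const) (use bernstein_tendsto_power[OF seminorm, of "y v" "r v" k for v k, unfolded ya] in blast)
  moreover have "B N \<in> cone" for N
  proof -
    \<comment> \<open>Multiplying out the one-variable operators gives a sum over a grid; exchanging
      the sums collects the value of \<open>p\<close> at each grid point as the coefficient.\<close>
    have "B N = (\<Sum>k\<in>Poly_Mapping.keys p. \<Sum>n\<in>J \<rightarrow>\<^sub>E {..N}.
        (Poly_Mapping.lookup p k * (\<Prod>v\<in>J. node N v (n v) ^ count k v)) *\<^sub>R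
          (\<Prod>v\<in>J. bernstein_basis N (y v) (n v)))"
      unfolding B_def bernstein_def
      by (subst prod_sum_PiE) (use J in \<open>simp_all add: prod_scaleR scaleR_sum_right\<close>)
    also have "\<dots> = (\<Sum>n\<in>J \<rightarrow>\<^sub>E {..N}. free_eval (\<lambda>v. node N v (n v)) p *\<^sub>R
          (\<Prod>v\<in>J. bernstein_basis N (y v) (n v)))"
      unfolding eval by (subst sum.swap) (simp add: scaleR_sum_left)
    finally have B: "B N = \<dots>" .
    show ?thesis unfolding B
    proof (rule cone_sum, rule cone_scaleR)
      fix n assume n: "n \<in> J \<rightarrow>\<^sub>E {..N}"
      \<comment> \<open>Outside \<open>J\<close> the index \<open>n v\<close> is
        \<open>undefined\<close> and may exceed \<open>N\<close>. Those variables do not occur in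
        \<open>p\<close>, so the coordinate is reset to \<open>0\<close> to stay in the box.\<close>
      let ?x = "\<lambda>v. if v \<in> J then node N v (n v) else 0"
      have "free_eval (\<lambda>v. node N v (n v)) p = free_eval ?x p"
        unfolding eval by (intro sum.cong arg_cong[of _ _ "scaleR _"] prod.cong) auto
      moreover have "0 \<le> free_eval ?x p"
        using n node r by (intro p) (auto simp: less_imp_le)
      ultimately show "0 \<le> free_eval (\<lambda>v. node N v (n v)) p" by simp
      show "(\<Prod>v\<in>J. bernstein_basis N (y v) (n v)) \<in> cone"
        using cone_multiplier_prod[of J "\<lambda>v. bernstein_basis N (y v) (n v)"] basis cone_multiplier_subset
        by auto
    qed
  qed
  ultimately show ?thesis by (rule cone_tendsto)
qed

end

section \<open>The Riesz representation theorem on a compact Hausdorff space\<close>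

text \<open>The functional takes functions on the whole type, but the assumptions speak only of
  continuity and sign on \<open>K\<close>. That values off \<open>K\<close> do not matter is a
  consequence of positivity (\<open>\<Lambda>_cong\<close>).\<close>

locale positive_functional =
  fixes K :: "'a::t2_space set" and \<Lambda> :: "('a \<Rightarrow> real) \<Rightarrow> real"
  assumes K: "compact K"
    and \<Lambda>_add: "\<And>f g. continuous_on K f \<Longrightarrow> continuous_on K g \<Longrightarrow> \<Lambda> (\<lambda>x. f x + g x) = \<Lambda> f + \<Lambda> g"
    and \<Lambda>_scale: "\<And>c f. continuous_on K f \<Longrightarrow> \<Lambda> (\<lambda>x. c * f x) = c * \<Lambda> f"
    and \<Lambda>_nonneg: "\<And>f. continuous_on K f \<Longrightarrow> (\<And>x. x \<in> K \<Longrightarrow> 0 \<le> f x) \<Longrightarrow> 0 \<le> \<Lambda> f"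
begin

lemma \<Lambda>_mono:
  assumes "continuous_on K f" "continuous_on K g" "\<And>x. x \<in> K \<Longrightarrow> f x \<le> g x"
  shows "\<Lambda> f \<le> \<Lambda> g"
proof -
  have c: "continuous_on K (\<lambda>x. g x - f x)" using assms by (intro continuous_intros)
  have "\<Lambda> (\<lambda>x. f x + (g x - f x)) = \<Lambda> f + \<Lambda> (\<lambda>x. g x - f x)" by (rule \<Lambda>_add[OF assms(1) c])
  moreover have "0 \<le> \<Lambda> (\<lambda>x. g x - f x)" using assms by (intro \<Lambda>_nonneg c) simp
  ultimately show ?thesis by simp
qed

lemma \<Lambda>_cong:
  "continuous_on K f \<Longrightarrow> continuous_on K g \<Longrightarrow> (\<And>x. x \<in> K \<Longrightarrow> f x = g x) \<Longrightarrow> \<Lambda> f = \<Lambda> g"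
  by (intro antisym \<Lambda>_mono) auto

lemma \<Lambda>_zero: "\<Lambda> (\<lambda>x. 0) = 0"
  using \<Lambda>_scale[of "\<lambda>x. 0" 0] by simp

lemma \<Lambda>_sum:
  assumes "\<And>i. i \<in> I \<Longrightarrow> continuous_on K (f i)"
  shows "\<Lambda> (\<lambda>x. \<Sum>i\<in>I. f i x) = (\<Sum>i\<in>I. \<Lambda> (f i))"
  using assms
proof (induction I rule: infinite_finite_induct)
  case (insert i I)
  then have "\<Lambda> (\<lambda>x. f i x + (\<Sum>i\<in>I. f i x)) = \<Lambda> (f i) + \<Lambda> (\<lambda>x. \<Sum>i\<in>I. f i x)"
    by (intro \<Lambda>_add continuous_intros) auto
  with insert show ?case by simp
qed (simp_all add: \<Lambda>_zero)

definition mass :: real where "mass = \<Lambda> (\<lambda>x. 1)"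

lemma mass_nonneg: "0 \<le> mass"
  unfolding mass_def by (intro \<Lambda>_nonneg continuous_intros) simp

lemma \<Lambda>_const: "\<Lambda> (\<lambda>x. c) = c * mass"
  using \<Lambda>_scale[of "\<lambda>x. 1" c] by (simp add: mass_def)

section \<open>The outer measure of a positive functional\<close>

text \<open>Vanishing off \<open>U\<close> replaces the usual requirement of compact support inside
  \<open>U\<close>; truncation at a level \<open>\<delta>\<close> recovers compactness at the price
  of \<open>\<delta> * mass\<close>.\<close>

definition subordinate :: "'a set \<Rightarrow> ('a \<Rightarrow> real) set" where
  "subordinate U = {f. continuous_on K f \<and> (\<forall>x\<in>K. 0 \<le> f x \<and> f x \<le> 1) \<and> (\<forall>x\<in>K - U. f x = 0)}"

definition open_mass :: "'a set \<Rightarrow> ennreal" where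
  "open_mass U = (SUP f\<in>subordinate U. ennreal (\<Lambda> f))"

definition outer :: "'a set \<Rightarrow> ennreal" where
  "outer E = (INF U\<in>{U. open U \<and> E \<subseteq> U}. open_mass U)"

lemma zero_subordinate: "(\<lambda>x. 0) \<in> subordinate U"
  by (simp add: subordinate_def)

lemma \<Lambda>_le_open_mass: "f \<in> subordinate U \<Longrightarrow> ennreal (\<Lambda> f) \<le> open_mass U"
  unfolding open_mass_def by (rule SUP_upper)

lemma \<Lambda>_subordinate: "f \<in> subordinate U \<Longrightarrow> 0 \<le> \<Lambda> f"
  unfolding subordinate_def by (intro \<Lambda>_nonneg) auto

lemma open_mass_mono: "U \<subseteq> W \<Longrightarrow> open_mass U \<le> open_mass W"
  unfolding open_mass_def by (intro SUP_subset_mono) (auto simp: subordinate_def)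

lemma open_mass_disjoint:
  assumes "U \<inter> K = {}" shows "open_mass U = 0"
proof -
  have "\<Lambda> f = 0" if "f \<in> subordinate U" for f
  proof -
    have "\<Lambda> f = \<Lambda> (\<lambda>x. 0)"
      using that assms unfolding subordinate_def by (intro \<Lambda>_cong) auto
    then show ?thesis by (simp add: \<Lambda>_zero)
  qed
  then have "open_mass U \<le> 0" unfolding open_mass_def by (intro SUP_least) simp
  then show ?thesis by simp
qed

lemma open_mass_UNIV: "open_mass UNIV = ennreal mass"
proof (rule antisym)
  show "open_mass UNIV \<le> ennreal mass"
    unfolding open_mass_def mass_def
    by (intro SUP_least ennreal_leI \<Lambda>_mono) (auto simp: subordinate_def)
  show "ennreal mass \<le> open_mass UNIV"
    unfolding mass_def by (rule \<Lambda>_le_open_mass) (simp add: subordinate_def)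
qed

lemma outer_open: "open U \<Longrightarrow> outer U = open_mass U"
  unfolding outer_def
  by (intro antisym INF_lower INF_greatest open_mass_mono) auto

lemma outer_mono: "E \<subseteq> F \<Longrightarrow> outer E \<le> outer F"
  unfolding outer_def by (intro INF_superset_mono) auto

lemma outer_le_open_mass: "open U \<Longrightarrow> E \<subseteq> U \<Longrightarrow> outer E \<le> open_mass U"
  using outer_mono outer_open by metis

lemma outer_le_mass: "outer E \<le> ennreal mass"
  using outer_le_open_mass[of UNIV E] by (simp add: open_mass_UNIV)

lemma subordinate_truncate:
  assumes f: "f \<in> subordinate U" and \<delta>: "\<delta> > 0"
  defines "f' \<equiv> \<lambda>x. max 0 (f x - \<delta>)"
  shows "f' \<in> subordinate U" "\<Lambda> f \<le> \<Lambda> f' + \<delta> * mass" "\<And>x. x \<in> K \<Longrightarrow> f x < \<delta> \<Longrightarrow> f' x = 0"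
    "compact {x\<in>K. \<delta> \<le> f x}" "{x\<in>K. \<delta> \<le> f x} \<subseteq> U"
proof -
  have cf: "continuous_on K f" and f01: "\<And>x. x \<in> K \<Longrightarrow> 0 \<le> f x \<and> f x \<le> 1"
    and f0: "\<And>x. x \<in> K \<Longrightarrow> x \<notin> U \<Longrightarrow> f x = 0"
    using f by (auto simp: subordinate_def)
  have cf': "continuous_on K f'" unfolding f'_def using cf by (intro continuous_intros)
  show "f' \<in> subordinate U"
    using cf' f01 f0 \<delta> unfolding subordinate_def by (fastforce simp: f'_def max_def)
  have "\<Lambda> f \<le> \<Lambda> (\<lambda>x. f' x + \<delta>)"
    using cf cf' by (intro \<Lambda>_mono continuous_intros) (auto simp: f'_def)
  also have "\<dots> = \<Lambda> f' + \<delta> * mass"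
    using \<Lambda>_add[OF cf', of "\<lambda>x. \<delta>"] by (simp add: \<Lambda>_const)
  finally show "\<Lambda> f \<le> \<Lambda> f' + \<delta> * mass" .
  show "x \<in> K \<Longrightarrow> f x < \<delta> \<Longrightarrow> f' x = 0" for x by (simp add: f'_def)
  have "closed {x\<in>K. \<delta> \<le> f x}"
    using continuous_on_closed_Collect_le[of K "\<lambda>x. \<delta>" f] cf K compact_imp_closed by auto
  moreover have "{x\<in>K. \<delta> \<le> f x} = K \<inter> {x\<in>K. \<delta> \<le> f x}" by blast
  ultimately show "compact {x\<in>K. \<delta> \<le> f x}" using compact_Int_closed[OF K] by metis
  show "{x\<in>K. \<delta> \<le> f x} \<subseteq> U" using f0 \<delta> by force
qed

text \<open>Reduces an estimate for \<open>f\<close> to its truncations, which live on the compact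
  set \<open>{x\<in>K. \<delta> \<le> f x}\<close>. The loss \<open>\<delta> * mass\<close> is at
  most \<open>e\<close> for \<open>\<delta> = e / (mass + 1)\<close>, also when
  \<open>mass = 0\<close>.\<close>

lemma ennreal_le_by_truncation:
  assumes f: "f \<in> subordinate U"
    and le: "\<And>\<delta>. \<delta> > 0 \<Longrightarrow> ennreal (\<Lambda> (\<lambda>x. max 0 (f x - \<delta>))) + b \<le> c"
  shows "ennreal (\<Lambda> f) + b \<le> c"
proof (rule ennreal_le_epsilon)
  fix e :: real assume e: "e > 0"
  define \<delta> where "\<delta> = e / (mass + 1)"
  have \<delta>: "\<delta> > 0" "\<delta> * mass \<le> e"
    using e mass_nonneg unfolding \<delta>_def by (auto simp: field_simps)
  note t = subordinate_truncate[OF f \<delta>(1)]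
  have "ennreal (\<Lambda> f) \<le> ennreal (\<Lambda> (\<lambda>x. max 0 (f x - \<delta>)) + e)"
    using t(2) \<delta>(2) by (intro ennreal_leI) simp
  also have "\<dots> = ennreal (\<Lambda> (\<lambda>x. max 0 (f x - \<delta>))) + ennreal e"
    using \<Lambda>_subordinate[OF t(1)] e by simp
  finally have "ennreal (\<Lambda> f) + b \<le> (ennreal (\<Lambda> (\<lambda>x. max 0 (f x - \<delta>))) + b) + ennreal e"
    by (metis add.assoc add.commute add_right_mono)
  also have "\<dots> \<le> c + ennreal e" by (intro add_right_mono le \<delta>)
  finally show "ennreal (\<Lambda> f) + b \<le> c + ennreal e" .
qed

text \<open>The ambient space is not assumed normal, but \<open>K\<close> is, being compact
  Hausdorff; hence the separating function is continuous only on \<open>K\<close>.\<close>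

lemma Urysohn_on_compact:
  assumes A: "closed A" "A \<subseteq> K" and B: "closed B" "B \<subseteq> K" and disj: "A \<inter> B = {}"
  obtains h :: "'a \<Rightarrow> real" where "continuous_on K h" "\<And>x. x \<in> K \<Longrightarrow> 0 \<le> h x \<and> h x \<le> 1"
    "\<And>x. x \<in> A \<Longrightarrow> h x = 0" "\<And>x. x \<in> B \<Longrightarrow> h x = 1"
proof -
  let ?X = "top_of_set K"
  have "Hausdorff_space (euclidean :: 'a topology)"
    unfolding Hausdorff_space_def by (auto simp: disjnt_def) (metis hausdorff)
  then have "normal_space ?X"
    using K by (intro compact_Hausdorff_or_regular_imp_normal_space)
      (simp_all add: compact_space_subtopology Hausdorff_space_subtopology)
  moreover have "closedin ?X A" "closedin ?X B" using A B by (auto intro: closed_subset)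
  moreover have "disjnt A B" using disj by (simp add: disjnt_def)
  ultimately obtain h where h: "continuous_map ?X (top_of_set {0..1::real}) h" "h ` A \<subseteq> {0}" "h ` B \<subseteq> {1}"
    using Urysohn_lemma[of ?X A B 0 1] by auto
  show ?thesis
  proof (rule that)
    show "continuous_on K h" using h(1) by (simp add: continuous_map_in_subtopology)
    show "0 \<le> h x \<and> h x \<le> 1" if "x \<in> K" for x
      using h(1) that by (auto simp: continuous_map_in_subtopology image_subset_iff)
  qed (use h in auto)
qed

text \<open>A partition of unity \<open>h\<close>, \<open>1 - h\<close> splits the truncated
  function. On its compact carrier the parts outside \<open>U\<close> and outside \<open>W\<close>
  are disjoint and closed, so \<open>h\<close> can be \<open>0\<close> on the former and
  \<open>1\<close> on the latter.\<close>

lemma open_mass_Un: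
  assumes U: "open U" and W: "open W"
  shows "open_mass (U \<union> W) \<le> open_mass U + open_mass W"
  unfolding open_mass_def[of "U \<union> W"]
proof (rule SUP_least)
  fix f assume f: "f \<in> subordinate (U \<union> W)"
  have "ennreal (\<Lambda> f) + 0 \<le> open_mass U + open_mass W"
  proof (rule ennreal_le_by_truncation[OF f])
    fix \<delta> :: real assume \<delta>: "\<delta> > 0"
    let ?f = "\<lambda>x. max 0 (f x - \<delta>)" and ?C = "{x\<in>K. \<delta> \<le> f x}"
    note t = subordinate_truncate[OF f \<delta>]
    have cl: "closed ?C" using t(4) by (rule compact_imp_closed)
    obtain h :: "'a \<Rightarrow> real" where h: "continuous_on K h" "\<And>x. x \<in> K \<Longrightarrow> 0 \<le> h x \<and> h x \<le> 1"
      "\<And>x. x \<in> ?C - U \<Longrightarrow> h x = 0" "\<And>x. x \<in> ?C - W \<Longrightarrow> h x = 1"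
    proof (rule Urysohn_on_compact[of "?C - U" "?C - W"])
      show "closed (?C - U)" "closed (?C - W)" using cl U W by (auto intro: closed_Diff)
      show "(?C - U) \<inter> (?C - W) = {}" using t(5) by blast
    qed auto
    have cf: "continuous_on K ?f" and f01: "\<And>x. x \<in> K \<Longrightarrow> 0 \<le> ?f x \<and> ?f x \<le> 1"
      using t(1) by (auto simp: subordinate_def)
    have s1: "(\<lambda>x. ?f x * h x) \<in> subordinate U"
      unfolding subordinate_def
    proof (intro CollectI conjI ballI)
      show "continuous_on K (\<lambda>x. ?f x * h x)" by (rule continuous_on_mult[OF cf h(1)])
      show "0 \<le> ?f x * h x" if "x \<in> K" for x using f01[OF that] h(2)[OF that] by simp
      show "?f x * h x \<le> 1" if "x \<in> K" for x using f01[OF that] h(2)[OF that] by (intro mult_le_one) auto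
      show "?f x * h x = 0" if "x \<in> K - U" for x
        using that t(3)[of x] h(3)[of x] by (cases "f x < \<delta>") auto
    qed
    have s2: "(\<lambda>x. ?f x * (1 - h x)) \<in> subordinate W"
      unfolding subordinate_def
    proof (intro CollectI conjI ballI)
      show "continuous_on K (\<lambda>x. ?f x * (1 - h x))" 
        by (rule continuous_on_mult[OF cf continuous_on_diff[OF continuous_on_const h(1)]])
      show "0 \<le> ?f x * (1 - h x)" if "x \<in> K" for x using f01[OF that] h(2)[OF that] by simp
      show "?f x * (1 - h x) \<le> 1" if "x \<in> K" for x using f01[OF that] h(2)[OF that] by (intro mult_le_one) auto
      show "?f x * (1 - h x) = 0" if "x \<in> K - W" for x
        using that t(3)[of x] h(4)[of x] by (cases "f x < \<delta>") auto
    qed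
    have "\<Lambda> ?f = \<Lambda> (\<lambda>x. ?f x * h x + ?f x * (1 - h x))" by (simp add: algebra_simps)
    also have "\<dots> = \<Lambda> (\<lambda>x. ?f x * h x) + \<Lambda> (\<lambda>x. ?f x * (1 - h x))"
      using s1 s2 by (intro \<Lambda>_add) (auto simp: subordinate_def)
    finally have "ennreal (\<Lambda> ?f) = ennreal (\<Lambda> (\<lambda>x. ?f x * h x)) + ennreal (\<Lambda> (\<lambda>x. ?f x * (1 - h x)))"
      using \<Lambda>_subordinate[OF s1] \<Lambda>_subordinate[OF s2] by simp
    also have "\<dots> \<le> open_mass U + open_mass W"
      by (intro add_mono \<Lambda>_le_open_mass s1 s2)
    finally show "ennreal (\<Lambda> ?f) + 0 \<le> open_mass U + open_mass W" by simp
  qed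
  then show "ennreal (\<Lambda> f) \<le> open_mass U + open_mass W" by simp
qed

lemma open_mass_finite_UN:
  assumes "finite I" "\<And>i. i \<in> I \<Longrightarrow> open (U i)"
  shows "open_mass (\<Union>i\<in>I. U i) \<le> (\<Sum>i\<in>I. open_mass (U i))"
  using assms
proof (induction I rule: finite_induct)
  case empty
  then show ?case by (simp add: open_mass_disjoint)
next
  case (insert i I)
  then have "open_mass (U i \<union> (\<Union>i\<in>I. U i)) \<le> open_mass (U i) + open_mass (\<Union>i\<in>I. U i)"
    by (intro open_mass_Un) auto
  also have "\<dots> \<le> open_mass (U i) + (\<Sum>i\<in>I. open_mass (U i))"
    using insert by (intro add_left_mono) auto
  finally show ?case using insert by simp
qed

text \<open>After truncation finitely many \<open>U n\<close> cover the carrier, by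
  compactness.\<close>

lemma open_mass_UN:
  fixes U :: "nat \<Rightarrow> 'a set"
  assumes U: "\<And>n. open (U n)"
  shows "open_mass (\<Union>n. U n) \<le> suminf (\<lambda>n. open_mass (U n))"
  unfolding open_mass_def[of "\<Union>n. U n"]
proof (rule SUP_least)
  fix f assume f: "f \<in> subordinate (\<Union>n. U n)"
  have "ennreal (\<Lambda> f) + 0 \<le> suminf (\<lambda>n. open_mass (U n))"
  proof (rule ennreal_le_by_truncation[OF f])
    fix \<delta> :: real assume \<delta>: "\<delta> > 0"
    let ?f = "\<lambda>x. max 0 (f x - \<delta>)" and ?C = "{x\<in>K. \<delta> \<le> f x}"
    note t = subordinate_truncate[OF f \<delta>]
    obtain I where I: "finite I" "?C \<subseteq> (\<Union>n\<in>I. U n)"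
      by (rule compactE_image[OF t(4), of UNIV U]) (use U t(5) in auto)
    have "?f \<in> subordinate (\<Union>n\<in>I. U n)"
      unfolding subordinate_def
    proof (intro CollectI conjI)
      show "\<forall>x\<in>K - (\<Union>n\<in>I. U n). ?f x = 0" using I(2) t(3) by (auto simp: not_le[symmetric])
    qed (use t(1) in \<open>auto simp: subordinate_def\<close>)
    then have "ennreal (\<Lambda> ?f) \<le> open_mass (\<Union>n\<in>I. U n)" by (rule \<Lambda>_le_open_mass)
    also have "\<dots> \<le> (\<Sum>n\<in>I. open_mass (U n))" by (intro open_mass_finite_UN I U)
    also have "\<dots> \<le> suminf (\<lambda>n. open_mass (U n))" by (intro sum_le_suminf I) auto
    finally show "ennreal (\<Lambda> ?f) + 0 \<le> suminf (\<lambda>n. open_mass (U n))" by simp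
  qed
  then show "ennreal (\<Lambda> f) \<le> suminf (\<lambda>n. open_mass (U n))" by simp
qed

lemma outer_approx:
  assumes "e > 0" obtains U where "open U" "E \<subseteq> U" "open_mass U < outer E + ennreal e"
proof -
  have "outer E < top" using outer_le_mass[of E] by (simp add: le_less_trans)
  then have "outer E < outer E + ennreal e" using assms by simp
  then have "(INF U\<in>{U. open U \<and> E \<subseteq> U}. open_mass U) < outer E + ennreal e"
    unfolding outer_def .
  then show ?thesis using that unfolding INF_less_iff by blast
qed

lemma outer_measure_space_outer: "outer_measure_space UNIV outer"
  unfolding outer_measure_space_def
proof (intro conjI)
  show "positive UNIV outer"
    unfolding positive_def using outer_open[of "{}"] by (simp add: open_mass_disjoint)
  show "increasing UNIV outer"
    unfolding increasing_def by (simp add: outer_mono)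
  show "countably_subadditive UNIV outer"
    unfolding countably_subadditive_def
  proof (intro allI impI)
    fix A :: "nat \<Rightarrow> 'a set"
    show "outer (\<Union>i. A i) \<le> suminf (\<lambda>i. outer (A i))"
    proof (rule ennreal_le_epsilon)
      fix e :: real assume e: "e > 0"
      have "\<forall>n. \<exists>U. open U \<and> A n \<subseteq> U \<and> open_mass U < outer (A n) + ennreal (e * (1/2) ^ Suc n)"
        using outer_approx e by (metis mult_pos_pos zero_less_power half_gt_zero_iff zero_less_one)
      then obtain U where U: "\<And>n. open (U n)" "\<And>n. A n \<subseteq> U n"
        "\<And>n. open_mass (U n) < outer (A n) + ennreal (e * (1/2) ^ Suc n)"
        by metis
      have "outer (\<Union>i. A i) \<le> open_mass (\<Union>n. U n)"
        using U by (intro outer_le_open_mass) auto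
      also have "\<dots> \<le> suminf (\<lambda>n. open_mass (U n))" by (rule open_mass_UN[OF U(1)])
      also have "\<dots> \<le> suminf (\<lambda>n. outer (A n) + ennreal (e * (1/2) ^ Suc n))"
        using U(3) by (intro suminf_le) (auto intro: less_imp_le)
      also have "\<dots> = suminf (\<lambda>n. outer (A n)) + suminf (\<lambda>n. ennreal e * ennreal ((1/2) ^ Suc n))"
        using e by (subst suminf_add[symmetric])
                   (auto simp del: ennreal_suminf_cmult simp add: ennreal_mult[symmetric])
      also have "\<dots> = suminf (\<lambda>n. outer (A n)) + ennreal e"
        unfolding ennreal_suminf_cmult
        by (subst suminf_ennreal_eq[OF zero_le_power power_half_series]) auto
      finally show "outer (\<Union>i. A i) \<le> suminf (\<lambda>n. outer (A n)) + ennreal e" .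
    qed
  qed
qed

text \<open>Caratheodory's condition on an open test set \<open>W\<close>. A truncated function
  lives on a compact part \<open>?C\<close> of \<open>W \<inter> U\<close>; adding any function
  subordinate to \<open>W - ?C\<close> never exceeds \<open>1\<close>, as one summand vanishes at
  each point of \<open>K\<close>.\<close>

lemma open_mass_split:
  assumes U: "open U" and W: "open W"
  shows "open_mass (W \<inter> U) + outer (W - U) \<le> open_mass W"
proof -
  have "ennreal (\<Lambda> f) + outer (W - U) \<le> open_mass W" if f: "f \<in> subordinate (W \<inter> U)" for f
  proof (rule ennreal_le_by_truncation[OF f])
    fix \<delta> :: real assume \<delta>: "\<delta> > 0"
    let ?f = "\<lambda>x. max 0 (f x - \<delta>)" and ?C = "{x\<in>K. \<delta> \<le> f x}"
    note t = subordinate_truncate[OF f \<delta>]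
    have op: "open (W - ?C)" using W compact_imp_closed[OF t(4)] by (rule open_Diff)
    have "ennreal (\<Lambda> ?f) + ennreal (\<Lambda> g) \<le> open_mass W" if g: "g \<in> subordinate (W - ?C)" for g
    proof -
      have "(\<lambda>x. ?f x + g x) \<in> subordinate W"
        unfolding subordinate_def
      proof (intro CollectI conjI ballI)
        show "continuous_on K (\<lambda>x. ?f x + g x)"
          using t(1) g by (intro continuous_on_add) (simp_all add: subordinate_def)
        show "0 \<le> ?f x + g x" if "x \<in> K" for x using g that by (auto simp: subordinate_def)
        show "?f x + g x \<le> 1" if "x \<in> K" for x
        proof (cases "f x < \<delta>")
          case True
          then show ?thesis using that g by (simp add: subordinate_def)
        next
          case False
          then have "g x = 0" using that g by (auto simp: subordinate_def)
          then show ?thesis using t(1) that by (simp add: subordinate_def)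
        qed
        show "?f x + g x = 0" if "x \<in> K - W" for x
          using that t(1) g by (auto simp: subordinate_def)
      qed
      moreover have "\<Lambda> (\<lambda>x. ?f x + g x) = \<Lambda> ?f + \<Lambda> g"
        using t(1) g by (intro \<Lambda>_add) (auto simp: subordinate_def)
      ultimately show ?thesis
        using \<Lambda>_le_open_mass[of "\<lambda>x. ?f x + g x" W] \<Lambda>_subordinate[OF t(1)] \<Lambda>_subordinate[OF g] by simp
    qed
    then have "ennreal (\<Lambda> ?f) + open_mass (W - ?C) \<le> open_mass W"
      unfolding open_mass_def[of "W - ?C"]
      by (subst ennreal_SUP_add_right) (use zero_subordinate in \<open>auto intro!: SUP_least\<close>)
    moreover have "outer (W - U) \<le> open_mass (W - ?C)"
      using t(5) by (intro outer_le_open_mass op) auto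
    ultimately show "ennreal (\<Lambda> ?f) + outer (W - U) \<le> open_mass W"
      by (meson add_left_mono order_trans)
  qed
  then show ?thesis
    unfolding open_mass_def[of "W \<inter> U"]
    by (subst ennreal_SUP_add_left[symmetric]) (use zero_subordinate in \<open>auto intro!: SUP_least\<close>)
qed

text \<open>As \<open>outer\<close> is an infimum over open supersets, the test set \<open>X\<close>
  may be replaced by an open \<open>W\<close>, where \<open>open_mass_split\<close> applies.\<close>

lemma open_in_lambda_system:
  assumes U: "open U" shows "U \<in> lambda_system UNIV UNIV outer"
  unfolding lambda_system_def
proof (intro CollectI conjI ballI antisym)
  fix X :: "'a set"
  have "subadditive UNIV outer"
    using outer_measure_space_outer ring_of_sets.countably_subadditive_subadditive[of UNIV "Pow UNIV" outer]
    by (simp add: outer_measure_space_def)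
       (metis Pow_UNIV algebra.axioms(1) algebra_Pow)
  then have "outer ((U \<inter> X) \<union> ((UNIV - U) \<inter> X)) \<le> outer (U \<inter> X) + outer ((UNIV - U) \<inter> X)"
    by (rule subadditiveD) auto
  moreover have "(U \<inter> X) \<union> ((UNIV - U) \<inter> X) = X" by auto
  ultimately show "outer X \<le> outer (U \<inter> X) + outer ((UNIV - U) \<inter> X)" by simp
  show "outer (U \<inter> X) + outer ((UNIV - U) \<inter> X) \<le> outer X"
    unfolding outer_def[of X]
  proof (rule INF_greatest)
    fix W assume W: "W \<in> {W. open W \<and> X \<subseteq> W}"
    have "outer (U \<inter> X) + outer ((UNIV - U) \<inter> X) \<le> open_mass (W \<inter> U) + outer (W - U)"
      using W U by (intro add_mono outer_le_open_mass outer_mono) auto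
    also have "\<dots> \<le> open_mass W" using W U by (intro open_mass_split) auto
    finally show "outer (U \<inter> X) + outer ((UNIV - U) \<inter> X) \<le> open_mass W" .
  qed
qed simp

section \<open>The Borel measure and its regularity\<close>

definition riesz_measure :: "'a measure" where
  "riesz_measure = measure_of UNIV (sets borel) outer"

lemma sets_riesz_measure [simp, measurable_cong]: "sets riesz_measure = sets borel"
  and space_riesz_measure [simp]: "space riesz_measure = UNIV"
  unfolding riesz_measure_def using sets.sigma_sets_eq[of "borel :: 'a measure"]
  by (simp_all add: space_borel)

text \<open>\<open>measure_of\<close> returns \<open>outer\<close> only where it is countably
  additive. Caratheodory's theorem gives this on the lambda system, a sigma algebra that contains
  the open sets and so all Borel sets.\<close>

lemma emeasure_riesz_measure:
  assumes "A \<in> sets borel" shows "emeasure riesz_measure A = outer A"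
proof -
  let ?ls = "lambda_system UNIV UNIV outer"
  have ms: "measure_space UNIV ?ls outer"
    using sigma_algebra.caratheodory_lemma[OF sigma_algebra_Pow[of UNIV], of outer] outer_measure_space_outer
    by simp
  then have sa: "sigma_algebra UNIV ?ls" by (simp add: measure_space_def)
  have "sets borel \<subseteq> ?ls"
    using open_in_lambda_system sigma_algebra.sigma_sets_subset[OF sa, of "{S. open S}"]
    by (auto simp: borel_def)
  then have "measure_space UNIV (sets borel) outer"
    using sets.sigma_algebra_axioms[of "borel :: 'a measure"] by (intro measure_down[OF ms]) auto
  then show ?thesis
    unfolding riesz_measure_def using assms sets.sigma_algebra_axioms[of "borel :: 'a measure"]
    by (intro emeasure_measure_of_sigma) (auto simp: measure_space_def)
qed

lemma emeasure_riesz_measure_open: "open U \<Longrightarrow> emeasure riesz_measure U = open_mass U"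
  by (simp add: emeasure_riesz_measure outer_open)

lemma finite_measure_riesz_measure: "finite_measure riesz_measure"
  by (rule finite_measureI) (simp add: emeasure_riesz_measure_open open_mass_UNIV)

sublocale riesz: finite_measure riesz_measure
  by (rule finite_measure_riesz_measure)

lemma measure_riesz_UNIV: "measure riesz_measure UNIV = mass"
  by (simp add: measure_def emeasure_riesz_measure_open open_mass_UNIV mass_nonneg)

lemma emeasure_riesz_compl: "emeasure riesz_measure (UNIV - K) = 0"
  using compact_imp_closed[OF K]
  by (subst emeasure_riesz_measure_open) (auto intro: open_mass_disjoint)

lemma AE_riesz: "AE x in riesz_measure. x \<in> K"
  using emeasure_riesz_compl compact_imp_closed[OF K]
  by (intro AE_I[of _ _ "UNIV - K"]) auto

text \<open>Dual to outer regularity: if an open \<open>U\<close> contains the complement of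
  \<open>B\<close> with excess less than \<open>e\<close>, then \<open>K - U\<close> is a compact
  subset of \<open>B\<close> missing at most \<open>e\<close> of its mass, since the measure is
  finite and lives on \<open>K\<close>.\<close>

lemma riesz_inner_regular:
  assumes B: "B \<in> sets borel"
  shows "emeasure riesz_measure B = (SUP C\<in>{C. compact C \<and> C \<subseteq> B}. emeasure riesz_measure C)"
proof (rule antisym)
  show "(SUP C\<in>{C. compact C \<and> C \<subseteq> B}. emeasure riesz_measure C) \<le> emeasure riesz_measure B"
    using B by (intro SUP_least emeasure_mono) auto
  show "emeasure riesz_measure B \<le> (SUP C\<in>{C. compact C \<and> C \<subseteq> B}. emeasure riesz_measure C)"
  proof (rule ennreal_le_epsilon)
    fix e :: real assume e: "e > 0"
    let ?m = "measure riesz_measure"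
    obtain U where U: "open U" "UNIV - B \<subseteq> U" "open_mass U < outer (UNIV - B) + ennreal e"
      using outer_approx[OF e] by blast
    have "UNIV - B \<in> sets borel" using B by auto
    then have "ennreal (?m U) < ennreal (?m (UNIV - B)) + ennreal e"
      using U emeasure_riesz_measure_open[OF U(1)] emeasure_riesz_measure[of "UNIV - B"]
      by (simp add: riesz.emeasure_eq_measure)
    then have mU: "?m U < ?m (UNIV - B) + e"
      using e by (simp add: ennreal_less_iff flip: ennreal_plus)
    have "?m (UNIV - B) = ?m UNIV - ?m B"
      using B riesz.finite_measure_compl[of B] by simp
    moreover have "?m (UNIV - U) = ?m UNIV - ?m U"
      using U riesz.finite_measure_compl[of U] by simp
    moreover have "?m (K - U) = ?m (UNIV - U)"
      using K U AE_riesz compact_imp_closed[OF K]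
      by (intro riesz.finite_measure_eq_AE) auto
    ultimately have "?m B \<le> ?m (K - U) + e" using mU by simp
    then have "emeasure riesz_measure B \<le> emeasure riesz_measure (K - U) + ennreal e"
      using e by (simp add: riesz.emeasure_eq_measure ennreal_leI flip: ennreal_plus)
    also have "\<dots> \<le> (SUP C\<in>{C. compact C \<and> C \<subseteq> B}. emeasure riesz_measure C) + ennreal e"
      using K U by (intro add_right_mono SUP_upper) (auto intro: compact_diff)
    finally show "emeasure riesz_measure B
        \<le> (SUP C\<in>{C. compact C \<and> C \<subseteq> B}. emeasure riesz_measure C) + ennreal e" .
  qed
qed

section \<open>Integration against the Riesz measure\<close>

lemma riesz_integrable:
  fixes f :: "'a \<Rightarrow> real"
  assumes f: "continuous_on UNIV f"
  shows "integrable riesz_measure f"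
proof -
  obtain c where "\<And>x. x \<in> K \<Longrightarrow> \<bar>f x\<bar> \<le> c"
    using compact_imp_bounded[OF compact_continuous_image[OF continuous_on_subset[OF f] K]]
    by (auto simp: bounded_iff)
  then show ?thesis
    using AE_riesz borel_measurable_continuous_onI[OF f]
    by (intro riesz.integrable_const_bound[of _ c]) (auto elim!: eventually_mono)
qed

text \<open>Slices a function with values in \<open>[0,1]\<close> into layers \<open>min (1/n) (f - k/n)\<^sup>+\<close>, each of which
  is \<open>1/n\<close> times a function subordinate to \<open>{f > k/n}\<close>.\<close>

lemma \<Lambda>_le_integral_unit:
  assumes f: "continuous_on UNIV f" and f01: "\<And>x. x \<in> K \<Longrightarrow> 0 \<le> f x \<and> f x \<le> 1"
  shows "\<Lambda> f \<le> (\<integral>x. f x \<partial>riesz_measure)"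
proof -
  let ?m = "measure riesz_measure"
  have cf: "continuous_on K f" using f by (rule continuous_on_subset) simp
  have *: "\<Lambda> f \<le> (\<integral>x. f x \<partial>riesz_measure) + mass / real n" if n: "n > 0" for n :: nat
  proof -
    define U where "U k = {x. real k / real n < f x}" for k :: nat
    define g where "g k x = min (1 / real n) (max 0 (f x - real k / real n))" for k :: nat and x
    have U: "open (U k)" for k
      unfolding U_def using f by (intro open_Collect_less continuous_intros) auto
    have cg: "continuous_on K (g k)" for k
      unfolding g_def using cf by (intro continuous_intros)
    have "(\<lambda>x. real n * g k x) \<in> subordinate (U k)" for k
      unfolding subordinate_def
    proof (intro CollectI conjI ballI)
      show "continuous_on K (\<lambda>x. real n * g k x)" using cg by (intro continuous_intros)
      show "0 \<le> real n * g k x" for x by (simp add: g_def)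
      have "g k x \<le> 1 / real n" for x by (simp add: g_def)
      then show "real n * g k x \<le> 1" for x using n by (simp add: field_simps)
      show "real n * g k x = 0" if "x \<in> K - U k" for x using that by (simp add: g_def U_def)
    qed
    from \<Lambda>_le_open_mass[OF this] have "ennreal (real n * \<Lambda> (g k)) \<le> ennreal (?m (U k))" for k
      using U \<Lambda>_scale[OF cg]
      by (simp add: riesz.emeasure_eq_measure flip: emeasure_riesz_measure_open)
    then have gk: "\<Lambda> (g k) \<le> (1 / real n) * ?m (U k)" for k
      using n by (simp add: field_simps)
    have layers: "(\<Sum>k<j. g k x) = min (f x) (real j / real n)" if "x \<in> K" for x j
    proof (induction j)
      case 0
      then show ?case using f01[OF that] by simp
    next
      case (Suc j)
      have "real (Suc j) / real n = real j / real n + 1 / real n" by (simp add: add_divide_distrib)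
      moreover have "min t a + min e (max 0 (t - a)) = min t (a + e)" if "0 \<le> e" for t a e :: real
        using that by linarith
      ultimately show ?case using Suc by (simp add: g_def)
    qed
    have "\<Lambda> f = \<Lambda> (\<lambda>x. \<Sum>k<n. g k x)"
      using layers[of _ n] f01 n cf cg by (intro \<Lambda>_cong continuous_intros) auto
    also have "\<dots> = (\<Sum>k<n. \<Lambda> (g k))" using cg by (intro \<Lambda>_sum) auto
    also have "\<dots> \<le> (\<Sum>k<n. (1 / real n) * ?m (U k))" by (intro sum_mono gk)
    also have "\<dots> = (\<integral>x. (\<Sum>k<n. (1 / real n) * indicator (U k) x) \<partial>riesz_measure)"
      using U by (simp add: riesz.emeasure_eq_measure)
    also have "\<dots> \<le> (\<integral>x. f x + 1 / real n \<partial>riesz_measure)"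
    proof (rule integral_mono_AE)
      show "integrable riesz_measure (\<lambda>x. \<Sum>k<n. (1 / real n) * indicator (U k) x :: real)"
        using U by (intro Bochner_Integration.integrable_sum integrable_mult_right)
          (simp add: riesz.emeasure_eq_measure)
      show "integrable riesz_measure (\<lambda>x. f x + 1 / real n)"
        using riesz_integrable[OF f] by simp
      show "AE x in riesz_measure. (\<Sum>k<n. (1 / real n) * indicator (U k) x) \<le> f x + 1 / real n"
        using AE_riesz
      proof eventually_elim
        case (elim x)
        \<comment> \<open>The excess \<open>1 / n\<close> is the topmost layer, which
          \<open>f x\<close> may fill only partly.\<close>
        have "(\<Sum>k<j. (1 / real n) * indicator (U k) x) \<le> min (f x) (real j / real n) + 1 / real n" for j
        proof (induction j)
          case 0
          then show ?case using f01[OF elim] by simp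
        next
          case (Suc j)
          have S: "real (Suc j) / real n = real j / real n + 1 / real n" by (simp add: add_divide_distrib)
          show ?case
          proof (cases "x \<in> U j")
            case True
            have "(\<Sum>k<Suc j. (1 / real n) * indicator (U k) x) \<le> (\<Sum>k<Suc j. 1 / real n)"
              by (intro sum_mono) (simp add: indicator_def)
            then have "(\<Sum>k<Suc j. (1 / real n) * indicator (U k) x) \<le> real (Suc j) / real n" by simp
            moreover have "real j / real n < f x" using True by (simp add: U_def)
            moreover have "0 \<le> 1 / real n" by simp
            ultimately show ?thesis unfolding S by linarith
          next
            case False
            then have "(\<Sum>k<Suc j. (1 / real n) * indicator (U k) x) = (\<Sum>k<j. (1 / real n) * indicator (U k) x)"
              by simp
            moreover have "0 \<le> 1 / real n" by simp
            ultimately show ?thesis using Suc unfolding S by linarith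
          qed
        qed
        from this[of n] show ?case using f01[OF elim] n by simp
      qed
    qed
    also have "\<dots> = (\<integral>x. f x \<partial>riesz_measure) + mass / real n"
      using riesz_integrable[OF f] by (simp add: measure_riesz_UNIV)
    finally show ?thesis .
  qed
  have "(\<lambda>n. (\<integral>x. f x \<partial>riesz_measure) + mass / real n) \<longlonglongrightarrow> (\<integral>x. f x \<partial>riesz_measure) + 0"
    by (intro tendsto_intros lim_const_over_n)
  then show ?thesis
    using * by (intro tendsto_lowerbound[of _ _ sequentially]) (auto simp: eventually_sequentially intro!: exI[of _ 1])
qed

text \<open>A function bounded by \<open>c\<close> on \<open>K\<close> is moved into
  \<open>[0, 1]\<close> by adding \<open>c\<close> and dividing by \<open>2 * c\<close>. The
  constants cancel because \<open>\<Lambda>\<close> and the measure give \<open>1\<close> the same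
  value \<open>mass\<close>.\<close>

lemma \<Lambda>_le_integral:
  assumes f: "continuous_on UNIV f"
  shows "\<Lambda> f \<le> (\<integral>x. f x \<partial>riesz_measure)"
proof -
  have cf: "continuous_on K f" using f by (rule continuous_on_subset) simp
  obtain b where b: "\<And>x. x \<in> K \<Longrightarrow> \<bar>f x\<bar> \<le> b"
    using compact_imp_bounded[OF compact_continuous_image[OF cf K]] by (auto simp: bounded_iff)
  define c where "c = max b 1"
  have c: "c > 0" "\<And>x. x \<in> K \<Longrightarrow> \<bar>f x\<bar> \<le> c" using b by (auto simp: c_def le_max_iff_disj)
  let ?g = "\<lambda>x. (1 / (2 * c)) * (f x + c)"
  have "\<Lambda> ?g = (1 / (2 * c)) * (\<Lambda> f + c * mass)"
    using \<Lambda>_scale[OF continuous_on_add[OF cf continuous_on_const], of "1 / (2 * c)" c]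
      \<Lambda>_add[OF cf continuous_on_const, of c]
    by (simp add: \<Lambda>_const)
  moreover have "(\<integral>x. ?g x \<partial>riesz_measure) = (1 / (2 * c)) * ((\<integral>x. f x \<partial>riesz_measure) + c * mass)"
    using riesz_integrable[OF f] by (simp add: measure_riesz_UNIV mult.commute)
  moreover have "\<Lambda> ?g \<le> (\<integral>x. ?g x \<partial>riesz_measure)"
  proof (rule \<Lambda>_le_integral_unit)
    show "continuous_on UNIV ?g" using f by (intro continuous_intros)
    show "0 \<le> ?g x \<and> ?g x \<le> 1" if "x \<in> K" for x
      using c(1) c(2)[OF that] by (auto simp: field_simps abs_le_iff)
  qed
  ultimately show ?thesis using c(1) by (simp add: divide_le_cancel)
qed

text \<open>The one-sided estimate for \<open>f\<close> and for \<open>- f\<close> together give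
  equality.\<close>

lemma riesz_integral:
  assumes f: "continuous_on UNIV f"
  shows "(\<integral>x. f x \<partial>riesz_measure) = \<Lambda> f"
proof (rule antisym)
  have cf: "continuous_on K f" using f by (rule continuous_on_subset) simp
  show "\<Lambda> f \<le> (\<integral>x. f x \<partial>riesz_measure)" by (rule \<Lambda>_le_integral[OF f])
  have "\<Lambda> (\<lambda>x. (-1) * f x) \<le> (\<integral>x. (-1) * f x \<partial>riesz_measure)"
    using f by (intro \<Lambda>_le_integral continuous_intros)
  then show "(\<integral>x. f x \<partial>riesz_measure) \<le> \<Lambda> f" using \<Lambda>_scale[OF cf, of "-1"] by simp
qed

end

section \<open>The algebraic dual\<close>

text \<open>The infimum is attained: for each \<open>w\<close> the inequality with constant
  \<open>i + e\<close> survives \<open>e \<rightarrow> 0\<close>.\<close>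

lemma dual_ball_iff:
  assumes \<rho>: "seminorm \<rho>"
  shows "l \<in> dual_ball \<rho> i \<longleftrightarrow> (\<forall>w. \<bar>dual_apply l w\<bar> \<le> real i * \<rho> w)"
proof
  assume "\<forall>w. \<bar>dual_apply l w\<bar> \<le> real i * \<rho> w"
  then have "dual_seminorm \<rho> l \<le> ennreal (real i)"
    unfolding dual_seminorm_def by (intro Inf_lower) (auto intro!: exI[of _ "real i"])
  then show "l \<in> dual_ball \<rho> i" by (simp add: dual_ball_def ennreal_of_nat_eq_real_of_nat)
next
  assume l: "l \<in> dual_ball \<rho> i"
  show "\<forall>w. \<bar>dual_apply l w\<bar> \<le> real i * \<rho> w"
  proof
    fix w
    have *: "\<bar>dual_apply l w\<bar> \<le> (real i + e) * \<rho> w" if e: "e > 0" for e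
    proof -
      have "dual_seminorm \<rho> l < ennreal (real i + e)"
        using l e by (auto simp: dual_ball_def ennreal_of_nat_eq_real_of_nat intro: le_less_trans ennreal_lessI)
      then obtain C where C: "0 \<le> C" "\<forall>w. \<bar>dual_apply l w\<bar> \<le> C * \<rho> w" "ennreal C < ennreal (real i + e)"
        unfolding dual_seminorm_def Inf_less_iff by auto
      then have "C \<le> real i + e" by (simp add: ennreal_less_iff)
      then show ?thesis
        using C(2) mult_right_mono[of C "real i + e" "\<rho> w"] seminorm_nonneg[OF \<rho>, of w] by (meson order_trans)
    qed
    have "(\<lambda>n. (real i + 1 / real (Suc n)) * \<rho> w) \<longlonglongrightarrow> (real i + 0) * \<rho> w"
      by (intro tendsto_intros LIMSEQ_Suc[OF lim_1_over_n])
    then have "\<bar>dual_apply l w\<bar> \<le> (real i + 0) * \<rho> w"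
      using * by (intro tendsto_lowerbound[of _ _ sequentially]) (auto intro!: always_eventually)
    then show "\<bar>dual_apply l w\<bar> \<le> real i * \<rho> w" by simp
  qed
qed

lemma hat_add: "hat (f + g) l = hat f l + hat g l"
  and hat_mult: "hat (f * g) l = hat f l * hat g l"
  and hat_scaleR: "hat (c *\<^sub>R f) l = c * hat f l"
  and hat_one: "hat 1 l = 1"
  using alg_hom_sym_lift[OF linear_dual_apply, of l]
  by (auto simp: hat_def alg_hom_def linear_add linear_scale)

lemma hat_embed: "hat (sym_embed v) l = dual_apply l v"
  by (simp add: hat_def sym_lift_embed linear_dual_apply)

lemma hat_abs: "hat (abs_sym_alg p) l = free_eval (dual_apply l) p"
  by (simp add: hat_def sym_lift_abs linear_dual_apply)

text \<open>By uniqueness of lifts the identity is the lift of \<open>sym_embed\<close>. This writes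
  every element of \<open>S(V)\<close> in the form that \<open>free_eval_in_cone\<close>
  handles.\<close>

lemma abs_sym_alg_eq_free_eval: "abs_sym_alg p = free_eval sym_embed p"
proof -
  have "(\<lambda>f. f) = sym_lift (sym_embed :: 'a \<Rightarrow> _)"
    by (rule sym_lift_unique[OF _ _ linear_sym_embed]) (auto simp: alg_hom_def linear_id[unfolded id_def])
  then show ?thesis using sym_lift_abs[OF linear_sym_embed, of p] by metis
qed

lemma continuous_on_dual_apply: "continuous_on UNIV (\<lambda>l. dual_apply l v)"
  unfolding continuous_on_open_vimage[OF open_UNIV]
  using open_dual_apply_vimage[of _ v] by (auto simp: vimage_def)

lemma continuous_on_free_eval:
  assumes "\<And>v. continuous_on S (\<lambda>y. x y v)"
  shows "continuous_on S (\<lambda>y. free_eval (x y) p :: real)"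
proof -
  have "continuous_on S (\<lambda>y. \<Prod>v\<in>#m. x y v)" for m
  proof (induction m)
    case (add v m)
    then show ?case by (simp add: continuous_on_mult assms)
  qed simp
  then show ?thesis unfolding free_eval_def by (intro continuous_intros)
qed

lemma continuous_on_hat: "continuous_on S (hat f)"
proof -
  obtain p where p: "f = abs_sym_alg p" by (rule sym_alg_abs_cases)
  have "continuous_on UNIV (hat f)"
    unfolding p hat_abs[abs_def] by (intro continuous_on_free_eval continuous_on_dual_apply)
  then show ?thesis by (rule continuous_on_subset) simp
qed

lemma continuous_on_coordinate: "continuous_on S (\<lambda>x :: 'v \<Rightarrow> real. x v)"
  by (rule continuous_on_subset[OF continuous_on_product_coordinates]) simp

section \<open>Compactness of the dual balls\<close>

text \<open>The dual carries the subspace topology of the product of real lines; this lets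
  compactness be transported from the product.\<close>

lemma open_alg_dual_vimage:
  assumes "open U" shows "\<exists>W. open W \<and> U = dual_apply -` W"
  using assms unfolding open_alg_dual_def
proof induction
  case UNIV
  then show ?case by (intro exI[of _ UNIV]) simp
next
  case (Int a b)
  then obtain V W where "open V" "a = dual_apply -` V" "open W" "b = dual_apply -` W" by blast
  then show ?case by (intro exI[of _ "V \<inter> W"]) (simp add: open_Int)
next
  case (UN K)
  then obtain W where "\<And>k. k \<in> K \<Longrightarrow> open (W k) \<and> k = dual_apply -` W k" by metis
  then show ?case by (intro exI[of _ "\<Union>k\<in>K. W k"]) (auto simp: vimage_UN)
next
  case (Basis s)
  then obtain v W where "s = {l. dual_apply l v \<in> W}" "open W" by blast
  moreover have "open ((\<lambda>x. x v) -` W)"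
    using \<open>open W\<close> continuous_on_coordinate by (rule open_vimage)
  ultimately show ?case by (intro exI[of _ "(\<lambda>x. x v) -` W"]) auto
qed

lemma compact_box: "compact {x :: 'v \<Rightarrow> real. \<forall>v. \<bar>x v\<bar> \<le> r v}"
proof -
  have "compactin (product_topology (\<lambda>v. euclidean) UNIV) (\<Pi>\<^sub>E v\<in>UNIV. {- r v..r v})"
    by (simp add: compactin_PiE)
  moreover have "(\<Pi>\<^sub>E v\<in>UNIV. {- r v..r v}) = {x. \<forall>v. \<bar>x v\<bar> \<le> r v}"
    by (auto simp: PiE_def Pi_def abs_le_iff minus_le_iff)
  ultimately show ?thesis by (simp add: euclidean_product_topology)
qed

lemma linear_eq_INT:
  "{x :: 'v::real_vector \<Rightarrow> real. linear x} =
    (\<Inter>v w. {x. x (v + w) = x v + x w}) \<inter> (\<Inter>c v. {x. x (c *\<^sub>R v) = c * x v})"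
  by (auto simp: linear_iff)

lemma closed_linear: "closed {x :: 'v::real_vector \<Rightarrow> real. linear x}"
  unfolding linear_eq_INT
  by (intro closed_Int closed_INT ballI closed_Collect_eq continuous_on_coordinate continuous_on_add continuous_on_mult continuous_on_const)

text \<open>The Banach-Alaoglu argument: the ball is the image of a Tychonoff box intersected with
  the closed set of linear functions.\<close>

lemma compact_dual_ball:
  assumes \<rho>: "seminorm \<rho>" shows "compact (dual_ball \<rho> i)"
proof -
  let ?X = "{x. \<forall>v. \<bar>x v\<bar> \<le> real i * \<rho> v} \<inter> {x. linear x}"
  have "continuous_on ?X Abs_alg_dual"
    unfolding continuous_on_open_invariant
  proof (intro allI impI)
    fix B :: "'a alg_dual set" assume "open B"
    then obtain W where W: "open W" "B = dual_apply -` W" using open_alg_dual_vimage by blast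
    show "\<exists>A. open A \<and> A \<inter> ?X = Abs_alg_dual -` B \<inter> ?X"
      using W by (intro exI[of _ W]) (auto simp: Abs_alg_dual_inverse)
  qed
  then have "compact (Abs_alg_dual ` ?X)"
    by (intro compact_continuous_image compact_Int_closed compact_box closed_linear)
  moreover have "Abs_alg_dual ` ?X = dual_ball \<rho> i"
  proof (intro set_eqI iffI)
    fix l assume "l \<in> dual_ball \<rho> i"
    then have "dual_apply l \<in> ?X" by (simp add: dual_ball_iff[OF \<rho>] linear_dual_apply)
    then show "l \<in> Abs_alg_dual ` ?X" 
      by (intro image_eqI[of _ _ "dual_apply l"]) (simp_all add: dual_apply_inverse)
  qed (auto simp: dual_ball_iff[OF \<rho>] Abs_alg_dual_inverse)
  ultimately show ?thesis by simp
qed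

lemma zero_in_dual_ball: "seminorm \<rho> \<Longrightarrow> Abs_alg_dual (\<lambda>v. 0) \<in> dual_ball \<rho> i"
  by (simp add: dual_ball_iff Abs_alg_dual_inverse linear_zero seminorm_nonneg)

section \<open>From boxes to dual balls\<close>

lemma free_eval_sum: "free_eval \<phi> (\<Sum>i\<in>I. p i) = (\<Sum>i\<in>I. free_eval \<phi> (p i))"
  by (induction I rule: infinite_finite_induct) (auto simp: free_eval_add)

lemma free_eval_const: "free_eval \<phi> (free_const c) = c *\<^sub>R 1"
  by (simp add: free_const_def free_eval_single)

lemma free_eval_gen: "free_eval \<phi> (free_gen v) = \<phi> v"
  by (simp add: free_gen_def free_eval_single)

lemma free_eval_embed_relation: "q \<in> sym_relations \<Longrightarrow> free_eval sym_embed q = 0"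
  by (rule free_eval_sym_relations[OF linear_sym_embed])

text \<open>On the part of the box where \<open>p \<le> -\<epsilon>\<close> the defining relations of \<open>S(V)\<close> have no common zero,
  so by compactness a multiple of a finite sum of their squares lifts \<open>p + \<epsilon>\<close> to a function that is
  nonnegative on the whole box; the functional does not see these squares.  Vectors with \<open>\<rho> v = 0\<close>
  get the radius \<open>1\<close>, because the Bernstein operators need boxes with nonempty interior, and are
  treated as additional relations.\<close>

lemma functional_nonneg_on_dual_ball:
  fixes f :: "'v::real_vector sym_alg"
  assumes pm: "power_module_functional \<sigma> C L M m"
    and \<rho>: "seminorm \<rho>" and i: "i \<ge> 1" and \<sigma>\<rho>: "\<And>v. \<sigma> (sym_embed v) \<le> real i * \<rho> v"
    and f: "\<And>l. l \<in> dual_ball \<rho> i \<Longrightarrow> 0 \<le> hat f l" and g: "g \<in> M"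
  shows "0 \<le> L (g * f)"
proof -
  interpret power_module_functional \<sigma> C L M m by (rule pm)
  obtain p where p: "f = abs_sym_alg p" by (rule sym_alg_abs_cases)
  define r where "r v = (if \<rho> v = 0 then 1 else real i * \<rho> v)" for v
  have \<rho>0: "0 \<le> \<rho> v" for v by (rule seminorm_nonneg[OF \<rho>])
  have r: "0 < r v" "real i * \<rho> v \<le> r v" for v
    using \<rho>0[of v] i by (auto simp: r_def less_le)
  define X where "X = {x. \<forall>v. \<bar>x v\<bar> \<le> r v}"
  define R where "R = sym_relations \<union> {free_gen v | v. \<rho> v = 0}"
  have X: "compact X" unfolding X_def by (rule compact_box)
  have cont: "continuous_on S (\<lambda>x. free_eval x q :: real)" for S and q :: "'v free_comm_alg"
    by (intro continuous_on_free_eval continuous_on_coordinate)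
  \<comment> \<open>A relation is zero in \<open>S(V)\<close>. If \<open>\<rho> v = 0\<close>, then
    \<open>\<sigma>\<close> vanishes at \<open>sym_embed v\<close>, hence at its square, and the
    bound on \<open>L\<close> does the rest.\<close>
  have R0: "L (g * (free_eval sym_embed q * free_eval sym_embed q)) = 0" if q: "q \<in> R" for q
  proof (cases "q \<in> sym_relations")
    case True
    then show ?thesis by (simp add: free_eval_embed_relation linear_0[OF linear])
  next
    case False
    then obtain v where v: "q = free_gen v" "\<rho> v = 0" using q by (auto simp: R_def)
    then have "\<sigma> (sym_embed v) = 0" using \<sigma>\<rho>[of v] seminorm_nonneg[OF seminorm, of "sym_embed v"] by simp
    then have "\<sigma> (sym_embed v * sym_embed v) = 0"
      using submultiplicativeD[OF submult, of "sym_embed v" "sym_embed v"] seminorm_nonneg[OF seminorm]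
      by (metis antisym mult_zero_left)
    then show ?thesis using bound_times[of g "sym_embed v * sym_embed v"] v by (simp add: free_eval_gen)
  qed
  have eps: "- \<epsilon> * L g \<le> L (g * f)" if \<epsilon>: "\<epsilon> > 0" for \<epsilon>
  proof -
    define D where "D = {x\<in>X. free_eval x p \<le> - \<epsilon>}"
    have "D = X \<inter> {x. free_eval x p \<le> - \<epsilon>}" by (auto simp: D_def)
    then have D: "compact D"
      by (simp add: compact_Int_closed[OF X] closed_Collect_le cont)
    \<comment> \<open>A common zero of \<open>R\<close> in the box is a linear functional in the
      dual ball, where \<open>hat f\<close> is nonnegative, contrary to
      \<open>free_eval x p \<le> - \<epsilon>\<close>.\<close>
    have "\<exists>q\<in>R. free_eval x q \<noteq> 0" if x: "x \<in> D" for x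
    proof (rule ccontr)
      assume "\<not> ?thesis"
      then have z: "\<And>q. q \<in> R \<Longrightarrow> free_eval x q = 0" by blast
      have "linear x"
      proof (rule linearI)
        fix v w :: 'v and c :: real
        have "free_gen (v + w) - free_gen v - free_gen w \<in> R" by (auto simp: R_def sym_relations_def)
        from z[OF this] show "x (v + w) = x v + x w" by (simp add: free_eval_diff free_eval_gen)
        have "free_gen (c *\<^sub>R v) - free_const c * free_gen v \<in> R" by (auto simp: R_def sym_relations_def)
        from z[OF this] show "x (c *\<^sub>R v) = c *\<^sub>R x v"
          by (simp add: free_eval_diff free_eval_mult free_eval_const free_eval_gen)
      qed
      moreover have "\<bar>x v\<bar> \<le> real i * \<rho> v" for v
      proof (cases "\<rho> v = 0")
        case True
        then have "free_gen v \<in> R" by (auto simp: R_def)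
        from z[OF this] show ?thesis using True by (simp add: free_eval_gen)
      next
        case False
        then show ?thesis using x by (auto simp: D_def X_def r_def dest: spec[of _ v])
      qed
      ultimately have "Abs_alg_dual x \<in> dual_ball \<rho> i" and "dual_apply (Abs_alg_dual x) = x"
        by (simp_all add: dual_ball_iff[OF \<rho>] Abs_alg_dual_inverse)
      from f[OF this(1)] this(2) have "0 \<le> free_eval x p" by (simp add: p hat_abs)
      then show False using x \<epsilon> by (simp add: D_def)
    qed
    then have "D \<subseteq> (\<Union>q\<in>R. {x. free_eval x q \<noteq> 0})" by blast
    moreover have "open {x. free_eval x q \<noteq> (0::real)}" for q :: "'v free_comm_alg"
      by (intro open_Collect_neq cont continuous_on_const)
    ultimately obtain F where F: "F \<subseteq> R" "finite F" "D \<subseteq> (\<Union>q\<in>F. {x. free_eval x q \<noteq> 0})"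
      using compactE_image[OF D, of R "\<lambda>q. {x. free_eval x q \<noteq> 0}"] by metis
    define s where "s = (\<Sum>q\<in>F. q * q)"
    have s: "free_eval x s = (\<Sum>q\<in>F. free_eval x q * free_eval x q)"
      for x :: "'v \<Rightarrow> 'c::{comm_ring_1,real_algebra_1}"
      by (simp add: s_def free_eval_sum free_eval_mult)
    have s0: "0 \<le> free_eval x s" for x :: "'v \<Rightarrow> real" unfolding s by (intro sum_nonneg) simp
    obtain N where N: "N \<ge> 0" "\<And>x. x \<in> X \<Longrightarrow> 0 \<le> free_eval x p + \<epsilon> + N * free_eval x s"
    proof (cases "D = {}")
      case True
      then show ?thesis using that[of 0] by (force simp: D_def)
    next
      case False
      obtain x0 where x0: "x0 \<in> D" "\<And>x. x \<in> D \<Longrightarrow> free_eval x0 s \<le> free_eval x s"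
        using continuous_attains_inf[OF D False cont, of s] by blast
      have "0 < free_eval x0 s"
      proof -
        obtain q where "q \<in> F" "free_eval x0 q \<noteq> 0" using F x0(1) by blast
        then show ?thesis unfolding s using F(2)
          by (intro sum_pos2[of _ q]) (auto simp: zero_less_mult_iff)
      qed
      obtain x1 where x1: "x1 \<in> D" "\<And>x. x \<in> D \<Longrightarrow> free_eval x1 p \<le> free_eval x p"
        using continuous_attains_inf[OF D False cont, of p] by blast
      \<comment> \<open>The ratio of the worst deficit of \<open>p\<close> on \<open>D\<close> to
        the least value of \<open>s\<close> there, so that \<open>?N * free_eval x s\<close>
        outweighs \<open>p\<close> at every point of \<open>D\<close>.\<close>
      let ?N = "- free_eval x1 p / free_eval x0 s"
      have x1p: "free_eval x1 p \<le> - \<epsilon>" using x1(1) by (simp add: D_def)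
      show ?thesis
      proof (rule that[of ?N])
        show N0: "0 \<le> ?N" using x1p \<epsilon> \<open>0 < free_eval x0 s\<close> by (intro divide_nonneg_pos) auto
        fix x assume x: "x \<in> X"
        show "0 \<le> free_eval x p + \<epsilon> + ?N * free_eval x s"
        proof (cases "x \<in> D")
          case True
          have "- free_eval x1 p = ?N * free_eval x0 s" using \<open>0 < free_eval x0 s\<close> by simp
          also have "\<dots> \<le> ?N * free_eval x s" using N0 x0(2)[OF True] by (intro mult_left_mono)
          finally show ?thesis using x1(2)[OF True] \<epsilon> by simp
        next
          case False
          then have "0 \<le> free_eval x p + \<epsilon>" using x by (simp add: D_def)
          moreover have "0 \<le> ?N * free_eval x s" using N0 s0 by (rule mult_nonneg_nonneg)
          ultimately show ?thesis by linarith
        qed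
      qed
    qed
    define p' where "p' = p + free_const \<epsilon> + free_const N * s"
    have "free_eval sym_embed p' \<in> cone"
    proof (rule free_eval_in_cone[of r])
      show "\<sigma> (sym_embed v) \<le> r v" for v using \<sigma>\<rho>[of v] r(2)[of v] by linarith
      fix x :: "'v \<Rightarrow> real" assume "\<And>v. \<bar>x v\<bar> \<le> r v"
      then have "x \<in> X" by (simp add: X_def)
      from N(2)[OF this] show "0 \<le> free_eval x p'"
        by (simp add: p'_def free_eval_add free_eval_mult free_eval_const)
    qed (rule r)
    then have "0 \<le> L (g * free_eval sym_embed p')" using g by (simp add: cone_def)
    also have "g * free_eval sym_embed p' = g * f + \<epsilon> *\<^sub>R g
        + N *\<^sub>R (\<Sum>q\<in>F. g * (free_eval sym_embed q * free_eval sym_embed q))"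
      by (simp add: p'_def free_eval_add free_eval_mult free_eval_const s p abs_sym_alg_eq_free_eval
          distrib_left sum_distrib_left scaleR_sum_right)
    also have "L \<dots> = L (g * f) + \<epsilon> * L g"
      using R0 F(1) by (simp add: linear_add[OF linear] linear_scale[OF linear] linear_sum[OF linear] subset_eq)
    finally show ?thesis by simp
  qed
  have "- L (g * f) \<le> \<epsilon> * L g" if "\<epsilon> > 0" for \<epsilon> using eps[OF that] by simp
  then have "- L (g * f) \<le> 0" by (rule le_zero_if_le_mult_epsilon[OF _ nonneg[OF g]])
  then show ?thesis by simp
qed

section \<open>Positive functionals on a separating algebra of functions\<close>

text \<open>The hypotheses of Stone-Weierstrass, needed both to extend \<open>L\<close> to
  continuous functions and to approximate negative parts.\<close>

lemma function_ring_on_range: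
  fixes ev :: "'b::{comm_ring_1,real_algebra_1} \<Rightarrow> 'a::t2_space \<Rightarrow> real"
  assumes K: "compact K"
    and cont: "\<And>f. continuous_on K (ev f)"
    and add: "\<And>f g x. ev (f + g) x = ev f x + ev g x"
    and mult: "\<And>f g x. ev (f * g) x = ev f x * ev g x"
    and scale: "\<And>c f x. ev (c *\<^sub>R f) x = c * ev f x"
    and one: "\<And>x. ev 1 x = 1"
    and sep: "\<And>x y. x \<in> K \<Longrightarrow> y \<in> K \<Longrightarrow> x \<noteq> y \<Longrightarrow> \<exists>f. ev f x \<noteq> ev f y"
  shows "function_ring_on (range ev) K"
proof
  show "\<And>f g. f \<in> range ev \<Longrightarrow> g \<in> range ev \<Longrightarrow> (\<lambda>x. f x + g x) \<in> range ev"
    by (auto simp: add[symmetric])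
  show "\<And>f g. f \<in> range ev \<Longrightarrow> g \<in> range ev \<Longrightarrow> (\<lambda>x. f x * g x) \<in> range ev"
    by (auto simp: mult[symmetric])
  show "(\<lambda>_. c) \<in> range ev" for c
    by (rule range_eqI[of _ _ "c *\<^sub>R 1"]) (simp add: scale one fun_eq_iff)
qed (use K cont sep in auto)

text \<open>Extension by density, written as an infimum of \<open>L\<close> over majorants so that
  no approximating sequences are chosen. By positivity, \<open>close\<close> puts the infimum within
  \<open>e * L 1\<close> of \<open>L f\<close> whenever \<open>ev f\<close> is uniformly within
  \<open>e\<close> of \<open>h\<close>; linearity follows by approximation.\<close>

lemma positive_functional_extension:
  fixes ev :: "'b::{comm_ring_1,real_algebra_1} \<Rightarrow> 'a::t2_space \<Rightarrow> real"
  assumes K: "compact K"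
    and cont: "\<And>f. continuous_on K (ev f)"
    and add: "\<And>f g x. ev (f + g) x = ev f x + ev g x"
    and mult: "\<And>f g x. ev (f * g) x = ev f x * ev g x"
    and scale: "\<And>c f x. ev (c *\<^sub>R f) x = c * ev f x"
    and one: "\<And>x. ev 1 x = 1"
    and sep: "\<And>x y. x \<in> K \<Longrightarrow> y \<in> K \<Longrightarrow> x \<noteq> y \<Longrightarrow> \<exists>f. ev f x \<noteq> ev f y"
    and L: "linear L" and pos: "\<And>f. (\<And>x. x \<in> K \<Longrightarrow> 0 \<le> ev f x) \<Longrightarrow> 0 \<le> L f"
  obtains \<Lambda> where "positive_functional K \<Lambda>" "\<And>f. \<Lambda> (ev f) = L f"
proof -
  interpret R: function_ring_on "range ev" K
    using K cont add mult scale one sep by (rule function_ring_on_range)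
  note lin = linear_add[OF L] linear_scale[OF L] linear_diff[OF L]
  define \<Lambda> where "\<Lambda> h = Inf {L f | f. \<forall>x\<in>K. h x \<le> ev f x}" for h
  have mono: "L f \<le> L g" if "\<And>x. x \<in> K \<Longrightarrow> ev f x \<le> ev g x" for f g
  proof -
    have "0 \<le> L (g + (-1) *\<^sub>R f)" 
      by (rule pos) (simp only: add scale, simp add: that)
    then show ?thesis by (simp add: lin)
  qed
  have L1: "0 \<le> L 1" by (rule pos) (simp add: one)
  have close: "\<bar>\<Lambda> h - L f\<bar> \<le> e * L 1" if "\<And>x. x \<in> K \<Longrightarrow> \<bar>h x - ev f x\<bar> \<le> e" for h f e
  proof -
    have up: "\<forall>x\<in>K. h x \<le> ev (f + e *\<^sub>R 1) x"
      using that by (force simp: add scale one abs_le_iff)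
    have low: "L f - e * L 1 \<le> L g" if g: "\<forall>x\<in>K. h x \<le> ev g x" for g
    proof -
      have "L f \<le> L (g + e *\<^sub>R 1)"
        using g \<open>\<And>x. x \<in> K \<Longrightarrow> \<bar>h x - ev f x\<bar> \<le> e\<close>
        by (intro mono) (force simp: add scale one abs_le_iff)
      then show ?thesis by (simp add: lin)
    qed
    have "\<Lambda> h \<le> L (f + e *\<^sub>R 1)"
      unfolding \<Lambda>_def using up low by (intro cInf_lower bdd_belowI[of _ "L f - e * L 1"]) auto
    moreover have "L f - e * L 1 \<le> \<Lambda> h"
      unfolding \<Lambda>_def using up low by (intro cInf_greatest) auto
    ultimately show ?thesis by (simp add: lin abs_le_iff)
  qed
  have approx: "\<exists>f. \<forall>x\<in>K. \<bar>h x - ev f x\<bar> \<le> e" if "continuous_on K h" "e > 0" for h e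
  proof -
    obtain g where "g \<in> range ev" "\<forall>x\<in>K. \<bar>h x - g x\<bar> < e"
      using R.Stone_Weierstrass_basic[OF \<open>continuous_on K h\<close> \<open>e > 0\<close>] by blast
    then show ?thesis by (auto intro: less_imp_le)
  qed
  have small: "a = b" if "\<And>e. e > 0 \<Longrightarrow> \<bar>a - b\<bar> \<le> e * c" "0 \<le> c" for a b c :: real
  proof -
    have "\<bar>a - b\<bar> \<le> 0" using that by (rule le_zero_if_le_mult_epsilon)
    then show ?thesis by simp
  qed
  have "positive_functional K \<Lambda>"
  proof
    show "compact K" by (rule K)
    fix h k :: "'a \<Rightarrow> real" and c :: real assume h: "continuous_on K h"
    {
      assume k: "continuous_on K k"
      show "\<Lambda> (\<lambda>x. h x + k x) = \<Lambda> h + \<Lambda> k"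
      proof (rule small)
        fix e :: real assume e: "e > 0"
        obtain f where f: "\<And>x. x \<in> K \<Longrightarrow> \<bar>h x - ev f x\<bar> \<le> e" using approx[OF h e] by blast
        obtain g where g: "\<And>x. x \<in> K \<Longrightarrow> \<bar>k x - ev g x\<bar> \<le> e" using approx[OF k e] by blast
        have "\<bar>h x + k x - ev (f + g) x\<bar> \<le> 2 * e" if "x \<in> K" for x
          using f[OF that] g[OF that] by (simp add: add)
        from close[OF this] have "\<bar>\<Lambda> (\<lambda>x. h x + k x) - (L f + L g)\<bar> \<le> 2 * e * L 1" by (simp add: lin)
        then show "\<bar>\<Lambda> (\<lambda>x. h x + k x) - (\<Lambda> h + \<Lambda> k)\<bar> \<le> e * (4 * L 1)"
          using close[OF f] close[OF g] by (simp add: abs_le_iff)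
      qed (use L1 in simp)
    }
    show "\<Lambda> (\<lambda>x. c * h x) = c * \<Lambda> h"
    proof (rule small)
      fix e :: real assume e: "e > 0"
      obtain f where f: "\<And>x. x \<in> K \<Longrightarrow> \<bar>h x - ev f x\<bar> \<le> e" using approx[OF h e] by blast
      have "\<bar>c * h x - ev (c *\<^sub>R f) x\<bar> \<le> \<bar>c\<bar> * e" if "x \<in> K" for x
        using mult_left_mono[OF f[OF that], of "\<bar>c\<bar>"]
        by (simp add: scale flip: right_diff_distrib abs_mult)
      from close[OF this] have 1: "\<bar>\<Lambda> (\<lambda>x. c * h x) - c * L f\<bar> \<le> \<bar>c\<bar> * e * L 1" by (simp add: lin)
      have 2: "\<bar>c * \<Lambda> h - c * L f\<bar> \<le> \<bar>c\<bar> * (e * L 1)"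
        using mult_left_mono[OF close[OF f], of "\<bar>c\<bar>"] by (simp flip: right_diff_distrib abs_mult)
      have "e * (2 * \<bar>c\<bar> * L 1) = \<bar>c\<bar> * e * L 1 + \<bar>c\<bar> * (e * L 1)" by simp
      then show "\<bar>\<Lambda> (\<lambda>x. c * h x) - c * \<Lambda> h\<bar> \<le> e * (2 * \<bar>c\<bar> * L 1)"
        using 1 2 by linarith
    qed (use L1 in simp)
    assume h0: "\<And>x. x \<in> K \<Longrightarrow> 0 \<le> h x"
    \<comment> \<open>Supplies a majorant, so that the infimum is not taken over the empty
      set.\<close>
    obtain f where "\<And>x. x \<in> K \<Longrightarrow> \<bar>h x - ev f x\<bar> \<le> 1" using approx[OF h, of 1] by auto
    then have "\<forall>x\<in>K. h x \<le> ev (f + 1) x" by (force simp: add one abs_le_iff)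
    then show "0 \<le> \<Lambda> h"
      unfolding \<Lambda>_def using h0 by (intro cInf_greatest) (auto intro!: pos intro: order_trans)
  qed
  moreover have "\<Lambda> (ev f) = L f" for f
    using close[of "ev f" f 0] by simp
  ultimately show ?thesis by (rule that)
qed

text \<open>The index set may be uncountable. By inner regularity only compact subsets of the union
  count, and each is covered by finitely many of the null sets.\<close>

lemma emeasure_UN_open_null:
  fixes \<mu> :: "'a::t2_space measure"
  assumes sets: "sets \<mu> = sets borel"
    and reg: "\<And>B. B \<in> sets borel \<Longrightarrow> emeasure \<mu> B = (SUP C\<in>{C. compact C \<and> C \<subseteq> B}. emeasure \<mu> C)"
    and U: "\<And>i. i \<in> I \<Longrightarrow> open (U i)" "\<And>i. i \<in> I \<Longrightarrow> emeasure \<mu> (U i) = 0"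
  shows "emeasure \<mu> (\<Union>i\<in>I. U i) = 0"
proof -
  have null: "emeasure \<mu> C = 0" if C: "compact C" "C \<subseteq> (\<Union>i\<in>I. U i)" for C
  proof -
    obtain J where J: "J \<subseteq> I" "finite J" "C \<subseteq> (\<Union>i\<in>J. U i)"
      by (rule compactE_image[OF C(1), of I U]) (use U C in auto)
    have "(\<Union>i\<in>J. U i) \<in> null_sets \<mu>"
      using J U sets by (intro null_sets_UN' countable_finite) (auto simp: null_sets_def)
    then show ?thesis
      using J(3) C(1) sets by (metis borel_compact null_setsD1 null_sets_subset)
  qed
  have "(\<Union>i\<in>I. U i) \<in> sets borel" using U(1) by (intro borel_open open_UN) auto
  from reg[OF this] have "emeasure \<mu> (\<Union>i\<in>I. U i) \<le> 0"
    by (simp only:) (rule SUP_least, simp add: null)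
  then show ?thesis by simp
qed

section \<open>Continuity of integrals over dual balls\<close>

definition sup_seminorm :: "'v::real_vector alg_dual set \<Rightarrow> 'v sym_alg \<Rightarrow> real" where
  "sup_seminorm K f = (SUP l\<in>K. \<bar>hat f l\<bar>)"

lemma sup_seminorm_upper:
  assumes "compact K" "l \<in> K" shows "\<bar>hat f l\<bar> \<le> sup_seminorm K f"
proof -
  have "bdd_above ((\<lambda>l. \<bar>hat f l\<bar>) ` K)"
    by (intro compact_imp_bounded[THEN bounded_imp_bdd_above] compact_continuous_image
        continuous_intros continuous_on_hat assms(1))
  then show ?thesis unfolding sup_seminorm_def by (intro cSUP_upper assms(2))
qed

lemma sup_seminorm_least:
  "K \<noteq> {} \<Longrightarrow> (\<And>l. l \<in> K \<Longrightarrow> \<bar>hat f l\<bar> \<le> c) \<Longrightarrow> sup_seminorm K f \<le> c"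
  unfolding sup_seminorm_def by (rule cSUP_least)

lemma seminorm_sup_seminorm:
  assumes K: "compact K" "K \<noteq> {}"
  shows "seminorm (sup_seminorm K)" "submultiplicative (sup_seminorm K)"
proof -
  note up = sup_seminorm_upper[OF K(1)] and le = sup_seminorm_least[OF K(2)]
  obtain l0 where l0: "l0 \<in> K" using K(2) by blast
  have nn: "0 \<le> sup_seminorm K f" for f
    using up[OF l0, of f] abs_ge_zero order_trans by blast
  have sc: "sup_seminorm K (c *\<^sub>R f) \<le> \<bar>c\<bar> * sup_seminorm K f" for c f
    by (intro le) (simp add: hat_scaleR abs_mult mult_left_mono up)
  have "sup_seminorm K (c *\<^sub>R f) = \<bar>c\<bar> * sup_seminorm K f" for c f
  proof (cases "c = 0")
    case True
    then show ?thesis using sc[of 0 f] nn[of 0] by simp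
  next
    case False
    then have "sup_seminorm K f \<le> \<bar>1 / c\<bar> * sup_seminorm K (c *\<^sub>R f)" using sc[of "1 / c" "c *\<^sub>R f"] by simp
    then show ?thesis using sc[of c f] False by (simp add: field_simps)
  qed
  moreover have "sup_seminorm K (f + g) \<le> sup_seminorm K f + sup_seminorm K g" for f g
  proof (rule le)
    fix l assume "l \<in> K"
    then show "\<bar>hat (f + g) l\<bar> \<le> sup_seminorm K f + sup_seminorm K g"
      using up[of l f] up[of l g] by (simp add: hat_add)
  qed
  ultimately show "seminorm (sup_seminorm K)" using nn by (simp add: seminorm_def)
  show "submultiplicative (sup_seminorm K)"
    unfolding submultiplicative_def
    by (intro allI le) (simp add: hat_mult abs_mult mult_mono up nn)
qed

lemma continuous_of_integral_representation:
  fixes \<mu> :: "'v::real_vector alg_dual measure"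
  assumes S: "\<forall>\<rho>\<in>S. seminorm \<rho>" and fin: "finest_lmc_extension (seminorm_topology S) \<tau>bar"
    and \<rho>: "\<rho> \<in> S" and i: "i \<ge> 1" and L: "linear L"
    and sets: "sets \<mu> = sets borel"
    and int: "\<And>f. integrable \<mu> (hat f)" and rep: "\<And>f. L f = (\<integral>l. hat f l \<partial>\<mu>)"
    and supp: "AE l in \<mu>. l \<in> dual_ball \<rho> i"
  shows "continuous_map \<tau>bar euclideanreal L"
proof -
  let ?K = "dual_ball \<rho> i" and ?\<sigma> = "sup_seminorm (dual_ball \<rho> i)"
  have s\<rho>: "seminorm \<rho>" using S \<rho> by blast
  have K: "compact ?K" "?K \<noteq> {}" using compact_dual_ball[OF s\<rho>] zero_in_dual_ball[OF s\<rho>] by auto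
  note sn = seminorm_sup_seminorm[OF K]
  have emb: "?\<sigma> (sym_embed v) \<le> real i * \<rho> v" for v
    by (rule sup_seminorm_least[OF K(2)]) (simp add: hat_embed dual_ball_iff[OF s\<rho>])
  \<comment> \<open>Integrability of \<open>hat 1\<close> makes \<open>\<mu>\<close> finite with
    total mass \<open>L 1\<close>; a Radon measure as defined here is only locally finite.\<close>
  have int1: "integrable \<mu> (\<lambda>l. 1 :: real)" using int[of 1] by (simp add: hat_one[abs_def])
  have bd: "\<bar>L f\<bar> \<le> L 1 * ?\<sigma> f" for f
  proof -
    have "\<bar>L f\<bar> \<le> (\<integral>l. \<bar>hat f l\<bar> \<partial>\<mu>)" unfolding rep by (rule integral_abs_bound)
    also have "\<dots> \<le> (\<integral>l. ?\<sigma> f * 1 \<partial>\<mu>)"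
      using supp by (intro integral_mono_AE integrable_mult_right int1 integrable_abs int)
        (auto elim!: eventually_mono intro: sup_seminorm_upper[OF K(1)])
    also have "\<dots> = ?\<sigma> f * L 1" unfolding rep[of 1] hat_one[abs_def] by (rule integral_mult_right_zero)
    finally show ?thesis by (simp add: mult.commute)
  qed
  have top: "topspace \<tau>bar = UNIV"
    using fin unfolding finest_lmc_extension_def lmc_topology_def by auto
  show ?thesis
    using i by (intro linear_continuous_of_bound[OF L bd top _ sn(1)]
        finest_lmc_extension_ball_open[OF fin S \<rho> sn emb]) auto
qed

section \<open>Locating the support and the representation\<close>

text \<open>For the negative part \<open>h\<close> of \<open>hat g\<close> one has
  \<open>hat g l * h l = - (h l)^2\<close>, so positivity tested with approximations of
  \<open>h\<close> forces the integral of the square of \<open>h\<close> to vanish.\<close>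

lemma AE_in_nonneg_set:
  fixes \<mu> :: "'v::real_vector alg_dual measure"
  assumes K: "compact K" and sets: "sets \<mu> = sets borel" and finm: "finite_measure \<mu>"
    and AE: "AE l in \<mu>. l \<in> K" and int: "\<And>h. continuous_on UNIV h \<Longrightarrow> integrable \<mu> (h :: _ \<Rightarrow> real)"
    and approx: "\<And>h e. continuous_on K h \<Longrightarrow> e > 0 \<Longrightarrow> \<exists>f. \<forall>l\<in>K. \<bar>h l - hat f l\<bar> < e"
    and pos: "\<And>f. (\<And>l. l \<in> K \<Longrightarrow> 0 \<le> hat f l) \<Longrightarrow> 0 \<le> (\<integral>l. hat (g * f) l \<partial>\<mu>)"
  shows "AE l in \<mu>. 0 \<le> hat g l"
proof -
  interpret finite_measure \<mu> by (rule finm)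
  define h where "h l = max 0 (- hat g l)" for l
  have ch: "continuous_on A h" for A unfolding h_def by (intro continuous_intros continuous_on_hat)
  have int_hat: "integrable \<mu> (hat f)" for f by (intro int continuous_on_hat)
  have int_sq: "integrable \<mu> (\<lambda>l. (h l)\<^sup>2)" by (intro int continuous_intros ch)
  let ?B = "\<integral>l. \<bar>hat g l\<bar> \<partial>\<mu>"
  have key: "(\<integral>l. (h l)\<^sup>2 \<partial>\<mu>) \<le> e * (2 * ?B)" if e: "e > 0" for e
  proof -
    \<comment> \<open>The target is \<open>h + e\<close> instead of \<open>h\<close>: an
      approximation within \<open>e\<close> is then nonnegative on \<open>K\<close>, as
      \<open>pos\<close> requires, and still within \<open>2 * e\<close> of
      \<open>h\<close>.\<close>
    obtain f where f: "\<And>l. l \<in> K \<Longrightarrow> \<bar>h l + e - hat f l\<bar> < e"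
      using approx[OF continuous_on_add[OF ch continuous_on_const] e, of e] by blast
    have "0 \<le> hat f l" if "l \<in> K" for l
    proof -
      have "0 \<le> h l" by (simp add: h_def)
      then show ?thesis using f[OF that] by (simp add: abs_less_iff)
    qed
    then have "0 \<le> (\<integral>l. hat (g * f) l \<partial>\<mu>)" by (rule pos)
    also have "\<dots> \<le> (\<integral>l. - ((h l)\<^sup>2) + 2 * e * \<bar>hat g l\<bar> \<partial>\<mu>)"
    proof (rule integral_mono_AE[OF int_hat])
      show "integrable \<mu> (\<lambda>l. - ((h l)\<^sup>2) + 2 * e * \<bar>hat g l\<bar>)"
        by (intro int continuous_intros ch continuous_on_hat)
      show "AE l in \<mu>. hat (g * f) l \<le> - ((h l)\<^sup>2) + 2 * e * \<bar>hat g l\<bar>"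
        using AE
      proof eventually_elim
        case (elim l)
        have "hat g l * h l = - ((h l)\<^sup>2)" by (simp add: h_def max_def power2_eq_square)
        moreover have "hat g l * (hat f l - h l) \<le> \<bar>hat g l\<bar> * (2 * e)"
        proof -
          have "\<bar>hat f l - h l\<bar> \<le> 2 * e" using f[OF elim] by linarith
          then have "\<bar>hat g l * (hat f l - h l)\<bar> \<le> \<bar>hat g l\<bar> * (2 * e)"
            unfolding abs_mult by (intro mult_left_mono) auto
          then show ?thesis by linarith
        qed
        ultimately show ?case by (simp add: hat_mult algebra_simps)
      qed
    qed
    also have "\<dots> = - (\<integral>l. (h l)\<^sup>2 \<partial>\<mu>) + 2 * e * ?B"
      using int_sq integrable_abs[OF int_hat[of g]] by simp
    finally show ?thesis by simp
  qed
  have "(\<integral>l. (h l)\<^sup>2 \<partial>\<mu>) \<le> 0"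
    by (rule le_zero_if_le_mult_epsilon[OF key]) simp_all
  moreover have "0 \<le> (\<integral>l. (h l)\<^sup>2 \<partial>\<mu>)" by (intro Bochner_Integration.integral_nonneg) simp
  ultimately have "AE l in \<mu>. (h l)\<^sup>2 = 0"
    using integral_nonneg_eq_0_iff_AE[OF int_sq] by simp
  then show ?thesis by eventually_elim (simp add: h_def max_def split: if_splits)
qed

lemma integral_representation_of_continuous:
  fixes L :: "'v::real_vector sym_alg \<Rightarrow> real"
  assumes S: "\<forall>\<rho>\<in>S. seminorm \<rho>" "directed_family S"
    and fin: "finest_lmc_extension (seminorm_topology S) \<tau>bar"
    and m: "m \<ge> 1" and M: "power_module m M" and L: "linear L"
    and cont: "continuous_map \<tau>bar euclideanreal L" and nonneg: "L ` M \<subseteq> {0..}"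
  shows "\<exists>\<rho>\<in>S. \<exists>i::nat. i \<ge> 1 \<and> (\<exists>\<mu> :: 'v alg_dual measure.
       radon_measure \<mu> \<and>
       (\<forall>f. integrable \<mu> (hat f) \<and> L f = (\<integral>l. hat f l \<partial>\<mu>)) \<and>
       supported_by \<mu> (nonneg_set M \<inter> dual_ball \<rho> i))"
proof -
  have lmc: "lmc_topology \<tau>bar" and ext: "pullback_topology UNIV sym_embed \<tau>bar = seminorm_topology S"
    using fin by (auto simp: finest_lmc_extension_def extends_topology_def)
  obtain \<sigma> C where \<sigma>: "seminorm \<sigma>" "submultiplicative \<sigma>" and C: "C > 0" "\<And>f. \<bar>L f\<bar> \<le> C * \<sigma> f"
    and op: "openin \<tau>bar {f. \<sigma> f < 1}"
    using continuous_functional_bound[OF lmc L cont] by blast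
  have "openin (seminorm_topology S) {v. \<sigma> (sym_embed v) < 1}"
    using op unfolding ext[symmetric] openin_pullback_topology by (auto simp: vimage_def)
  moreover have "seminorm (\<lambda>v. \<sigma> (sym_embed v))"
    using \<sigma>(1) by (simp add: seminorm_def linear_add[OF linear_sym_embed] linear_scale[OF linear_sym_embed])
  ultimately obtain \<rho> i where \<rho>: "\<rho> \<in> S" and i: "i \<ge> 1" and \<sigma>\<rho>: "\<And>v. \<sigma> (sym_embed v) \<le> real i * \<rho> v"
    using seminorm_bound_of_open_unit_ball[OF S(2,1)] by blast
  have s\<rho>: "seminorm \<rho>" using S(1) \<rho> by blast
  have pm: "power_module_functional \<sigma> C L M m"
    by (rule power_module_functional.intro) (use \<sigma> C L M m nonneg in auto)
  let ?K = "dual_ball \<rho> i"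
  have K: "compact ?K" by (rule compact_dual_ball[OF s\<rho>])
  have pos: "0 \<le> L (g * f)" if "\<And>l. l \<in> ?K \<Longrightarrow> 0 \<le> hat f l" "g \<in> M" for f g
    using functional_nonneg_on_dual_ball[OF pm s\<rho> i \<sigma>\<rho>] that by blast
  have oneM: "1 \<in> M" using M by (simp add: power_module_def)
  have sep: "\<exists>f. hat f k \<noteq> hat f l" if "k \<noteq> l" for k l :: "'v alg_dual"
  proof -
    have "dual_apply k \<noteq> dual_apply l" using that by (simp add: dual_apply_inject)
    then obtain v where "dual_apply k v \<noteq> dual_apply l v" by (auto simp: fun_eq_iff)
    then show ?thesis by (intro exI[of _ "sym_embed v"]) (simp add: hat_embed)
  qed
  obtain \<Lambda> where \<Lambda>: "positive_functional ?K \<Lambda>" "\<And>f. \<Lambda> (hat f) = L f"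
    by (rule positive_functional_extension[OF K continuous_on_hat hat_add hat_mult hat_scaleR hat_one _ L])
       (use sep pos[OF _ oneM] in auto)
  interpret positive_functional ?K \<Lambda> by (rule \<Lambda>(1))
  let ?\<mu> = riesz_measure
  have int: "integrable ?\<mu> (hat f)" and rep: "L f = (\<integral>l. hat f l \<partial>?\<mu>)" for f
    using riesz_integrable[OF continuous_on_hat] riesz_integral[OF continuous_on_hat] \<Lambda>(2) by auto
  have "radon_measure ?\<mu>"
    unfolding radon_measure_def
  proof (intro conjI allI ballI)
    show "\<exists>U. open U \<and> x \<in> U \<and> emeasure ?\<mu> U < \<infinity>" for x
      by (intro exI[of _ UNIV]) (simp add: emeasure_riesz_measure_open open_mass_UNIV)
  qed (auto intro: riesz_inner_regular)
  moreover have "supported_by ?\<mu> (nonneg_set M \<inter> ?K)"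
  proof -
    have op: "open {l. hat g l < 0}" for g :: "'v sym_alg"
      by (rule open_Collect_less[OF continuous_on_hat continuous_on_const])
    interpret R: function_ring_on "range hat" ?K
      using K continuous_on_hat hat_add hat_mult hat_scaleR hat_one sep by (rule function_ring_on_range)
    have "emeasure ?\<mu> {l. hat g l < 0} = 0" if g: "g \<in> M" for g
    proof -
      have "AE l in ?\<mu>. 0 \<le> hat g l"
      proof (rule AE_in_nonneg_set[OF K sets_riesz_measure finite_measure_riesz_measure AE_riesz riesz_integrable])
        show "\<exists>f. \<forall>l\<in>?K. \<bar>h l - hat f l\<bar> < e" if "continuous_on ?K h" "e > 0" for h e
          using R.Stone_Weierstrass_basic[OF that] by blast
        show "0 \<le> (\<integral>l. hat (g * f) l \<partial>?\<mu>)" if "\<And>l. l \<in> ?K \<Longrightarrow> 0 \<le> hat f l" for f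
          using pos[OF that g] rep by simp
      qed
      then show ?thesis
        using op[of g] by (subst (asm) AE_iff_measurable[of "{l. hat g l < 0}"]) (auto simp: not_le)
    qed
    then have "emeasure ?\<mu> (\<Union>g\<in>M. {l. hat g l < 0}) = 0"
      using op by (intro emeasure_UN_open_null riesz_inner_regular) auto
    then have "(\<Union>g\<in>M. {l. hat g l < 0}) \<in> null_sets ?\<mu>"
      using op open_UN[of M "\<lambda>g. {l. hat g l < 0}"] by (intro null_setsI) (simp_all add: borel_open)
    moreover have "UNIV - ?K \<in> null_sets ?\<mu>"
      using emeasure_riesz_compl compact_imp_closed[OF K] by (auto simp: null_sets_def)
    ultimately have "(\<Union>g\<in>M. {l. hat g l < 0}) \<union> (UNIV - ?K) \<in> null_sets ?\<mu>" by (rule null_sets.Un)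
    moreover have eq: "UNIV - (nonneg_set M \<inter> ?K) = (\<Union>g\<in>M. {l. hat g l < 0}) \<union> (UNIV - ?K)"
      by (auto simp: nonneg_set_def not_le)
    ultimately have "emeasure ?\<mu> (UNIV - (nonneg_set M \<inter> ?K)) = 0" by auto
    moreover have "open (UNIV - (nonneg_set M \<inter> ?K))"
      unfolding eq using op compact_imp_closed[OF K] by auto
    then have "nonneg_set M \<inter> ?K \<in> sets borel"
      by (metis borel_closed closed_def Compl_eq_Diff_UNIV)
    ultimately show ?thesis by (simp add: supported_by_def)
  qed
  ultimately show ?thesis using \<rho> i int rep by blast
qed

theorem theorem1p1:
  fixes S :: "('v::real_vector \<Rightarrow> real) set"
    and \<tau> :: "'v topology"
    and \<tau>bar :: "'v sym_alg topology"
    and d :: nat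
    and M :: "'v sym_alg set"
    and L :: "'v sym_alg \<Rightarrow> real"
  assumes "\<forall>\<rho>\<in>S. seminorm \<rho>"
    and "directed_family S"
    and "\<tau> = seminorm_topology S"
    and "finest_lmc_extension \<tau> \<tau>bar"
    and "d \<ge> 1"
    and "power_module (2 * d) M"
    and "linear L"
  shows "(continuous_map \<tau>bar euclideanreal L \<and> L ` M \<subseteq> {0..}) \<longleftrightarrow>
    (\<exists>\<rho>\<in>S. \<exists>i::nat. i \<ge> 1 \<and> (\<exists>\<mu> :: 'v alg_dual measure.
       radon_measure \<mu> \<and>
       (\<forall>f. integrable \<mu> (hat f) \<and> L f = (\<integral>l. hat f l \<partial>\<mu>)) \<and>
       supported_by \<mu> (nonneg_set M \<inter> dual_ball \<rho> i)))"
proof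
  assume "continuous_map \<tau>bar euclideanreal L \<and> L ` M \<subseteq> {0..}"
  then show "\<exists>\<rho>\<in>S. \<exists>i::nat. i \<ge> 1 \<and> (\<exists>\<mu> :: 'v alg_dual measure.
       radon_measure \<mu> \<and>
       (\<forall>f. integrable \<mu> (hat f) \<and> L f = (\<integral>l. hat f l \<partial>\<mu>)) \<and>
       supported_by \<mu> (nonneg_set M \<inter> dual_ball \<rho> i))"
    using assms by (intro integral_representation_of_continuous[where m = "2 * d"]) auto
next
  assume "\<exists>\<rho>\<in>S. \<exists>i::nat. i \<ge> 1 \<and> (\<exists>\<mu> :: 'v alg_dual measure.
       radon_measure \<mu> \<and>
       (\<forall>f. integrable \<mu> (hat f) \<and> L f = (\<integral>l. hat f l \<partial>\<mu>)) \<and>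
       supported_by \<mu> (nonneg_set M \<inter> dual_ball \<rho> i))"
  then obtain \<rho> i and \<mu> :: "'v alg_dual measure" where \<rho>: "\<rho> \<in> S" "i \<ge> 1"
    and \<mu>: "radon_measure \<mu>" "\<And>f. integrable \<mu> (hat f)" "\<And>f. L f = (\<integral>l. hat f l \<partial>\<mu>)"
      "supported_by \<mu> (nonneg_set M \<inter> dual_ball \<rho> i)"
    by blast
  have sets: "sets \<mu> = sets borel" using \<mu>(1) by (simp add: radon_measure_def)
  have "UNIV - (nonneg_set M \<inter> dual_ball \<rho> i) \<in> null_sets \<mu>"
    using \<mu>(4) by (intro null_setsI) (auto simp: supported_by_def sets)
  then have AE: "AE l in \<mu>. l \<in> nonneg_set M \<inter> dual_ball \<rho> i"
    by (rule AE_I') auto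
  have "continuous_map \<tau>bar euclideanreal L"
  proof (rule continuous_of_integral_representation[OF assms(1) _ \<rho> assms(7) sets \<mu>(2,3)])
    show "finest_lmc_extension (seminorm_topology S) \<tau>bar" using assms(3,4) by simp
    show "AE l in \<mu>. l \<in> dual_ball \<rho> i" using AE by eventually_elim simp
  qed
  moreover have "0 \<le> L g" if "g \<in> M" for g
    unfolding \<mu>(3) using AE that
    by (intro integral_nonneg_AE) (auto elim!: eventually_mono simp: nonneg_set_def)
  ultimately show "continuous_map \<tau>bar euclideanreal L \<and> L ` M \<subseteq> {0..}" by auto
qed

end
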